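(* Let $H$ be an $(n+1)\times n$ integer matrix of rank $n$ in reduced Hermite normal form, and let $b\in\mathbb{Z}^{n+1}$ be such that $P(H,b)$ is a simplex. Let $\Delta=\Delta(H)$ and let $\Delta(H,b)$ be the maximum absolute value of the $n\times n$ minors of the augmented matrix $(H\,b)$. If $P(H,b)\cap\mathbb{Z}^n=\emptyset$, then the problem of computing $\mathrm{width}(P(H,b))$ and a flat direction of $P(H,b)$ can be solved by an algorithm with complexity $$O\bigl(\log\Delta\cdot n^4\cdot\Delta^4\cdot\mathrm{mult}(n^3\log\Delta(H,b)+n^3\log n)\bigr).$$
   Context: $P(H,b)=\{x\in\mathbb{R}^n : Hx\le b\}$. For an integer matrix $A$, $\Delta_k(A)$ is the greatest absolute value of the determinants of all $k\times k$ submatrices of $A$, and $\Delta(A)=\Delta_{\mathrm{rank}(A)}(A)$. The width of a convex body $P\subset\mathbb{R}^n$ is $\mathrm{width}(P)=\min_{c\in\mathbb{Z}^n\setminus\{0\}}\bigl(\max_{x\in P}c^\top x-\min_{x\in P}c^\top x\bigr)$; a vector $c\in\mathbb{Z}^n\setminus\{0\}$ attaining this minimum is a flat direction of $P$. Reduced Hermite normal form: write $H_B$ for the $n\times n$ matrix of the first $n$ rows of $H$. $H$ is in reduced Hermite normal form if $H_B$ is non-singular and lower triangular, $0\le H_{ij}<H_{ii}$ for all $1\le j<i\le n$, and there is $s\in\{0,\dots,n\}$ with $H_{ii}=1$ for $i\le s$ and $H_{ii}\ge 2$ for $s<i\le n$ (so the first $s$ rows of $H_B$ are those of the identity matrix).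 $\mathrm{mult}(k)$ is the bit complexity of multiplying two integers of bit size $k$. *)

theory Defs
  imports
    Complex_Main
    "HOL-Library.Log_Nat"
    "Jordan_Normal_Form.DL_Rank"
    "Jordan_Normal_Form.DL_Submatrix"
begin

section \<open>Minors\<close>

definition max_minor :: "nat \<Rightarrow> int mat \<Rightarrow> int" where
  "max_minor k A = Max {\<bar>det (submatrix A I J)\<bar> | I J.
     I \<subseteq> {..<dim_row A} \<and> J \<subseteq> {..<dim_col A} \<and> card I = k \<and> card J = k}"

definition int_rank :: "int mat \<Rightarrow> nat" where
  "int_rank A = vec_space.rank (dim_row A) (map_mat rat_of_int A)"

definition Delta :: "int mat \<Rightarrow> int" where
  "Delta A = max_minor (int_rank A) A"

definition augmented :: "int mat \<Rightarrow> int vec \<Rightarrow> int mat" where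
  "augmented H b = mat_of_cols (dim_row H) (cols H @ [b])"

definition Delta_aug :: "int mat \<Rightarrow> int vec \<Rightarrow> int" where
  "Delta_aug H b = max_minor (dim_col H) (augmented H b)"


section \<open>Reduced Hermite normal form\<close>

definition first_rows :: "nat \<Rightarrow> 'a mat \<Rightarrow> 'a mat" where
  "first_rows n H = mat n (dim_col H) (\<lambda>(i, j). H $$ (i, j))"

definition reduced_HNF :: "nat \<Rightarrow> int mat \<Rightarrow> bool" where
  "reduced_HNF n H \<longleftrightarrow>
     det (first_rows n H) \<noteq> 0 \<and>
     (\<forall>i<n. \<forall>j<n. i < j \<longrightarrow> H $$ (i, j) = 0) \<and>
     (\<forall>i<n. \<forall>j<i. 0 \<le> H $$ (i, j) \<and> H $$ (i, j) < H $$ (i, i)) \<and>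
     (\<exists>s\<le>n. (\<forall>i<s. H $$ (i, i) = 1) \<and> (\<forall>i. s \<le> i \<and> i < n \<longrightarrow> H $$ (i, i) \<ge> 2))"


section \<open>Polyhedra, simplices and width\<close>

definition polyhedron :: "int mat \<Rightarrow> int vec \<Rightarrow> real vec set" where
  "polyhedron H b = {x \<in> carrier_vec (dim_col H).
     map_mat real_of_int H *\<^sub>v x \<le> map_vec real_of_int b}"

definition int_points :: "nat \<Rightarrow> real vec set" where
  "int_points n = map_vec real_of_int ` carrier_vec n"

text \<open>An \<open>n\<close>-dimensional simplex in \<open>n\<close>-space: the convex hull of \<open>n + 1\<close> affinely
  independent points \<open>v 0, \<dots>, v n\<close>.\<close>

definition affinely_independent :: "nat \<Rightarrow> (nat \<Rightarrow> real vec) \<Rightarrow> bool" where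
  "affinely_independent n v \<longleftrightarrow>
     (\<forall>u. (\<Sum>i\<le>n. u i) = 0 \<and> (\<forall>j<n. (\<Sum>i\<le>n. u i * v i $ j) = 0) \<longrightarrow> (\<forall>i\<le>n. u i = 0))"

definition hull_of :: "nat \<Rightarrow> (nat \<Rightarrow> real vec) \<Rightarrow> real vec set" where
  "hull_of n v = {vec n (\<lambda>j. \<Sum>i\<le>n. u i * v i $ j) | u.
     (\<forall>i\<le>n. 0 \<le> u i) \<and> (\<Sum>i\<le>n. u i) = 1}"

definition is_simplex :: "nat \<Rightarrow> real vec set \<Rightarrow> bool" where
  "is_simplex n S \<longleftrightarrow>
     (\<exists>v. (\<forall>i\<le>n. v i \<in> carrier_vec n) \<and> affinely_independent n v \<and> S = hull_of n v)"

text \<open>Maxima and minima are written as suprema and infima in the reals; they are attained for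
  the compact full-dimensional sets considered here.\<close>

definition width_along :: "real vec set \<Rightarrow> int vec \<Rightarrow> real" where
  "width_along P c =
     (SUP x\<in>P. map_vec real_of_int c \<bullet> x) - (INF x\<in>P. map_vec real_of_int c \<bullet> x)"

definition width :: "nat \<Rightarrow> real vec set \<Rightarrow> real" where
  "width n P = (INF c \<in> carrier_vec n - {0\<^sub>v n}. width_along P c)"

definition flat_direction :: "nat \<Rightarrow> real vec set \<Rightarrow> int vec \<Rightarrow> bool" where
  "flat_direction n P c \<longleftrightarrow> c \<in> carrier_vec n - {0\<^sub>v n} \<and> width_along P c = width n P"


section \<open>Bit complexity\<close>

text \<open>
  Complexity is measured on a random access machine in the style of Cook and Reckhow
  (\<^emph>\<open>Time bounded random access machines\<close>, 1973) under the logarithmic cost criterion: registers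
  hold integers, and an instruction costs the number of binary digits of the integers (contents
  and computed addresses) that it handles. Control flow is structured (sequence, conditional,
  loop) instead of using jumps. Besides addition and subtraction there are shifts, also
  at linear cost, so that bits can be packed and unpacked efficiently. There is no
  multiplication or division instruction. Reading past the end of the input, a negative address
  and a negative shift distance have no transition.
\<close>

definition bit_size :: "int \<Rightarrow> nat" where
  "bit_size x = max 1 (floorlog 2 (nat \<bar>x\<bar>))"

type_synonym reg = nat

datatype program =
    Assign reg int
  | Add reg reg reg
  | Sub reg reg reg
  | Shift_Left reg reg reg
  | Shift_Right reg reg reg
  | Load reg reg
  | Store reg reg
  | Read reg
  | Print reg
  | Seq program program
  | Cond reg program program
  | While reg program

text \<open>A configuration consists of the register contents, the remaining input and the output
  printed so far. In \<open>exec p s t s'\<close>, the number \<open>t\<close> is the cost of running \<open>p\<close> from \<open>s\<close> to \<open>s'\<close>.\<close>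

type_synonym config = "(reg \<Rightarrow> int) \<times> int list \<times> int list"

inductive exec :: "program \<Rightarrow> config \<Rightarrow> nat \<Rightarrow> config \<Rightarrow> bool" where
  Assign: "exec (Assign i c) (R, inp, out) (bit_size c) (R(i := c), inp, out)"
| Add: "exec (Add i j k) (R, inp, out)
    (bit_size (R j) + bit_size (R k)) (R(i := R j + R k), inp, out)"
| Sub: "exec (Sub i j k) (R, inp, out)
    (bit_size (R j) + bit_size (R k)) (R(i := R j - R k), inp, out)"
| Shift_Left: "0 \<le> R k \<Longrightarrow> y = R j * 2 ^ nat (R k) \<Longrightarrow>
    exec (Shift_Left i j k) (R, inp, out)
      (bit_size (R j) + bit_size (R k) + bit_size y) (R(i := y), inp, out)"
| Shift_Right: "0 \<le> R k \<Longrightarrow>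
    exec (Shift_Right i j k) (R, inp, out)
      (bit_size (R j) + bit_size (R k)) (R(i := R j div 2 ^ nat (R k)), inp, out)"
| Load: "0 \<le> R j \<Longrightarrow>
    exec (Load i j) (R, inp, out)
      (bit_size (R j) + bit_size (R (nat (R j)))) (R(i := R (nat (R j))), inp, out)"
| Store: "0 \<le> R i \<Longrightarrow>
    exec (Store i j) (R, inp, out)
      (bit_size (R i) + bit_size (R j)) (R(nat (R i) := R j), inp, out)"
| Read: "exec (Read i) (R, x # inp, out) (bit_size x) (R(i := x), inp, out)"
| Print: "exec (Print i) (R, inp, out) (bit_size (R i)) (R, inp, out @ [R i])"
| Seq: "exec p s t s' \<Longrightarrow> exec q s' t' s'' \<Longrightarrow> exec (Seq p q) s (t + t') s''"
| Cond_True: "R i > 0 \<Longrightarrow> exec p (R, inp, out) t s' \<Longrightarrow>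
    exec (Cond i p q) (R, inp, out) (bit_size (R i) + t) s'"
| Cond_False: "R i \<le> 0 \<Longrightarrow> exec q (R, inp, out) t s' \<Longrightarrow>
    exec (Cond i p q) (R, inp, out) (bit_size (R i) + t) s'"
| While_True: "R i > 0 \<Longrightarrow> exec p (R, inp, out) t s' \<Longrightarrow> exec (While i p) s' t' s'' \<Longrightarrow>
    exec (While i p) (R, inp, out) (bit_size (R i) + t + t') s''"
| While_False: "R i \<le> 0 \<Longrightarrow>
    exec (While i p) (R, inp, out) (bit_size (R i)) (R, inp, out)"

definition computes :: "program \<Rightarrow> int list \<Rightarrow> nat \<Rightarrow> int list \<Rightarrow> bool" where
  "computes p inp t out \<longleftrightarrow> (\<exists>R rest. exec p (\<lambda>_. 0, inp, []) t (R, rest, out))"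

text \<open>Some program multiplies any two integers of at most \<open>k\<close> bits in time at most \<open>f k\<close>. As this
  admits every upper bound of the worst-case running time, the exact worst-case running time of
  any multiplication program is an instance.\<close>

definition multiplication_time :: "(nat \<Rightarrow> real) \<Rightarrow> bool" where
  "multiplication_time f \<longleftrightarrow>
     (\<exists>p. \<forall>k x y. bit_size x \<le> k \<and> bit_size y \<le> k \<longrightarrow>
        (\<exists>t. computes p [x, y] t [x * y] \<and> real t \<le> f k))"

text \<open>The dimension, the matrix row by row, and the right-hand side.\<close>

definition encode_instance :: "nat \<Rightarrow> int mat \<Rightarrow> int vec \<Rightarrow> int list" where
  "encode_instance n H b = int n # concat (mat_to_list H) @ list_of_vec b"

text \<open>The width of a rational polytope is rational. It is output as a numerator and a positive
  denominator (not necessarily in lowest terms), followed by the flat direction.\<close>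

definition solves_width_in_time ::
  "program \<Rightarrow> nat \<Rightarrow> int mat \<Rightarrow> int vec \<Rightarrow> real \<Rightarrow> bool" where
  "solves_width_in_time prog n H b T \<longleftrightarrow>
     (\<exists>t num den c.
        computes prog (encode_instance n H b) t (num # den # list_of_vec c) \<and>
        den > 0 \<and>
        width n (polyhedron H b) = real_of_int num / real_of_int den \<and>
        flat_direction n (polyhedron H b) c \<and>
        real t \<le> T)"

end

theory Submission
  imports Defs
begin

text \<open>
  Let \<open>lam\<^sub>j > 0\<close> be the coefficients of the linear relation between the rows \<open>h\<^sub>j\<close> of \<open>H\<close>, namely the
  maximal minors of \<open>H\<close> up to sign, and let \<open>\<beta> = \<Sum>\<^sub>j lam\<^sub>j b\<^sub>j > 0\<close>. In terms of the slacks \<open>y\<^sub>j\<close> the simplex is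
  \<open>{y \<ge> 0. \<Sum>\<^sub>j lam\<^sub>j y\<^sub>j = \<beta>}\<close>. Hence the width along \<open>c = \<Sum>\<^sub>j t\<^sub>j h\<^sub>j\<close> is \<open>\<beta>\<close> times the difference
  between the maximum and the minimum of \<open>t\<^sub>j / lam\<^sub>j\<close>, and \<open>b\<close> only enters through the factor \<open>\<beta>\<close>. As \<open>t\<close> is determined
  up to multiples of \<open>lam\<close>, we may assume \<open>t \<ge> 0\<close> and \<open>t\<^sub>i = 0\<close> for some \<open>i\<close>. Replacing all
  \<open>t\<^sub>j\<close> by their fractional parts then does not increase the width, so it suffices to consider
  the finitely many \<open>t\<close> in \<open>[0, 1)\<close> (and single rows in place of \<open>t = 0\<close>). They are enumerated by
  triples \<open>(a, i, m)\<close>: \<open>a < lam\<^sub>n\<close> encodes an element of the group \<open>\<int>\<^sup>n / \<int>\<^sup>n H\<^sub>B\<close>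
  and \<open>m < lam\<^sub>i\<close> the integral shift after which \<open>t\<^sub>i\<close> vanishes.

  These are at most \<open>(n + 1) \<Delta>\<^sup>2\<close> candidates, whose numerators and denominators are polynomial in \<open>\<Delta>\<close>.
  The time bound therefore leaves room for multiplying and dividing by repeated addition and
  subtraction, and the assumed multiplication program only serves to bound \<open>mult_time\<close> from below. That the simplex
  contains no lattice point gives \<open>\<Delta> \<ge> 2\<close>: otherwise \<open>H\<^sub>B\<close> is the identity and \<open>b\<close> restricted to the
  first \<open>n\<close> rows is a lattice point of the simplex.
\<close>

section \<open>Counting instructions\<close>

text \<open>Fractional parts do no harm because \<open>t\<close> is nonnegative with a zero entry:
  the minimum of \<open>t_j / lam_j\<close> stays 0 and the maximum can only drop. The range of
  \<open>m\<close> has an arithmetic origin. Write \<open>t = tau / lam_n + v + g lam\<close> with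
  \<open>tau\<close> determined by the coset of \<open>c\<close> and \<open>v\<close> integral. Then
  \<open>t_i = 0\<close> determines \<open>g\<close>, and modulo integers \<open>g lam\<close>
  depends on \<open>v_i\<close> only modulo \<open>lam_i\<close>. This also gives the common
  denominator \<open>lam_n lam_i\<close>.

  Arithmetic by counting forces every counter and quotient to stay polynomial in \<open>n\<close>
  and \<Delta>. Unreduced back substitution could enlarge the entries of \<open>tau\<close> in every
  step; they are therefore reduced each time, and divisibility by partial products of the diagonal
  keeps the divisions exact. Numbers that depend on \<open>b\<close> may be large, but they are only
  added, so they count through their bit length, which minors of \<open>(H b)\<close> control.

  The number of instructions has order \<open>n^3\<close> \<Delta>\<open>^4\<close>: at most
  \<Delta> back substitutions of order \<open>n^3\<close> \<Delta>\<open>^3\<close>, and of order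
  \<open>n\<close> \<Delta>\<open>^2\<close> candidates of order \<open>n\<close>
  \<Delta>\<open>^2\<close> each.\<close>

lemma bit_size_mono: "\<bar>x\<bar> \<le> \<bar>y\<bar> \<Longrightarrow> bit_size x \<le> bit_size y"
  unfolding bit_size_def by (intro max.mono order_refl floorlog_mono) simp

definition bounded_by :: "int \<Rightarrow> (reg \<Rightarrow> int) \<Rightarrow> bool" where
  "bounded_by V R \<longleftrightarrow> (\<forall>r. \<bar>R r\<bar> \<le> V)"

text \<open>Every instruction that only handles integers of absolute value at most \<open>V\<close> costs at most
  \<open>3 * bit_size V\<close>, so it suffices to count instructions.\<close>

definition run ::
  "int \<Rightarrow> program \<Rightarrow> nat \<Rightarrow> (reg \<Rightarrow> int) \<Rightarrow> int list \<Rightarrow> int list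
    \<Rightarrow> ((reg \<Rightarrow> int) \<Rightarrow> int list \<Rightarrow> int list \<Rightarrow> bool) \<Rightarrow> bool" where
  "run V p N R inp out Q \<longleftrightarrow> (bounded_by V R \<longrightarrow>
     (\<exists>t R' inp' out'. exec p (R, inp, out) t (R', inp', out') \<and>
        t \<le> N * (3 * bit_size V) \<and> bounded_by V R' \<and> Q R' inp' out'))"

lemma bounded_byD: "bounded_by V R \<Longrightarrow> \<bar>R r\<bar> \<le> V"
  by (simp add: bounded_by_def)

lemma bounded_by_upd: "bounded_by V R \<Longrightarrow> \<bar>v\<bar> \<le> V \<Longrightarrow> bounded_by V (R(i := v))"
  by (simp add: bounded_by_def)

lemma bit_size_bounded: "bounded_by V R \<Longrightarrow> bit_size (R r) \<le> bit_size V"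
  by (rule bit_size_mono) (use bounded_byD[of V R r] in linarith)

lemma run_mono:
  "run V p N R inp out Q \<Longrightarrow> N \<le> N' \<Longrightarrow> (\<And>R inp out. Q R inp out \<Longrightarrow> Q' R inp out) \<Longrightarrow>
     run V p N' R inp out Q'"
  unfolding run_def by (meson le_trans mult_le_mono1)

text \<open>\<open>run\<close> is vacuous for registers beyond \<open>V\<close>, so the bound on the
  initial registers may be assumed. Range conditions of single instructions that follow from
  register contents are discharged this way.\<close>

lemma run_bounded:
  "(bounded_by V R \<Longrightarrow> run V p N R inp out Q) \<Longrightarrow> run V p N R inp out Q"
  unfolding run_def by simp

lemma run_Assign:
  assumes "\<bar>c\<bar> \<le> V" "Q (R(i := c)) inp out"
  shows "run V (Assign i c) 1 R inp out Q"
  unfolding run_def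
proof (intro impI exI conjI)
  show "exec (Assign i c) (R, inp, out) (bit_size c) (R(i := c), inp, out)" by (rule exec.intros)
  have "bit_size c \<le> bit_size V" by (rule bit_size_mono) (use assms(1) in linarith)
  then show "bit_size c \<le> 1 * (3 * bit_size V)" by simp
qed (use assms bounded_by_upd in auto)

lemma run_Add:
  assumes "\<bar>R j + R k\<bar> \<le> V" "Q (R(i := R j + R k)) inp out"
  shows "run V (Add i j k) 1 R inp out Q"
  unfolding run_def
proof (intro impI exI conjI)
  assume ok: "bounded_by V R"
  show "exec (Add i j k) (R, inp, out) (bit_size (R j) + bit_size (R k)) (R(i := R j + R k), inp, out)"
    by (rule exec.intros)
  show "bit_size (R j) + bit_size (R k) \<le> 1 * (3 * bit_size V)"
    using bit_size_bounded[OF ok, of j] bit_size_bounded[OF ok, of k] by simp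
qed (use assms bounded_by_upd in auto)

lemma run_Sub:
  assumes "\<bar>R j - R k\<bar> \<le> V" "Q (R(i := R j - R k)) inp out"
  shows "run V (Sub i j k) 1 R inp out Q"
  unfolding run_def
proof (intro impI exI conjI)
  assume ok: "bounded_by V R"
  show "exec (Sub i j k) (R, inp, out) (bit_size (R j) + bit_size (R k)) (R(i := R j - R k), inp, out)"
    by (rule exec.intros)
  show "bit_size (R j) + bit_size (R k) \<le> 1 * (3 * bit_size V)"
    using bit_size_bounded[OF ok, of j] bit_size_bounded[OF ok, of k] by simp
qed (use assms bounded_by_upd in auto)

lemma run_Load:
  assumes "0 \<le> R j" "Q (R(i := R (nat (R j)))) inp out"
  shows "run V (Load i j) 1 R inp out Q"
  unfolding run_def
proof (intro impI exI conjI)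
  assume ok: "bounded_by V R"
  show "exec (Load i j) (R, inp, out) (bit_size (R j) + bit_size (R (nat (R j))))
    (R(i := R (nat (R j))), inp, out)"
    by (rule exec.intros) (rule assms)
  show "bit_size (R j) + bit_size (R (nat (R j))) \<le> 1 * (3 * bit_size V)"
    using bit_size_bounded[OF ok, of j] bit_size_bounded[OF ok, of "nat (R j)"] by simp
  show "bounded_by V (R(i := R (nat (R j))))" using ok bounded_by_upd bounded_byD by auto
qed (use assms in auto)

lemma run_Store:
  assumes "0 \<le> R i" "Q (R(nat (R i) := R j)) inp out"
  shows "run V (Store i j) 1 R inp out Q"
  unfolding run_def
proof (intro impI exI conjI)
  assume ok: "bounded_by V R"
  show "exec (Store i j) (R, inp, out) (bit_size (R i) + bit_size (R j))
    (R(nat (R i) := R j), inp, out)"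
    by (rule exec.intros) (rule assms)
  show "bit_size (R i) + bit_size (R j) \<le> 1 * (3 * bit_size V)"
    using bit_size_bounded[OF ok, of j] bit_size_bounded[OF ok, of i] by simp
  show "bounded_by V (R(nat (R i) := R j))" using ok bounded_by_upd bounded_byD by auto
qed (use assms in auto)

lemma run_Read:
  assumes "\<bar>x\<bar> \<le> V" "Q (R(i := x)) inp out"
  shows "run V (Read i) 1 R (x # inp) out Q"
  unfolding run_def
proof (intro impI exI conjI)
  show "exec (Read i) (R, x # inp, out) (bit_size x) (R(i := x), inp, out)" by (rule exec.intros)
  have "bit_size x \<le> bit_size V" by (rule bit_size_mono) (use assms(1) in linarith)
  then show "bit_size x \<le> 1 * (3 * bit_size V)" by simp
qed (use assms bounded_by_upd in auto)

lemma run_Print: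
  assumes "Q R inp (out @ [R i])"
  shows "run V (Print i) 1 R inp out Q"
  unfolding run_def
proof (intro impI exI conjI)
  assume ok: "bounded_by V R"
  show "exec (Print i) (R, inp, out) (bit_size (R i)) (R, inp, out @ [R i])" by (rule exec.intros)
  show "bit_size (R i) \<le> 1 * (3 * bit_size V)"
    using bit_size_bounded[OF ok, of i] by simp
qed (use assms in auto)

text \<open>The second program sits in the postcondition of the first, so a proof can step through a
  program by symbolic execution, while the costs add up to a term of the same shape as the
  program.\<close>

lemma run_Seq:
  assumes "run V p N R inp out (\<lambda>R inp out. run V q M R inp out Q)"
  shows "run V (Seq p q) (N + M) R inp out Q"
  unfolding run_def
proof
  assume ok: "bounded_by V R"
  obtain t R1 i1 o1 where 1: "exec p (R, inp, out) t (R1, i1, o1)" "t \<le> N * (3 * bit_size V)"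
    "bounded_by V R1" "run V q M R1 i1 o1 Q"
    using assms ok unfolding run_def[of V p] by blast
  obtain t' R2 i2 o2 where 2: "exec q (R1, i1, o1) t' (R2, i2, o2)" "t' \<le> M * (3 * bit_size V)"
    "bounded_by V R2" "Q R2 i2 o2"
    using 1 unfolding run_def by blast
  show "\<exists>t R' inp' out'. exec (Seq p q) (R, inp, out) t (R', inp', out') \<and>
        t \<le> (N + M) * (3 * bit_size V) \<and> bounded_by V R' \<and> Q R' inp' out'"
    using exec.Seq[OF 1(1) 2(1)] 1(2) 2(2-) by (metis add_mono add_mult_distrib)
qed

lemma run_Cond:
  assumes "R i > 0 \<Longrightarrow> run V p N R inp out Q" "R i \<le> 0 \<Longrightarrow> run V q N R inp out Q"
  shows "run V (Cond i p q) (Suc N) R inp out Q"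
  unfolding run_def
proof
  assume ok: "bounded_by V R"
  have b: "bit_size (R i) \<le> 3 * bit_size V" using bit_size_bounded[OF ok, of i] by simp
  show "\<exists>t R' inp' out'. exec (Cond i p q) (R, inp, out) t (R', inp', out') \<and>
        t \<le> Suc N * (3 * bit_size V) \<and> bounded_by V R' \<and> Q R' inp' out'"
  proof (cases "R i > 0")
    case True
    then obtain t R1 i1 o1 where 1: "exec p (R, inp, out) t (R1, i1, o1)" "t \<le> N * (3 * bit_size V)"
      "bounded_by V R1" "Q R1 i1 o1" using assms(1) ok unfolding run_def by blast
    show ?thesis using exec.Cond_True[OF True 1(1)] 1 b
      by (metis add_mono mult_Suc)
  next
    case False
    then obtain t R1 i1 o1 where 1: "exec q (R, inp, out) t (R1, i1, o1)" "t \<le> N * (3 * bit_size V)"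
      "bounded_by V R1" "Q R1 i1 o1" using assms(2) ok unfolding run_def by force
    have "R i \<le> 0" using False by simp
    then show ?thesis using exec.Cond_False[OF _ 1(1)] 1 b
      by (metis add_mono mult_Suc)
  qed
qed

text \<open>The invariant is indexed by the number of rounds still to come, so it carries
  termination and the count. A round pays \<open>N\<close> for the body and one unit for the test;
  the final unit is the failing test.\<close>

lemma run_While:
  assumes init: "I m R inp out"
    and cnt: "\<And>k R inp out. I k R inp out \<Longrightarrow> R c > 0 \<longleftrightarrow> k > 0"
    and body: "\<And>k R inp out. k < m \<Longrightarrow> I (Suc k) R inp out \<Longrightarrow> run V p N R inp out (I k)"
    and post: "\<And>R inp out. I 0 R inp out \<Longrightarrow> Q R inp out"
  shows "run V (While c p) (m * (N + 1) + 1) R inp out Q"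
proof -
  have "I j R inp out \<Longrightarrow> j \<le> m \<Longrightarrow> run V (While c p) (j * (N + 1) + 1) R inp out Q" for j R inp out
  proof (induction j arbitrary: R inp out)
    case 0
    show ?case unfolding run_def
    proof (intro impI exI conjI)
      assume ok: "bounded_by V R"
      show "exec (While c p) (R, inp, out) (bit_size (R c)) (R, inp, out)"
        by (rule exec.intros) (use cnt[OF 0(1)] in simp)
      show "bit_size (R c) \<le> (0 * (N + 1) + 1) * (3 * bit_size V)"
        using bit_size_bounded[OF ok, of c] by simp
    qed (use post[OF 0(1)] in auto)
  next
    case (Suc j)
    show ?case unfolding run_def
    proof
      assume ok: "bounded_by V R"
      obtain t R1 i1 o1 where 1: "exec p (R, inp, out) t (R1, i1, o1)" "t \<le> N * (3 * bit_size V)"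
        "bounded_by V R1" "I j R1 i1 o1"
        using body[OF _ Suc.prems(1)] Suc.prems(2) ok unfolding run_def by force
      obtain t' R2 i2 o2 where 2: "exec (While c p) (R1, i1, o1) t' (R2, i2, o2)"
        "t' \<le> (j * (N + 1) + 1) * (3 * bit_size V)" "bounded_by V R2" "Q R2 i2 o2"
        using Suc.IH[OF 1(4)] Suc.prems(2) 1(3) unfolding run_def by auto
      have pos: "R c > 0" using cnt[OF Suc.prems(1)] by simp
      have "bit_size (R c) + t + t' \<le> (Suc j * (N + 1) + 1) * (3 * bit_size V)"
        using bit_size_bounded[OF ok, of c] 1(2) 2(2) by (simp add: algebra_simps)
      then show "\<exists>t R' inp' out'. exec (While c p) (R, inp, out) t (R', inp', out') \<and>
        t \<le> (Suc j * (N + 1) + 1) * (3 * bit_size V) \<and> bounded_by V R' \<and> Q R' inp' out'"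
        using exec.While_True[where R=R and i=c, OF pos 1(1) 2(1)] 2(3,4) by blast
    qed
  qed
  then show ?thesis using init by blast
qed

text \<open>Printing is charged by digits and output is never removed, so the running time bounds
  the length of the output. This yields a lower bound on the time of any multiplication
  program.\<close>

lemma exec_output:
  "exec p s t s' \<Longrightarrow> \<exists>o'. snd (snd s') = snd (snd s) @ o' \<and> sum_list (map bit_size o') \<le> t"
proof (induction rule: exec.induct)
  case (Seq p s t s' q t' s'')
  then obtain o1 o2 where "snd (snd s') = snd (snd s) @ o1" "sum_list (map bit_size o1) \<le> t"
    "snd (snd s'') = snd (snd s') @ o2" "sum_list (map bit_size o2) \<le> t'" by auto
  then show ?case by (intro exI[of _ "o1 @ o2"]) auto
next
  case (While_True R i p inp out t s' t' s'')
  then obtain o1 o2 where "snd (snd s') = out @ o1" "sum_list (map bit_size o1) \<le> t"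
    "snd (snd s'') = snd (snd s') @ o2" "sum_list (map bit_size o2) \<le> t'" by auto
  then show ?case by (intro exI[of _ "o1 @ o2"]) auto
qed auto

lemma bit_size_power2: "bit_size (2 ^ k) = Suc k"
proof -
  have "floorlog 2 (2 ^ k) = Suc k"
    using floorlog_power[of 1 2 k] by (simp add: floorlog_def)
  then show ?thesis by (simp add: bit_size_def nat_power_eq)
qed

text \<open>Printing the product alone costs its number of bits.\<close>

lemma multiplication_time_ge:
  assumes "multiplication_time f" "k \<ge> 1"
  shows "real k \<le> f k"
proof -
  obtain p where p: "\<And>k x y. bit_size x \<le> k \<and> bit_size y \<le> k \<Longrightarrow>
        (\<exists>t. computes p [x, y] t [x * y] \<and> real t \<le> f k)"
    using assms(1) unfolding multiplication_time_def by blast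
  \<comment> \<open>This factor has exactly \<open>k\<close> digits and its square at least as many,
    so printing the product takes time at least \<open>k\<close>.\<close>
  let ?x = "2 ^ (k - 1) :: int"
  obtain t where t: "computes p [?x, ?x] t [?x * ?x]" "real t \<le> f k"
    using p[of ?x k ?x] assms(2) by (auto simp: bit_size_power2)
  then have "bit_size (?x * ?x) \<le> t"
    unfolding computes_def by (auto dest!: exec_output)
  moreover have "bit_size ?x \<le> bit_size (?x * ?x)"
    by (rule bit_size_mono) (simp add: mult_le_cancel_left1)
  ultimately show ?thesis using t(2) assms(2) by (simp add: bit_size_power2)
qed

text \<open>Above 40, eight arrays are interleaved: array 0 holds \<open>lam\<close>, array 2 the current candidate, array 3
  the best candidate, array 4 the matrix, and array 5 the vector \<open>tau\<close>. Below 40, registers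
  0 to 5 hold \<open>0, 1, n, n + 1, n (n + 1)\<close> and \<open>lam\<^sub>n\<close>; 24 and 25 hold \<open>N\<^sub>k\<close> and \<open>lam\<^sub>k\<close> for the \<open>k\<close> that
  maximizes \<open>N\<^sub>k / lam\<^sub>k\<close>; 28 the denominator of the current candidate, 29 that of the best one; and
  26 and 27 the numerator and denominator of the least width divided by \<open>\<beta>\<close> so far (\<open>1 / 0\<close> initially).\<close>

definition cell :: "nat \<Rightarrow> nat \<Rightarrow> reg" where
  "cell a k = 40 + 8 * k + a"

section \<open>Memory layout and frame conditions\<close>

lemma cell_eq_iff:
  assumes "a < 8" "a' < 8"
  shows "cell a k = cell a' k' \<longleftrightarrow> a = a' \<and> k = k'"
proof
  assume "cell a k = cell a' k'"
  then have e: "8 * k + a = 8 * k' + a'" by (simp add: cell_def)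
  have "(8 * k + a) div 8 = k" "(8 * k' + a') div 8 = k'" using assms by simp_all
  then have "k = k'" by (simp only: e)
  then show "a = a' \<and> k = k'" using e by simp
qed simp

lemma cell_neq: "r < 40 \<Longrightarrow> cell a k \<noteq> r" "r < 40 \<Longrightarrow> r \<noteq> cell a k"
  by (auto simp: cell_def)

lemma cell_notin_range: "a < 8 \<Longrightarrow> a' < 8 \<Longrightarrow> a \<noteq> a' \<Longrightarrow> cell a k \<notin> range (cell a')"
  by (auto simp: cell_eq_iff)

lemma reg_notin_range: "r < 40 \<Longrightarrow> r \<notin> range (cell a)"
  by (auto simp: cell_def)

lemma cell_less: "r \<le> 40 \<Longrightarrow> \<not> cell a k < r" "r < 40 \<Longrightarrow> \<not> cell a k \<le> r"
  by (auto simp: cell_def)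

lemmas cell_simps = cell_eq_iff cell_neq cell_notin_range reg_notin_range cell_less

text \<open>Frame condition: each subroutine is specified by the set \<open>X\<close> of registers
  it may change, so that facts about all other registers carry over without naming scratch
  values.\<close>

definition agree_outside :: "reg set \<Rightarrow> (reg \<Rightarrow> int) \<Rightarrow> (reg \<Rightarrow> int) \<Rightarrow> bool" where
  "agree_outside X R R' \<longleftrightarrow> (\<forall>r. r \<notin> X \<longrightarrow> R' r = R r)"

lemma agree_outsideD: "agree_outside X R R' \<Longrightarrow> r \<notin> X \<Longrightarrow> R' r = R r"
  by (simp add: agree_outside_def)

lemma agree_outside_refl: "agree_outside X R R"
  by (simp add: agree_outside_def)

lemma agree_outside_upd: "agree_outside X R R' \<Longrightarrow> r \<in> X \<Longrightarrow> agree_outside X R (R'(r := v))"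
  by (simp add: agree_outside_def)

lemma agree_outside_trans:
  "agree_outside X R R' \<Longrightarrow> agree_outside Y R' R'' \<Longrightarrow> Y \<subseteq> X \<Longrightarrow> agree_outside X R R''"
  unfolding agree_outside_def by (metis subsetD)

section \<open>Loops, array access and integer arithmetic by counting\<close>

abbreviation (input) Copy :: "reg \<Rightarrow> reg \<Rightarrow> program" where
  "Copy i j \<equiv> Add i j 0"

lemma run_weaken: "run V p N R inp out Q \<Longrightarrow> N \<le> M \<Longrightarrow> run V p M R inp out Q"
  by (rule run_mono)

text \<open>Register 0 holds zero throughout, which turns an addition into a move. No range
  condition arises, since the copied value already sits in a register.\<close>

lemma run_Copy:
  assumes "R 0 = 0" "Q (R(i := R j)) inp out"
  shows "run V (Copy i j) 1 R inp out Q"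
proof (rule run_bounded, rule run_Add)
  assume "bounded_by V R"
  then show "\<bar>R j + R 0\<bar> \<le> V" using bounded_byD[of V R j] assms by simp
qed (use assms in simp)

text \<open>The counter is decreased before the body runs, so the body sees the indices
  \<open>m - 1, ..., 0\<close> and can use the counter as an array index. Register 1 holds the
  constant 1.\<close>

definition For_Down :: "reg \<Rightarrow> program \<Rightarrow> program" where
  "For_Down c p = While c (Seq (Sub c c 1) p)"

lemma run_For_Down:
  assumes init: "I m R inp out"
    and cnt: "\<And>k R inp out. I k R inp out \<Longrightarrow> R c = int k \<and> R 1 = 1"
    and body: "\<And>k R inp out. k < m \<Longrightarrow> I (Suc k) R inp out \<Longrightarrow> run V p N (R(c := int k)) inp out (I k)"
    and post: "\<And>R inp out. I 0 R inp out \<Longrightarrow> Q R inp out"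
    and M: "m * (N + 2) + 1 \<le> M"
  shows "run V (For_Down c p) M R inp out Q"
proof (rule run_mono)
  show "run V (For_Down c p) (m * ((1 + N) + 1) + 1) R inp out Q"
    unfolding For_Down_def
  proof (rule run_While[where I = I, OF init _ _ post])
    show "(0 < R c) = (0 < k)" if "I k R inp out" for k R inp out
      using cnt[OF that] by simp
    show "run V (Seq (Sub c c 1) p) (1 + N) R inp out (I k)" if "k < m" "I (Suc k) R inp out" for k R inp out
    proof (rule run_Seq, rule run_bounded, rule run_Sub)
      assume "bounded_by V R"
      then show "\<bar>R c - R 1\<bar> \<le> V" using bounded_byD[of V R c] cnt[OF that(2)] by simp
      show "run V p N (R(c := R c - R 1)) inp out (I k)"
        using body[OF that] cnt[OF that(2)] by simp
    qed
  qed
qed (use M in auto)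

text \<open>Three doublings produce \<open>8 * k\<close> without a multiplication, and
  \<open>40 + a\<close> completes the address \<open>cell a k\<close>. Registers 6 and 7 are
  scratch.\<close>

definition Array_Load :: "reg \<Rightarrow> nat \<Rightarrow> reg \<Rightarrow> program" where
  "Array_Load d a j = Seq (Add 6 j j) (Seq (Add 6 6 6) (Seq (Add 6 6 6)
     (Seq (Assign 7 (40 + int a)) (Seq (Add 6 6 7) (Load d 6)))))"

definition Array_Store :: "nat \<Rightarrow> reg \<Rightarrow> reg \<Rightarrow> program" where
  "Array_Store a j s = Seq (Add 6 j j) (Seq (Add 6 6 6) (Seq (Add 6 6 6)
     (Seq (Assign 7 (40 + int a)) (Seq (Add 6 6 7) (Store 6 s)))))"

text \<open>The final contents of the scratch registers are quantified in the postcondition, so what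
  follows cannot depend on them. The offset 48 exceeds \<open>40 + a\<close> for every
  array.\<close>

lemma run_Array_Load:
  assumes "0 \<le> R j" "8 * R j + 48 \<le> V" "a < 8" "j \<noteq> 6"
    and Q: "\<And>v w. Q (R(6 := v, 7 := w, d := R (cell a (nat (R j))))) inp out"
  shows "run V (Array_Load d a j) 6 R inp out Q"
proof -
  define k where "k = nat (R j)"
  have k: "R j = int k" using assms(1) by (simp add: k_def)
  have c: "nat (8 * int k + (40 + int a)) = cell a k" by (simp add: cell_def nat_add_distrib)
  have "run V (Array_Load d a j) (1 + (1 + (1 + (1 + (1 + 1))))) R inp out Q"
    unfolding Array_Load_def
    apply (rule run_Seq run_Add run_Assign run_Load; (insert assms(1-4), simp; fail)?)+
    using Q[of "8 * int k + (40 + int a)" "40 + int a"] c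
    by (simp add: k fun_upd_twist[of 7 6] cell_neq)
  then show ?thesis by (rule run_mono) auto
qed

lemma run_Array_Store:
  assumes "0 \<le> R j" "8 * R j + 48 \<le> V" "a < 8" "j \<noteq> 6" "s \<noteq> 6" "s \<noteq> 7"
    and Q: "\<And>v w. Q (R(6 := v, 7 := w, cell a (nat (R j)) := R s)) inp out"
  shows "run V (Array_Store a j s) 6 R inp out Q"
proof -
  define k where "k = nat (R j)"
  have k: "R j = int k" using assms(1) by (simp add: k_def)
  have c: "nat (8 * int k + (40 + int a)) = cell a k" by (simp add: cell_def nat_add_distrib)
  have "run V (Array_Store a j s) (1 + (1 + (1 + (1 + (1 + 1))))) R inp out Q"
    unfolding Array_Store_def
    apply (rule run_Seq run_Add run_Assign run_Store; (insert assms(1-6), simp; fail)?)+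
    using assms(5,6) Q[of "8 * int k + (40 + int a)" "40 + int a"] c
    by (simp add: k fun_upd_twist[of 7 6] cell_neq)
  then show ?thesis by (rule run_mono) auto
qed

text \<open>Time is linear in the value of the last factor \<open>y\<close> but only in the bit
  length of \<open>x\<close>. A factor that may be negative or depends on \<open>b\<close> is
  therefore placed first.\<close>

definition Mul :: "reg \<Rightarrow> reg \<Rightarrow> reg \<Rightarrow> program" where
  "Mul d x y = Seq (Copy 8 y) (Seq (Assign d 0) (For_Down 8 (Add d d x)))"

lemma run_Mul:
  assumes "R 0 = 0" "R 1 = 1" "d \<notin> {0, 1, 8, x}" "x \<noteq> 8"
    and "0 \<le> R y" "\<bar>R x * R y\<bar> \<le> V" "3 * nat (R y) + 3 \<le> N"
    and "Q (R(8 := 0, d := R x * R y)) inp out"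
  shows "run V (Mul d x y) N R inp out Q"
proof (rule run_mono)
  define m where "m = nat (R y)"
  have m: "R y = int m" using assms(5) by (simp add: m_def)
  define I where "I k R' i' o' \<longleftrightarrow> R' = R(8 := int k, d := R x * int (m - k)) \<and> k \<le> m \<and> i' = inp \<and> o' = out"
    for k R' and i' o' :: "int list"
  show "run V (Mul d x y) (1 + (1 + (m * (1 + 2) + 1))) R inp out Q"
    unfolding Mul_def
  proof (rule run_Seq, rule run_Copy, rule assms, rule run_Seq, rule run_Assign)
    have "0 \<le> \<bar>R x * R y\<bar>" by simp
    then show "\<bar>0\<bar> \<le> V" using assms(6) by linarith
    show "run V (For_Down 8 (Add d d x)) (m * (1 + 2) + 1) ((R(8 := R y))(d := 0)) inp out Q"
    proof (rule run_For_Down[where I = I and m = m and N = 1])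
      show "I m (R(8 := R y, d := 0)) inp out" by (simp add: I_def m)
      show "R' 8 = int k \<and> R' 1 = 1" if "I k R' i' o'" for k R' i' o'
        using that assms by (auto simp: I_def)
      show "Q R' i' o'" if "I 0 R' i' o'" for R' i' o'
        using that assms by (auto simp: I_def m)
      show "run V (Add d d x) 1 (R'(8 := int k)) i' o' (I k)" if "k < m" "I (Suc k) R' i' o'" for k R' i' o'
      proof -
        have R': "R' = R(8 := int (Suc k), d := R x * int (m - Suc k))" "i' = inp" "o' = out"
          using that by (auto simp: I_def)
        have e: "R x * int (m - Suc k) + R x = R x * int (m - k)"
          using that(1) by (simp add: of_nat_diff algebra_simps)
        have "\<bar>R x * int (m - k)\<bar> \<le> \<bar>R x * R y\<bar>"
          unfolding m abs_mult by (intro mult_left_mono) auto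
        then have b: "\<bar>R x * int (m - k)\<bar> \<le> V" using assms(6) by linarith
        show ?thesis
          by (rule run_Add)
            (use assms b e that in \<open>auto simp: R' I_def fun_upd_twist\<close>)
      qed
    qed simp
  qed
  show "1 + (1 + (m * (1 + 2) + 1)) \<le> N" using assms(7) by (simp add: m_def)
qed

text \<open>The first loop adds \<open>h\<close> while the dividend is negative, the second
  subtracts \<open>h\<close> while it is at least \<open>h\<close>; this yields the floor quotient
  for both signs. Register 9 encodes the tests \<open>r < 0\<close> and \<open>r \<ge> h\<close> as
  positivity of \<open>- r\<close> and of \<open>r - h + 1\<close>.\<close>

definition Div_Mod :: "reg \<Rightarrow> reg \<Rightarrow> reg \<Rightarrow> program" where
  "Div_Mod q r h = Seq (Assign q 0) (Seq (Sub 9 0 r)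
     (Seq (While 9 (Seq (Add r r h) (Seq (Sub q q 1) (Sub 9 0 r))))
     (Seq (Sub 9 r h) (Seq (Add 9 9 1)
       (While 9 (Seq (Sub r r h) (Seq (Add q q 1) (Sub 9 9 h))))))))"

lemma run_Div_Mod:
  assumes R: "R 0 = 0" "R 1 = 1" "q \<notin> {0, 1, 9, r, h}" "r \<notin> {0, 1, 9, h}" "h \<noteq> 9"
    and h: "R h > 0" and N: "4 * nat \<bar>R r div R h\<bar> + 9 \<le> N"
    and Q: "\<And>v. Q (R(q := R r div R h, r := R r mod R h, 9 := v)) inp out"
  shows "run V (Div_Mod q r h) N R inp out Q"
proof (rule run_bounded, rule run_mono)
  assume ok: "bounded_by V R"
  define x y where "x = R r" and "y = R h"
  have y: "y > 0" using h by (simp add: y_def)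
  have xV: "\<bar>x\<bar> \<le> V" and yV: "\<bar>y\<bar> \<le> V" using bounded_byD[OF ok] by (simp_all add: x_def y_def)
  define d e where "d = x div y" and "e = x mod y"
  have xy: "x = y * d + e" by (simp add: d_def e_def)
  have dpos: "d \<ge> 0 \<longleftrightarrow> x \<ge> 0" using y by (simp add: d_def pos_imp_zdiv_nonneg_iff)
  \<comment> \<open>The numbers of rounds of the two loops. At most one of them is positive,
    depending on the sign of the quotient.\<close>
  define m m' where "m = nat (- (d))" and "m' = nat (d)"
  \<comment> \<open>The quotient register moves between 0 and \<open>d\<close>, so this bound keeps
    it within \<open>V\<close>.\<close>
  have qx: "\<bar>d\<bar> \<le> \<bar>x\<bar>"
  proof (cases "x \<ge> 0")
    case True
    then have d: "d \<ge> 0" using dpos by simp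
    then have "d * 1 \<le> d * y" using y by (intro mult_left_mono) auto
    moreover have "0 \<le> e" using y by (simp add: e_def)
    ultimately show ?thesis using True d xy by (simp add: mult.commute)
  next
    case False
    have "d < 0" using False dpos by simp
    have "e < y" using y by (simp add: e_def)
    have "(d + 1) * y \<le> (d + 1) * 1" using y \<open>d < 0\<close> by (intro mult_left_mono_neg) auto
    then have "x < d + 1" using xy \<open>e < y\<close> by (simp add: algebra_simps)
    then show ?thesis using False \<open>d < 0\<close> by simp
  qed
  define I where "I k R' i' o' \<longleftrightarrow> k \<le> m \<and> R' = R(q := int k - int m, r := x + (int m - int k) * y,
      9 := - (x + (int m - int k) * y)) \<and> i' = inp \<and> o' = out" for k R' and i' o' :: "int list"
  define I' where "I' k R' i' o' \<longleftrightarrow> k \<le> m' \<and> R' = R(q := d - int k, r := e + int k * y,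
      9 := e + int k * y - y + 1) \<and> i' = inp \<and> o' = out" for k R' and i' o' :: "int list"
  have md: "0 \<le> e" "e < y" using y by (auto simp: e_def)
  have ky: "int k * y \<ge> y" if "k > 0" for k :: nat
    using that y by (simp add: mult_le_cancel_right1)
  have neg: "x + (int m - int k) * y = e - int k * y" if "k > 0" "k \<le> m" for k
  proof -
    have "int m = - (d)" using that by (simp add: m_def)
    then show ?thesis using xy by (simp add: algebra_simps)
  qed
  have fin: "m = 0 \<or> int m = - (d) \<and> m' = 0" by (auto simp: m_def m'_def)
  have fin': "m > 0 \<Longrightarrow> int m = - (d)" "m = 0 \<Longrightarrow> int m' = d" by (auto simp: m_def m'_def)
  show "run V (Div_Mod q r h) (1 + (1 + ((m * ((1 + (1 + 1)) + 1) + 1) + (1 + (1 + (m' * ((1 + (1 + 1)) + 1) + 1)))))) R inp out Q"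
    unfolding Div_Mod_def
  proof (rule run_Seq, rule run_Assign)
    show "\<bar>0\<bar> \<le> V" using xV by simp
    show "run V (Seq (Sub 9 0 r)
     (Seq (While 9 (Seq (Add r r h) (Seq (Sub q q 1) (Sub 9 0 r))))
     (Seq (Sub 9 r h) (Seq (Add 9 9 1)
       (While 9 (Seq (Sub r r h) (Seq (Add q q 1) (Sub 9 9 h))))))))
      (1 + ((m * ((1 + (1 + 1)) + 1) + 1) + (1 + (1 + (m' * ((1 + (1 + 1)) + 1) + 1))))) (R(q := 0)) inp out Q"
    proof (rule run_Seq, rule run_Sub)
      show "\<bar>(R(q := 0)) 0 - (R(q := 0)) r\<bar> \<le> V" using R xV by (auto simp: x_def)
      let ?R = "(R(q := 0))(9 := (R(q := 0)) 0 - (R(q := 0)) r)"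
      show "run V (Seq (While 9 (Seq (Add r r h) (Seq (Sub q q 1) (Sub 9 0 r))))
         (Seq (Sub 9 r h) (Seq (Add 9 9 1)
           (While 9 (Seq (Sub r r h) (Seq (Add q q 1) (Sub 9 9 h)))))))
         ((m * ((1 + (1 + 1)) + 1) + 1) + (1 + (1 + (m' * ((1 + (1 + 1)) + 1) + 1)))) ?R inp out Q"
      proof (rule run_Seq, rule run_While[where I = I])
        show "I m ?R inp out" using R by (auto simp: I_def x_def fun_eq_iff)
        show "(0 < R' 9) = (0 < k)" if "I k R' i' o'" for k R' i' o'
        proof (cases "k > 0")
          case True
          moreover have "k \<le> m" using that by (simp add: I_def)
          ultimately have "x + (int m - int k) * y < 0" using neg[of k] ky[of k] md by linarith
          then show ?thesis using that True by (simp add: I_def)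
        next
          case False
          have "x + int m * y \<ge> 0"
          proof (cases "m = 0")
            case True
            then have "d \<ge> 0" by (simp add: m_def)
            then show ?thesis using True dpos by simp
          next
            case False
            then have "int m = - (d)" using fin by auto
            then have "x + int m * y = e" using xy by (simp add: algebra_simps)
            then show ?thesis using md by simp
          qed
          then show ?thesis using that False by (simp add: I_def)
        qed
        show "run V (Seq (Add r r h) (Seq (Sub q q 1) (Sub 9 0 r))) (1 + (1 + 1)) R' i' o' (I k)"
          if "k < m" "I (Suc k) R' i' o'" for k R' i' o'
        proof -
          have R': "R' = R(q := int (Suc k) - int m, r := x + (int m - int (Suc k)) * y,
              9 := - (x + (int m - int (Suc k)) * y))" "i' = inp" "o' = out"
            using that by (auto simp: I_def)
          have e: "x + (int m - int (Suc k)) * y + y = x + (int m - int k) * y"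
            by (simp add: algebra_simps)
          have b1: "\<bar>x + (int m - int k) * y\<bar> \<le> V"
          proof -
            have 1: "x + (int m - int (Suc k)) * y = e - int (Suc k) * y"
              by (rule neg) (use that in auto)
            have "x + (int m - int (Suc k)) * y < 0" using 1 md ky[of "Suc k"] by linarith
            then have "x + (int m - int k) * y < y" using e by linarith
            moreover have "(int m - int k) * y \<ge> 0" using that y by simp
            ultimately show ?thesis using xV yV y by linarith
          qed
          have b2: "\<bar>int k - int m\<bar> \<le> V"
            using that fin xV qx by (auto simp: m_def)
          show ?thesis
            apply (rule run_Seq, rule run_Add)
             apply (use R e b1 in \<open>simp add: R' y_def\<close>)
            apply (rule run_Seq, rule run_Sub)
             apply (use R e b2 in \<open>simp add: R' y_def\<close>)
            apply (rule run_Sub)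
             apply (use R e b1 in \<open>simp add: R' y_def\<close>)
            using R e that by (auto simp: R' I_def y_def fun_eq_iff)
        qed
        show "run V (Seq (Sub 9 r h) (Seq (Add 9 9 1)
           (While 9 (Seq (Sub r r h) (Seq (Add q q 1) (Sub 9 9 h)))))) (1 + (1 + (m' * ((1 + (1 + 1)) + 1) + 1))) R' i' o' Q"
          if "I 0 R' i' o'" for R' i' o'
        proof -
          have r: "x + int m * y = e + int m' * y"
            using fin' xy fin by (cases "m = 0") (auto simp: algebra_simps)
          have q: "- int m = d - int m'" using fin fin' by (cases "m = 0") auto
          have R': "R' = R(q := d - int m', r := e + int m' * y,
              9 := - (e + int m' * y))" "i' = inp" "o' = out"
            using that r q by (auto simp: I_def)
          have b: "- V \<le> e + int m' * y - y \<and> e + int m' * y - y < V"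
          proof (cases "m' = 0")
            case True then show ?thesis using md xV yV y by simp
          next
            case False
            then have "e + int m' * y = x" using fin' fin xy by (auto simp: algebra_simps)
            then show ?thesis using xV yV y False ky[of m'] md by linarith
          qed
          show ?thesis
          proof (rule run_Seq, rule run_Sub)
            show "\<bar>R' r - R' h\<bar> \<le> V" using R b by (auto simp: R' y_def)
            show "run V (Seq (Add 9 9 1) (While 9 (Seq (Sub r r h) (Seq (Add q q 1) (Sub 9 9 h)))))
              (1 + (m' * ((1 + (1 + 1)) + 1) + 1)) (R'(9 := R' r - R' h)) i' o' Q"
            proof (rule run_Seq, rule run_Add)
              show "\<bar>(R'(9 := R' r - R' h)) 9 + (R'(9 := R' r - R' h)) 1\<bar> \<le> V"
                using R b by (auto simp: R' y_def)
              let ?R' = "(R'(9 := R' r - R' h))(9 := (R'(9 := R' r - R' h)) 9 + (R'(9 := R' r - R' h)) 1)"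
              show "run V (While 9 (Seq (Sub r r h) (Seq (Add q q 1) (Sub 9 9 h))))
                (m' * ((1 + (1 + 1)) + 1) + 1) ?R' i' o' Q"
              proof (rule run_While[where I = I'])
                show "I' m' ?R' i' o'" using R by (auto simp: I'_def R' y_def fun_eq_iff)
                show "(0 < R'' 9) = (0 < k)" if "I' k R'' i'' o''" for k R'' i'' o''
                proof -
                  have "R'' 9 = e + int k * y - y + 1" using that by (simp add: I'_def)
                  then show ?thesis using ky[of k] md by (cases "k = 0") (simp, linarith)
                qed
                show "Q R'' i'' o''" if "I' 0 R'' i'' o''" for R'' i'' o''
                  using that Q by (auto simp: I'_def x_def y_def d_def e_def)
                show "run V (Seq (Sub r r h) (Seq (Add q q 1) (Sub 9 9 h))) (1 + (1 + 1)) R'' i'' o'' (I' k)"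
                  if "k < m'" "I' (Suc k) R'' i'' o''" for k R'' i'' o''
                proof -
                  have R'': "R'' = R(q := d - int (Suc k), r := e + int (Suc k) * y,
                    9 := e + int (Suc k) * y - y + 1)" "i'' = inp" "o'' = out"
                    using that by (auto simp: I'_def)
                  have "int (Suc k) * y \<le> int m' * y" using that y by (intro mult_right_mono) auto
                  moreover have "e + int m' * y = x"
                    using that fin fin' xy by (auto simp: algebra_simps)
                  ultimately have b1: "e + int (Suc k) * y \<le> V" using xV by linarith
                  have b2: "\<bar>d - int k\<bar> \<le> V" using that qx xV by (auto simp: m'_def)
                  obtain z where z: "int k * y = z" "0 \<le> z" using y by simp
                  show ?thesis
                    apply (rule run_Seq, rule run_Sub)
                     apply (use R b1 z(2) md y in \<open>simp add: R'' y_def[symmetric] distrib_right z(1)\<close>)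
                    apply (rule run_Seq, rule run_Add)
                     apply (use R b2 in \<open>simp add: R'' y_def\<close>)
                    apply (rule run_Sub)
                     apply (use R b1 z(2) md y yV in \<open>simp add: R'' y_def[symmetric] distrib_right z(1)\<close>)
                    using R that by (auto simp: R'' I'_def y_def[symmetric] fun_eq_iff distrib_right)
                qed
              qed
            qed
          qed
        qed
      qed
    qed
  qed
  have "m + m' \<le> nat \<bar>R r div R h\<bar>" by (auto simp: m_def m'_def x_def y_def d_def)
  then show "1 + (1 + ((m * ((1 + (1 + 1)) + 1) + 1) + (1 + (1 + (m' * ((1 + (1 + 1)) + 1) + 1))))) \<le> N"
    using N by simp
qed auto

subsection \<open>The program\<close>

text \<open>Register 13 walks up a column of the row-major matrix: it starts one row past the end,
  at \<open>n (n + 1) + k\<close> with \<open>k\<close> in register 10, and drops by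
  \<open>n\<close> in every round, so no address needs a multiplication. The result is left in
  register 12.\<close>

definition Dot_Col :: "nat \<Rightarrow> program" where
  "Dot_Col a = Seq (Assign 12 0) (Seq (Add 13 4 10) (Seq (Copy 11 3) (For_Down 11
     (Seq (Sub 13 13 2) (Seq (Array_Load 16 4 13) (Seq (Array_Load 14 a 11) (Seq (Mul 15 16 14)
       (Add 12 12 15))))))))"

definition Diag :: program where
  "Diag = Seq (Mul 15 2 10) (Seq (Add 15 15 10) (Array_Load 16 4 15))"

definition Read_Matrix :: program where
  "Read_Matrix = Seq (Copy 10 4) (Seq (Assign 11 0) (For_Down 10
     (Seq (Read 14) (Seq (Array_Store 4 11 14) (Add 11 11 1)))))"

definition Init :: program where
  "Init = Seq (Assign 1 1) (Seq (Read 2) (Seq (Add 3 2 1) (Seq (Mul 4 3 2) Read_Matrix)))"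

definition Det :: program where
  "Det = Seq (Assign 5 1) (Seq (Copy 10 2) (For_Down 10 (Seq Diag (Seq (Mul 14 5 16) (Copy 5 14)))))"

definition Lambda_Step :: program where
  "Lambda_Step = Seq (Sub 12 0 12) (Seq (Div_Mod 14 12 16) (Array_Store 0 10 14))"

definition Lambda :: program where
  "Lambda = Seq (Array_Store 0 2 5) (Seq (Copy 10 2) (For_Down 10 (Seq (Dot_Col 0) (Seq Diag Lambda_Step))))"

text \<open>Register 23 holds the unread part of \<open>a\<close>, register 12 the dot product of
  the partial solution with the current column, and register 16 the diagonal entry. Of the last two
  divisions, one reduces modulo \<open>lam n * h k k\<close> and the other is exact.\<close>

definition Tau_Step :: program where
  "Tau_Step = Seq (Div_Mod 17 23 16) (Seq (Mul 14 5 23) (Seq (Copy 23 17) (Seq (Sub 14 14 12)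
     (Seq (Mul 15 5 16) (Seq (Div_Mod 17 14 15) (Seq (Div_Mod 17 14 16) (Array_Store 5 10 17)))))))"

definition Tau :: program where
  "Tau = Seq (Copy 23 20) (Seq (Copy 10 3) (Seq (For_Down 10 (Array_Store 5 10 0)) (Seq (Copy 10 2)
     (For_Down 10 (Seq (Dot_Col 5) (Seq Diag Tau_Step))))))"

text \<open>Fractions are compared by cross multiplication: the new entry in registers 14 and 16
  against the maximum so far. \<open>Assign 7 0\<close> plays the role of an empty branch.\<close>

definition Update_Max :: program where
  "Update_Max = Seq (Mul 17 14 25) (Seq (Mul 18 24 16) (Seq (Sub 17 17 18)
     (Cond 17 (Seq (Copy 24 14) (Copy 25 16)) (Assign 7 0))))"

definition Cand_Step :: program where
  "Cand_Step = Seq (Array_Load 14 5 10) (Seq (Mul 15 14 30) (Seq (Array_Load 16 0 10) (Seq (Mul 14 31 16)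
     (Seq (Add 14 14 15) (Seq (Div_Mod 17 14 28) (Seq (Array_Store 2 10 14) Update_Max))))))"

text \<open>The tested difference is positive exactly if the maximum is 0, that is, if all
  fractional parts vanish. The row \<open>i\<close> with coefficient 1, written over the denominator
  in register 28, then replaces the zero vector.\<close>

definition Fix_Zero :: program where
  "Fix_Zero = Seq (Sub 17 1 24) (Cond 17 (Seq (Array_Store 2 21 28) (Seq (Copy 24 28) (Copy 25 30)))
     (Assign 7 0))"

definition Cand :: program where
  "Cand = Seq (Array_Load 30 0 21) (Seq (Array_Load 31 5 21) (Seq (Mul 28 5 30) (Seq (Mul 14 5 22)
     (Seq (Sub 31 14 31) (Seq (Assign 24 0) (Seq (Assign 25 1) (Seq (Copy 10 3)
       (Seq (For_Down 10 Cand_Step) Fix_Zero))))))))"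

definition Copy_Best :: program where
  "Copy_Best = Seq (Copy 10 3) (For_Down 10 (Seq (Array_Load 14 2 10) (Array_Store 3 10 14)))"

text \<open>The width of the candidate divided by \<open>\<beta>\<close> is
  \<open>N_k / (M lam_k)\<close>, with \<open>M\<close> in register 28. Under cross multiplication
  the initial \<open>1 / 0\<close> loses against every candidate.\<close>

definition Consider :: program where
  "Consider = Seq (Mul 14 27 24) (Seq (Mul 15 28 25) (Seq (Mul 16 15 26) (Seq (Sub 16 16 14)
     (Cond 16 (Seq (Copy 26 24) (Seq (Copy 27 15) (Seq (Copy 29 28) Copy_Best))) (Assign 7 0)))))"

definition Inner :: program where
  "Inner = Seq (Array_Load 22 0 21) (For_Down 22 (Seq Cand Consider))"

definition Search :: program where
  "Search = Seq (Assign 26 1) (Seq (Copy 20 5) (For_Down 20 (Seq Tau (Seq (Copy 21 3) (For_Down 21 Inner)))))"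

text \<open>The right-hand side is used up while it is read and never stored in an array. Each entry
  is a summand repeated \<open>lam_j\<close> times, so large entries cost only their bit
  length.\<close>

definition Beta :: program where
  "Beta = Seq (Assign 32 0) (Seq (Copy 11 3) (Seq (Assign 10 0) (For_Down 11
     (Seq (Read 14) (Seq (Array_Load 16 0 10) (Seq (Mul 15 14 16) (Seq (Add 32 32 15) (Add 10 10 1))))))))"

text \<open>The printed direction combines the rows with coefficients \<open>N_j / M\<close>; it is
  an integer vector because \<open>M\<close> divides every column sum.\<close>

definition Output :: program where
  "Output = Seq (Mul 14 32 26) (Seq (Print 14) (Seq (Print 27) (Seq (Copy 33 2) (Seq (Assign 10 0)
     (For_Down 33 (Seq (Dot_Col 3) (Seq (Div_Mod 14 12 29) (Seq (Print 14) (Add 10 10 1)))))))))"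

definition Width_Program :: program where
  "Width_Program = Seq Init (Seq Det (Seq Lambda (Seq Search (Seq Beta Output))))"

section \<open>Candidates and their computation\<close>

lemma abs_zdiv_le:
  fixes x y :: int
  assumes "0 < y" "\<bar>x\<bar> \<le> y * q"
  shows "\<bar>x div y\<bar> \<le> q"
proof -
  have "x div y \<le> (y * q) div y" using assms by (intro zdiv_mono1) auto
  then have "x div y \<le> q" using assms by simp
  moreover have "- q \<le> x div y"
  proof -
    have "(y * - q) div y \<le> x div y" using assms by (intro zdiv_mono1) auto
    then show ?thesis using assms nonzero_mult_div_cancel_left[of y "- q"] by (simp del: mult_minus_right)
  qed
  ultimately show ?thesis by linarith
qed

lemma abs_zdiv_le_abs:
  fixes x y :: int
  assumes "0 < y"
  shows "\<bar>x div y\<bar> \<le> \<bar>x\<bar>"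
  by (rule abs_zdiv_le[OF assms]) (use assms in \<open>simp add: mult_le_cancel_right1\<close>)

lemma abs_le_address: "0 \<le> y \<Longrightarrow> 8 * y + 48 \<le> V \<Longrightarrow> \<bar>y\<bar> \<le> (V :: int)"
  by linarith

text \<open>The data of the search, detached from matrices: the rows \<open>j < n\<close> of
  \<open>h\<close> form the triangular block, row \<open>n\<close> is the additional one,
  \<open>lam\<close> spans the relations between the rows, and \<open>E\<close> stands for
  \<Delta>.\<close>

locale simplex_matrix =
  fixes n :: nat and h :: "nat \<Rightarrow> nat \<Rightarrow> int" and lam :: "nat \<Rightarrow> int" and E :: nat
  assumes n_pos: "1 \<le> n" and E_ge: "2 \<le> E"
    and upper_zero: "i < n \<Longrightarrow> k < n \<Longrightarrow> i < k \<Longrightarrow> h i k = 0"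
    and row_bound: "i < n \<Longrightarrow> k < i \<Longrightarrow> 0 \<le> h i k \<and> h i k < h i i"
    and diag_pos: "k < n \<Longrightarrow> 1 \<le> h k k"
    and lam_pos: "j \<le> n \<Longrightarrow> 1 \<le> lam j"
    and lam_le: "j \<le> n \<Longrightarrow> lam j \<le> int E"
    and lam_last: "lam n = (\<Prod>k<n. h k k)"
    and lam_kernel: "k < n \<Longrightarrow> (\<Sum>j\<le>n. h j k * lam j) = 0"
begin

lemma partial_det_bounds: "1 \<le> (\<Prod>k\<in>{m..<n}. h k k)" "(\<Prod>k\<in>{m..<n}. h k k) \<le> lam n"
proof -
  show "1 \<le> (\<Prod>k\<in>{m..<n}. h k k)" by (rule prod_ge_1) (use diag_pos in auto)
  show "(\<Prod>k\<in>{m..<n}. h k k) \<le> lam n"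
    unfolding lam_last by (rule prod_mono2) (use diag_pos in \<open>force+\<close>)
qed

lemma diag_le_det: "k < n \<Longrightarrow> h k k \<le> lam n"
proof -
  assume "k < n"
  then have "(\<Prod>i\<in>{k}. h i i) \<le> (\<Prod>i<n. h i i)"
    by (intro prod_mono2) (use diag_pos in \<open>force+\<close>)
  then show ?thesis by (simp add: lam_last)
qed

lemma diag_le: "k < n \<Longrightarrow> h k k \<le> int E"
  using diag_le_det lam_le[of n] by force

lemma entry_le_diag: "j < n \<Longrightarrow> k < n \<Longrightarrow> \<bar>h j k\<bar> \<le> h j j"
  using upper_zero[of j k] row_bound[of j k] diag_pos[of j] by (cases j k rule: linorder_cases) auto

text \<open>The normal form says nothing about row \<open>n\<close>; its entries are bounded through
  the kernel equation of column \<open>k\<close>. Estimating \<open>h j k\<close> by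
  \<open>lam n\<close> instead of \<open>E\<close> is what allows \<open>lam n\<close> to be
  cancelled in the end.\<close>

lemma entry_le:
  assumes "j \<le> n" "k < n"
  shows "\<bar>h j k\<bar> \<le> int (n * E)"
proof (cases "j = n")
  case True
  have "(\<Sum>j\<le>n. h j k * lam j) = (\<Sum>j<n. h j k * lam j) + h n k * lam n"
    by (simp add: lessThan_Suc_atMost[symmetric])
  then have "\<bar>h n k * lam n\<bar> = \<bar>\<Sum>j<n. h j k * lam j\<bar>" using lam_kernel[OF assms(2)] by linarith
  also have "\<dots> \<le> (\<Sum>j<n. \<bar>h j k * lam j\<bar>)" by (rule sum_abs)
  also have "\<dots> \<le> of_nat (card {..<n}) * (lam n * int E)"
  proof (rule sum_bounded_above)
    fix j assume j: "j \<in> {..<n}"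
    then have "\<bar>h j k\<bar> \<le> lam n" using entry_le_diag[of j k] diag_le_det[of j] assms by force
    moreover have "\<bar>lam j\<bar> \<le> int E" using j lam_pos[of j] lam_le[of j] by auto
    ultimately show "\<bar>h j k * lam j\<bar> \<le> lam n * int E"
      unfolding abs_mult by (intro mult_mono) auto
  qed
  finally have "\<bar>h n k\<bar> * lam n \<le> int (n * E) * lam n"
    using lam_pos[of n] by (simp add: abs_mult mult_ac)
  then show ?thesis using lam_pos[of n] True by (simp add: mult_le_cancel_right)
next
  case False
  then have "\<bar>h j k\<bar> \<le> 1 * int E" using entry_le_diag[of j k] diag_le[of j] assms by force
  also have "\<dots> \<le> int (n * E)" using n_pos by (simp add: mult_le_cancel_right1)
  finally show ?thesis .
qed

text \<open>The state consists of the part of \<open>a\<close> that is not yet split into digits and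
  of the partial solution. Step \<open>s + 1\<close> settles entry \<open>n - 1 - s\<close>; entries
  not yet reached are 0, and entry \<open>n\<close> stays 0.\<close>

fun tau_state :: "nat \<Rightarrow> nat \<Rightarrow> int \<times> (nat \<Rightarrow> int)" where
  "tau_state a 0 = (int a, \<lambda>_. 0)"
| "tau_state a (Suc s) =
    (let k = n - Suc s; (c, X) = tau_state a s; u = (\<Sum>j\<le>n. h j k * X j) in
      (c div h k k, X(k := ((lam n * (c mod h k k) - u) mod (lam n * h k k)) div h k k)))"

text \<open>Back substitution for \<open>x H\<^sub>B = lam n * c\<close>, reduced modulo \<open>lam n\<close> in every step, where the
  entries of \<open>c\<close> modulo the diagonal are the mixed radix digits of \<open>a\<close>.\<close>

definition tau :: "nat \<Rightarrow> nat \<Rightarrow> int" where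
  "tau a = snd (tau_state a n)"

lemma tau_state_bounds:
  "s \<le> n \<Longrightarrow> 0 \<le> fst (tau_state a s) \<and> fst (tau_state a s) \<le> int a"
  "s \<le> n \<Longrightarrow> 0 \<le> snd (tau_state a s) j \<and> snd (tau_state a s) j < lam n"
  "s \<le> n \<Longrightarrow> j < n - s \<or> n \<le> j \<Longrightarrow> snd (tau_state a s) j = 0"
proof (induction s)
  case 0
  {
    case 1 then show ?case by simp
  next
    case 2 then show ?case using lam_pos[of n] by simp
  next
    case 3 then show ?case by simp
  }
next
  case (Suc s)
  let ?k = "n - Suc s"
  obtain c X where cX: "tau_state a s = (c, X)" by fastforce
  have k: "?k < n" using n_pos by simp
  have h: "1 \<le> h ?k ?k" using diag_pos[OF k] .
  have l: "1 \<le> lam n" using lam_pos[of n] by simp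
  have lh: "0 < lam n * h ?k ?k" using h l by simp
  {
    case 1
    then have c: "0 \<le> c" "c \<le> int a" using Suc.IH(1) cX by auto
    then have "c div h ?k ?k \<le> c" using abs_zdiv_le_abs[of "h ?k ?k" c] h by simp
    then show ?case using cX c h by (simp add: Let_def pos_imp_zdiv_nonneg_iff)
  next
    case 2
    have "\<And>x. 0 \<le> (x mod (lam n * h ?k ?k)) div h ?k ?k"
      using h lh by (simp add: pos_imp_zdiv_nonneg_iff)
    moreover have "\<And>x. (x mod (lam n * h ?k ?k)) div h ?k ?k < lam n"

    proof -
      fix x
      let ?y = "x mod (lam n * h ?k ?k)"
      have "?y div h ?k ?k * h ?k ?k \<le> ?y"
        using div_mult_mod_eq[of ?y "h ?k ?k"] pos_mod_sign[of "h ?k ?k" ?y] h by linarith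
      also have "\<dots> < lam n * h ?k ?k" using lh by simp
      finally show "?y div h ?k ?k < lam n" using h by simp
    qed
    ultimately show ?case using Suc.IH(2) 2 cX by (simp add: Let_def)
  next
    case 3
    then have "j < n - s \<or> n \<le> j" "j \<noteq> ?k" using k by linarith+
    then show ?case using Suc.IH(3) 3 cX by (simp add: Let_def)
  }
qed

end

section \<open>Running the linear algebra: determinant, kernel vector and back substitution\<close>

locale width_program = simplex_matrix +
  fixes V :: int
  assumes V_large: "64 * int ((n + 1) ^ 3) * int E ^ 5 \<le> V"
begin

definition loaded :: "(reg \<Rightarrow> int) \<Rightarrow> bool" where
  "loaded R \<longleftrightarrow> R 0 = 0 \<and> R 1 = 1 \<and> R 2 = int n \<and> R 3 = int (n + 1) \<and> R 4 = int (n * (n + 1)) \<and>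
     (\<forall>j\<le>n. \<forall>k<n. R (cell 4 (j * n + k)) = h j k)"

lemma loaded_agree:
  "loaded R \<Longrightarrow> agree_outside X R R' \<Longrightarrow> X \<inter> ({..<5} \<union> range (cell 4)) = {} \<Longrightarrow> loaded R'"
proof -
  assume a: "loaded R" "agree_outside X R R'" "X \<inter> ({..<5} \<union> range (cell 4)) = {}"
  have "R' r = R r" if "r \<in> {..<5} \<union> range (cell 4)" for r
    using a(2,3) that by (auto simp: agree_outside_def)
  then show ?thesis using a(1) by (auto simp: loaded_def)
qed

lemma loaded_upd: "r \<ge> 5 \<Longrightarrow> r < 40 \<Longrightarrow> loaded (R(r := v)) = loaded R"
  "a < 8 \<Longrightarrow> a \<noteq> 4 \<Longrightarrow> loaded (R(cell a k := v)) = loaded R"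
  by (auto simp: loaded_def cell_simps)

lemma loadedD:
  assumes "loaded R"
  shows "R 0 = 0" "R 1 = 1" "R (Suc 0) = 1" "R 2 = int n" "R 3 = int n + 1" "R 4 = int n * (int n + 1)"
    "j \<le> n \<Longrightarrow> k < n \<Longrightarrow> R (cell 4 (j * n + k)) = h j k"
  using assms by (auto simp: loaded_def algebra_simps)

text \<open>Values in the search are bounded by monomials in \<open>n + 1\<close> and
  \<open>E\<close>. The degrees cover addresses and dot products, quadratic in \<open>n + 1\<close>,
  and the comparison of fractions, of degree 5 in \<open>E\<close>. The factor 64 absorbs the stride
  8 and the offset 48 of addresses.\<close>

lemma V_ge: "i \<le> 3 \<Longrightarrow> j \<le> 5 \<Longrightarrow> 64 * (int (n + 1) ^ i * int E ^ j) \<le> V"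
proof -
  assume "i \<le> 3" "j \<le> 5"
  then have "int (n + 1) ^ i * int E ^ j \<le> int (n + 1) ^ 3 * int E ^ 5"
    using E_ge by (intro mult_mono power_increasing) auto
  then show ?thesis using V_large by simp
qed

lemma V_const: "64 \<le> V"
  using V_ge[of 0 0] by simp

lemma V_address: "8 * (int n * int n + 2 * int n + 1) + 48 \<le> V"
proof -
  have a: "64 * (int (n + 1) ^ 2) \<le> V" using V_ge[of 2 0] by simp
  have b: "1 \<le> int n * int n"
    using n_pos by (simp add: mult_le_cancel_left1 zero_less_mult_iff int_one_le_iff_zero_less)
  show ?thesis
    using a b by (simp add: power2_eq_square algebra_simps)
qed

lemma V_address_le:
  assumes "y \<le> int n * int n + 2 * int n + 1"
  shows "8 * y + 48 \<le> V"
proof -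
  have "8 * y + 48 \<le> 8 * (int n * int n + 2 * int n + 1) + 48" using assms by simp
  then show ?thesis using V_address by (rule order_trans)
qed

lemma V_index: "k \<le> n \<Longrightarrow> 8 * int k + 48 \<le> V"
proof (rule V_address_le)
  assume "k \<le> n"
  moreover have "0 \<le> int n * int n" by simp
  ultimately show "int k \<le> int n * int n + 2 * int n + 1" by linarith
qed

lemma V_entry_index: "j \<le> n \<Longrightarrow> k < n \<Longrightarrow> 8 * (int j * int n + int k) + 48 \<le> V"
proof (rule V_address_le)
  assume a: "j \<le> n" "k < n"
  then have "int j * int n \<le> int n * int n" by (intro mult_right_mono) auto
  then show "int j * int n + int k \<le> int n * int n + 2 * int n + 1" using a by linarith
qed

lemma dot_partial_bound:
  assumes "\<And>j. j \<le> n \<Longrightarrow> 0 \<le> X j \<and> X j \<le> int B" "k < n"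
  shows "\<bar>\<Sum>j = m..n. h j k * X j\<bar> \<le> int (n + 1) * (int (n * E) * int B)"
    "j \<le> n \<Longrightarrow> \<bar>h j k * X j\<bar> \<le> int (n + 1) * (int (n * E) * int B)"
proof -
  have 1: "\<bar>h j k * X j\<bar> \<le> int (n * E) * int B" if "j \<le> n" for j
    unfolding abs_mult using assms entry_le[OF that assms(2)] that by (intro mult_mono) auto
  have "\<bar>\<Sum>j = m..n. h j k * X j\<bar> \<le> (\<Sum>j = m..n. \<bar>h j k * X j\<bar>)" by (rule sum_abs)
  also have "\<dots> \<le> of_nat (card {m..n}) * (int (n * E) * int B)"
    by (rule sum_bounded_above) (use 1 in auto)
  also have "\<dots> \<le> int (n + 1) * (int (n * E) * int B)" by (intro mult_right_mono) auto
  finally show "\<bar>\<Sum>j = m..n. h j k * X j\<bar> \<le> int (n + 1) * (int (n * E) * int B)" .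
  have "1 * (int (n * E) * int B) \<le> int (n + 1) * (int (n * E) * int B)" by (intro mult_right_mono) auto
  then show "j \<le> n \<Longrightarrow> \<bar>h j k * X j\<bar> \<le> int (n + 1) * (int (n * E) * int B)" using 1[of j] by linarith
qed

text \<open>The vector entries are the counting factors of the products, hence
  \<open>0 \<le> X j\<close> and a time bound in terms of \<open>B\<close>, while the matrix entries
  may be negative.\<close>

lemma run_Dot_Col:
  assumes R: "loaded R" "R 10 = int k" "k < n" and a: "a < 8" "a \<noteq> 4"
    and X: "\<And>j. j \<le> n \<Longrightarrow> R (cell a j) = X j" "\<And>j. j \<le> n \<Longrightarrow> 0 \<le> X j \<and> X j \<le> int B"
    and BV: "int (n + 1) * (int (n * E) * int B) \<le> V"
    and N: "(n + 1) * (3 * B + 19) + 4 \<le> N"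
    and Q: "\<And>R'. agree_outside {6, 7, 8, 11, 12, 13, 14, 15, 16} R R' \<Longrightarrow>
              R' 12 = (\<Sum>j\<le>n. h j k * X j) \<Longrightarrow> Q R' inp out"
  shows "run V (Dot_Col a) N R inp out Q"
proof -
  let ?T = "{6, 7, 8, 11, 12, 13, 14, 15, 16} :: nat set"
  define I where "I m R' i' o' \<longleftrightarrow> m \<le> n + 1 \<and> agree_outside ?T R R' \<and> R' 11 = int m \<and>
    R' 13 = int m * int n + int k \<and> R' 12 = (\<Sum>j = m..n. h j k * X j) \<and> i' = inp \<and> o' = out"
    for m R' and i' o' :: "int list"
  note bound = dot_partial_bound[where X = X and B = B, OF X(2) R(3)]
  have body: "run V (Seq (Sub 13 13 2) (Seq (Array_Load 16 4 13) (Seq (Array_Load 14 a 11) (Seq (Mul 15 16 14)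
       (Add 12 12 15))))) (3 * B + 17) (R'(11 := int m)) i' o' (I m)"
    if m: "m < n + 1" and I: "I (Suc m) R' i' o'" for m R' i' o'
  proof -
    have ag: "agree_outside ?T R R'" and r: "R' 13 = int m * int n + int k + int n"
      "R' 12 = (\<Sum>j = Suc m..n. h j k * X j)" and io: "i' = inp" "o' = out"
      using I by (auto simp: I_def algebra_simps)
    have s: "loaded R'" by (rule loaded_agree[OF R(1) ag]) (auto simp: cell_simps)
    have x: "R' (cell a m) = X m"
      using agree_outsideD[OF ag, of "cell a m"] X(1)[of m] m a by (simp add: cell_simps)
    have hh: "R' (cell 4 (m * n + k)) = h m k" using loadedD(7)[OF s] m R(3) by simp
    have na: "nat (int m * int n + int k) = m * n + k" by (simp add: nat_add_distrib nat_mult_distrib)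
    have sum: "(\<Sum>j = Suc m..n. h j k * X j) + h m k * X m = (\<Sum>j = m..n. h j k * X j)"
      using m by (simp add: sum.atLeast_Suc_atMost)
    have ad: "8 * (int m * int n + int k) + 48 \<le> V" using V_entry_index m R(3) by simp
    have adV: "\<bar>int m * int n + int k\<bar> \<le> V" by (rule abs_le_address) (use ad in simp_all)
    have vi: "8 * int m + 48 \<le> V" using V_index m by simp
    have b: "\<bar>h m k * X m\<bar> \<le> V" "\<bar>\<Sum>j = m..n. h j k * X j\<bar> \<le> V"
      using bound(2)[where j = m] bound(1)[where m = m] BV m by linarith+
    have xm: "0 \<le> X m" "X m \<le> int B" using X(2) m by auto
    show ?thesis
      apply (rule run_weaken)
       apply (rule run_Seq, rule run_Sub)
        apply (use s r adV in \<open>simp add: loadedD\<close>)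
       apply (rule run_Seq, rule run_Array_Load)
           apply (use s r ad in \<open>simp_all add: loadedD\<close>)[4]
       apply (rule run_Seq, rule run_Array_Load)
           apply (use a vi in \<open>simp_all\<close>)[4]
       apply (rule run_Seq, rule run_Mul[where N = "3 * B + 3"])
              apply (use s r xm hh na b in \<open>simp_all add: loadedD cell_simps a x\<close>)[7]
       apply (rule run_Add)
        apply (use s r b sum hh na in \<open>simp add: loadedD cell_simps a x\<close>)
       apply (use s r b sum hh na io m ag in \<open>simp add: loadedD cell_simps a x I_def agree_outside_upd\<close>)
      apply simp
      done
  qed
  have b0: "\<bar>int n * (int n + 1) + int k\<bar> \<le> V"
    by (rule abs_le_address[OF _ V_address_le]) (use R(3) in \<open>simp_all add: algebra_simps\<close>)
  show ?thesis
    unfolding Dot_Col_def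
    apply (rule run_weaken)
     apply (rule run_Seq, rule run_Assign)
      apply (use V_const in simp)
     apply (rule run_Seq, rule run_Add)
      apply (use R b0 in \<open>simp add: loadedD\<close>)
     apply (rule run_Seq, rule run_Copy)
      apply (use R in \<open>simp add: loadedD\<close>)
     apply (rule run_For_Down[where I = I and m = "n + 1" and N = "3 * B + 17", OF _ _ body])
         apply (use R in \<open>simp add: I_def loadedD agree_outside_upd agree_outside_refl algebra_simps\<close>)
        apply (use loaded_agree[OF R(1)] in \<open>fastforce simp: I_def loadedD cell_simps\<close>)
       apply assumption+
     apply (use Q in \<open>auto simp: I_def atMost_atLeast0\<close>)
    using N by (simp add: algebra_simps)
qed

lemma V_prod: "i \<le> 3 \<Longrightarrow> j \<le> 5 \<Longrightarrow> x \<le> int (n + 1) ^ i * int E ^ j \<Longrightarrow> x \<le> V"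
proof -
  assume a: "i \<le> 3" "j \<le> 5" "x \<le> int (n + 1) ^ i * int E ^ j"
  have "0 \<le> int (n + 1) ^ i * int E ^ j" by simp
  then show ?thesis using V_ge[OF a(1,2)] a(3) by linarith
qed

lemma V_dot: "B \<le> E ^ 2 \<Longrightarrow> int (n + 1) * (int (n * E) * int B) \<le> V"
proof (rule V_prod[of 2 3])
  assume "B \<le> E ^ 2"
  then have "int (n * E) * int B \<le> int ((n + 1) * E) * int (E ^ 2)" by (intro mult_mono) auto
  then have "int (n + 1) * (int (n * E) * int B) \<le> int (n + 1) * (int ((n + 1) * E) * int (E ^ 2))"
    by (intro mult_left_mono) auto
  then show "int (n + 1) * (int (n * E) * int B) \<le> int (n + 1) ^ 2 * int E ^ 3"
    by (simp add: power2_eq_square power3_eq_cube algebra_simps)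
qed auto

lemma run_Diag:
  assumes R: "loaded R" "R 10 = int k" "k < n"
    and N: "3 * n + 10 \<le> N"
    and Q: "\<And>R'. agree_outside {6, 7, 8, 15, 16} R R' \<Longrightarrow> R' 16 = h k k \<Longrightarrow> Q R' inp out"
  shows "run V Diag N R inp out Q"
proof -
  have ad: "8 * (int n * int k + int k) + 48 \<le> V"
    using V_entry_index[of k k] R(3) by (simp add: mult.commute)
  have adV: "\<bar>int n * int k + int k\<bar> \<le> V" by (rule abs_le_address) (use ad in simp_all)
  have adV': "\<bar>int n * int k\<bar> \<le> V"
    by (rule abs_le_address) (use ad in \<open>simp_all add: algebra_simps\<close>)
  have na: "nat (int n * int k + int k) = k * n + k" by (simp add: nat_add_distrib nat_mult_distrib mult.commute)
  have hh: "R (cell 4 (k * n + k)) = h k k" using loadedD(7)[OF R(1)] R(3) by simp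
  show ?thesis
    unfolding Diag_def
    apply (rule run_weaken)
     apply (rule run_Seq, rule run_Mul[where N = "3 * n + 3"])
            apply (use R adV' in \<open>simp_all add: loadedD\<close>)[7]
     apply (rule run_Seq, rule run_Add)
      apply (use R adV in \<open>simp add: loadedD\<close>)
     apply (rule run_Array_Load)
         apply (use R ad in \<open>simp_all add: loadedD\<close>)[4]
     apply (rule Q)
      apply (use R hh na in \<open>simp_all add: loadedD cell_simps agree_outside_upd agree_outside_refl\<close>)[2]
    using N by simp
qed

lemma run_Det:
  assumes R: "loaded R"
    and N: "n * (3 * n + 3 * E + 16) + 3 \<le> N"
    and Q: "\<And>R'. agree_outside {5, 6, 7, 8, 10, 14, 15, 16} R R' \<Longrightarrow> R' 5 = lam n \<Longrightarrow> Q R' inp out"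
  shows "run V Det N R inp out Q"
proof -
  let ?T = "{5, 6, 7, 8, 10, 14, 15, 16} :: nat set"
  define I where "I m R' i' o' \<longleftrightarrow> m \<le> n \<and> agree_outside ?T R R' \<and> R' 10 = int m \<and>
    R' 5 = (\<Prod>k\<in>{m..<n}. h k k) \<and> i' = inp \<and> o' = out"
    for m R' and i' o' :: "int list"
  have body: "run V (Seq Diag (Seq (Mul 14 5 16) (Copy 5 14))) (3 * n + 3 * E + 14) (R'(10 := int m)) i' o' (I m)"
    if m: "m < n" and I: "I (Suc m) R' i' o'" for m R' i' o'
  proof -
    have ag: "agree_outside ?T R R'" and r: "R' 5 = (\<Prod>k\<in>{Suc m..<n}. h k k)" and io: "i' = inp" "o' = out"
      using I by (auto simp: I_def)
    have s: "loaded R'" by (rule loaded_agree[OF R(1) ag]) (auto simp: cell_simps)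
    have e: "(\<Prod>k\<in>{Suc m..<n}. h k k) * h m m = (\<Prod>k\<in>{m..<n}. h k k)"
      using m by (simp add: prod.atLeast_Suc_lessThan)
    have hm: "1 \<le> h m m" "h m m \<le> int E" using diag_pos diag_le m by auto
    have "\<bar>\<Prod>k\<in>{m..<n}. h k k\<bar> \<le> int (n + 1) ^ 0 * int E ^ 1"
      using partial_det_bounds[of m] lam_le[of n] by simp
    then have b: "\<bar>\<Prod>k\<in>{m..<n}. h k k\<bar> \<le> V" by (rule V_prod[rotated 2]) auto
    have rest: "run V (Seq (Mul 14 5 16) (Copy 5 14)) (3 * E + 4) R1 i' o' (I m)"
      if a1: "agree_outside {6, 7, 8, 15, 16} (R'(10 := int m)) R1" and r1: "R1 16 = h m m" for R1
    proof -
      have ag2: "agree_outside ?T R R1"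
        by (rule agree_outside_trans[OF agree_outside_upd[OF ag] a1]) auto
      note R1 = agree_outsideD[OF a1]
      show ?thesis
        apply (rule run_weaken)
         apply (rule run_Seq, rule run_Mul[where N = "3 * E + 3"])
                apply (use s r e b hm in \<open>simp_all add: loadedD R1 r1\<close>)[7]
         apply (rule run_Copy)
          apply (use s in \<open>simp add: loadedD R1\<close>)
         apply (use m io e r ag2 in \<open>simp add: I_def agree_outside_upd R1 r1\<close>)
        apply simp
        done
    qed
    show ?thesis
      apply (rule run_weaken)
       apply (rule run_Seq, rule run_Diag[where k = m, OF _ _ m order_refl])
         apply (use s in \<open>simp_all add: loaded_upd\<close>)[2]
       apply (rule rest; assumption)
      apply simp
      done
  qed
  show ?thesis
    unfolding Det_def
    apply (rule run_weaken)
     apply (rule run_Seq, rule run_Assign)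
      apply (use V_const in simp)
     apply (rule run_Seq, rule run_Copy)
      apply (use R in \<open>simp add: loadedD\<close>)
     apply (rule run_For_Down[where I = I and m = "n" and N = "3 * n + 3 * E + 14", OF _ _ body])
         apply (use R in \<open>simp add: I_def loadedD agree_outside_upd agree_outside_refl\<close>)
        apply (use loaded_agree[OF R(1)] in \<open>fastforce simp: I_def loadedD cell_simps\<close>)
       apply assumption+
     apply (use Q in \<open>auto simp: I_def lam_last atLeast0LessThan\<close>)
    using N by (simp add: algebra_simps)
qed

text \<open>In column \<open>m\<close> of the kernel equations the rows above \<open>m\<close>
  contribute nothing, and the array still holds 0 at \<open>m\<close>. The dot product with the
  entries known so far is thus \<open>- h m m * lam m\<close>, and one division recovers
  \<open>lam m\<close>.\<close>

lemma run_Lambda: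
  assumes R: "loaded R" "R 5 = lam n" "\<And>j. R (cell 0 j) = 0"
    and N: "n * ((n + 1) * (3 * E + 19) + 3 * n + 4 * E + 32) + 8 \<le> N"
    and Q: "\<And>R'. agree_outside ({6..16} \<union> range (cell 0)) R R' \<Longrightarrow>
              (\<And>j. j \<le> n \<Longrightarrow> R' (cell 0 j) = lam j) \<Longrightarrow> Q R' inp out"
  shows "run V Lambda N R inp out Q"
proof -
  let ?T = "{6..16} \<union> range (cell 0)"
  let ?X = "\<lambda>m j. if m \<le> j \<and> j \<le> n then lam j else 0"
  define I where "I m R' i' o' \<longleftrightarrow> m \<le> n \<and> agree_outside ?T R R' \<and> R' 10 = int m \<and>
    (\<forall>j. R' (cell 0 j) = ?X m j) \<and> i' = inp \<and> o' = out"
    for m R' and i' o' :: "int list"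
  have body: "run V (Seq (Dot_Col 0) (Seq Diag Lambda_Step))
      ((n + 1) * (3 * E + 19) + 3 * n + 4 * E + 30) (R'(10 := int m)) i' o' (I m)"
    if m: "m < n" and I: "I (Suc m) R' i' o'" for m R' i' o'
  proof -
    have ag: "agree_outside ?T R R'" and r: "\<And>j. R' (cell 0 j) = ?X (Suc m) j" and io: "i' = inp" "o' = out"
      using I by (auto simp: I_def)
    have s: "loaded R'" by (rule loaded_agree[OF R(1) ag]) (auto simp: cell_simps)
    have "0 = (\<Sum>j\<le>n. h j m * lam j)" using lam_kernel[OF m] by simp
    also have "\<dots> = (\<Sum>j\<le>n. h j m * ?X (Suc m) j + (if j = m then h m m * lam m else 0))"
      by (rule sum.cong) (use m upper_zero in auto)
    also have "\<dots> = (\<Sum>j\<le>n. h j m * ?X (Suc m) j) + h m m * lam m"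
      using m by (simp add: sum.distrib)
    finally have dot: "(\<Sum>j\<le>n. h j m * ?X (Suc m) j) = - (h m m * lam m)" by simp
    have hm: "1 \<le> h m m" "h m m \<le> int E" using diag_pos diag_le m by auto
    have lm: "1 \<le> lam m" "lam m \<le> int E" using lam_pos lam_le m by auto
    have quot: "h m m * lam m div h m m = lam m" using hm by simp
    have "h m m * lam m \<le> int E * int E" using hm lm by (intro mult_mono) auto
    then have "h m m * lam m \<le> V" by (intro V_prod[of 0 2]) (auto simp: power2_eq_square)
    then have b: "\<bar>h m m * lam m\<bar> \<le> V" using hm lm by (simp add: abs_mult)
    have step: "run V Lambda_Step (4 * E + 16) R2 i' o' (I m)"
      if a2: "agree_outside {6, 7, 8, 11, 12, 13, 14, 15, 16} (R'(10 := int m)) R2"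
        and r2: "R2 12 = - (h m m * lam m)" "R2 16 = h m m" for R2
    proof -
      have ag2: "agree_outside ?T R R2"
        by (rule agree_outside_trans[OF agree_outside_upd[OF ag] a2]) (auto simp: cell_simps)
      note R2 = agree_outsideD[OF a2]
      show ?thesis
        unfolding Lambda_Step_def
        apply (rule run_weaken)
         apply (rule run_Seq, rule run_Sub)
          apply (use s r2 b in \<open>simp add: loadedD R2\<close>)
         apply (rule run_Seq, rule run_Div_Mod[where N = "4 * E + 9"])
                 apply (use s r2 hm lm quot in \<open>simp_all add: loadedD R2\<close>)[7]
         apply (rule run_Array_Store)
               apply (use s V_index[of m] m in \<open>simp_all add: loadedD R2\<close>)[6]
         apply (use m io r r2 ag2 quot hm in \<open>auto simp: I_def cell_simps R2 loadedD(1)[OF s] intro!: agree_outside_upd\<close>)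
        done
    qed
    have diag: "run V (Seq Diag Lambda_Step) ((3 * n + 10) + (4 * E + 16)) R1 i' o' (I m)"
      if a1: "agree_outside {6, 7, 8, 11, 12, 13, 14, 15, 16} (R'(10 := int m)) R1"
        and r1: "R1 12 = (\<Sum>j\<le>n. h j m * ?X (Suc m) j)" for R1
    proof (rule run_Seq, rule run_Diag[where k = m, OF _ _ m order_refl])
      show "loaded R1"
        by (rule loaded_agree[OF _ a1]) (use s in \<open>auto simp: loaded_upd cell_simps\<close>)
      show "R1 10 = int m" using agree_outsideD[OF a1, of 10] by simp
      fix R2 assume a2: "agree_outside {6, 7, 8, 15, 16} R1 R2" and r2: "R2 16 = h m m"
      show "run V Lambda_Step (4 * E + 16) R2 i' o' (I m)"
        by (rule step[OF agree_outside_trans[OF a1 a2]])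
          (use agree_outsideD[OF a2, of 12] r1 dot r2 in auto)
    qed
    have "run V (Seq (Dot_Col 0) (Seq Diag Lambda_Step))
      ((n + 1) * (3 * E + 19) + 4 + ((3 * n + 10) + (4 * E + 16))) (R'(10 := int m)) i' o' (I m)"
    proof (rule run_Seq, rule run_Dot_Col[where k = m and X = "?X (Suc m)" and B = E, OF _ _ m])
      show "loaded (R'(10 := int m))" using s by (simp add: loaded_upd)
      show "0 \<le> ?X (Suc m) j \<and> ?X (Suc m) j \<le> int E" if "j \<le> n" for j
        using lam_pos[OF that] lam_le[OF that] by auto
      show "int (n + 1) * (int (n * E) * int E) \<le> V"
        by (rule V_dot) (simp add: power2_eq_square)
    qed (use r diag in \<open>auto simp: cell_simps\<close>)
    then show ?thesis by (rule run_weaken) simp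
  qed
  show ?thesis
    unfolding Lambda_def
    apply (rule run_weaken)
     apply (rule run_Seq, rule run_Array_Store)
           apply (use R V_index[of n] in \<open>simp_all add: loadedD\<close>)[6]
     apply (rule run_Seq, rule run_Copy)
      apply (use R in \<open>simp add: loadedD cell_simps\<close>)
     apply (rule run_For_Down[where I = I and m = "n" and
          N = "(n + 1) * (3 * E + 19) + 3 * n + 4 * E + 30", OF _ _ body])
         apply (use R in \<open>auto simp: I_def loadedD cell_simps intro!: agree_outside_upd agree_outside_refl\<close>)[1]
        apply (use loaded_agree[OF R(1)] in \<open>fastforce simp: I_def loadedD cell_simps\<close>)
       apply assumption+
     apply (use Q in \<open>auto simp: I_def\<close>)[1]
    using N by (auto simp: algebra_simps)
qed

lemma run_Tau_Step:
  assumes R: "loaded R" "R 10 = int k" "R 5 = lam n" "R 16 = h k k" "k < n"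
    and c: "R 23 = c" "0 \<le> c" "c \<le> int E"
    and u: "R 12 = u" "\<bar>u\<bar> \<le> int (n + 1) * (int (n * E) * int E)"
    and N: "4 * (n + 1) ^ 2 * E ^ 3 + 14 * E + 60 \<le> N"
    and Q: "\<And>R'. agree_outside ({6..9} \<union> {11..17} \<union> {23} \<union> {cell 5 k}) R R' \<Longrightarrow> R' 23 = c div h k k \<Longrightarrow>
       R' (cell 5 k) = ((lam n * (c mod h k k) - u) mod (lam n * h k k)) div h k k \<Longrightarrow> Q R' inp out"
  shows "run V Tau_Step N R inp out Q"
proof -
  define d x y where "d = c mod h k k" and "x = lam n * d - u" and "y = lam n * h k k"
  have hk: "1 \<le> h k k" "h k k \<le> int E" using diag_pos diag_le R(5) by auto
  have l: "1 \<le> lam n" "lam n \<le> int E" using lam_pos[of n] lam_le[of n] by auto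
  have d: "0 \<le> d" "d < h k k" using hk by (auto simp: d_def)
  have y: "1 * 1 \<le> y" unfolding y_def using hk l by (intro mult_mono) auto
  have "y \<le> int E * int E" unfolding y_def using hk l by (intro mult_mono) auto
  then have yV: "\<bar>y\<bar> \<le> V" using y by (intro V_prod[of 0 2]) (auto simp: power2_eq_square)
  have ld: "0 \<le> lam n * d" "lam n * d \<le> int E * int E"
    using l d hk by (auto intro!: mult_mono)
  then have ldV: "\<bar>lam n * d\<bar> \<le> V" by (intro V_prod[of 0 2]) (auto simp: power2_eq_square)
  have E1: "int E * int E \<le> int E ^ 3" using E_ge by (simp add: power3_eq_cube)
  have x: "\<bar>x\<bar> \<le> int ((n + 1) ^ 2 * E ^ 3)"
  proof -
    have "\<bar>x\<bar> \<le> int E * int E + int (n + 1) * (int (n * E) * int E)"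
      using ld u(2) by (simp add: x_def)
    also have "\<dots> = int (1 + (n + 1) * n) * (int E * int E)" by (simp add: algebra_simps)
    also have "\<dots> \<le> int ((n + 1) ^ 2) * int E ^ 3"
      using E1 by (intro mult_mono) (auto simp: power2_eq_square)
    finally show ?thesis by simp
  qed
  have xV: "\<bar>x\<bar> \<le> V" by (rule V_prod[of 2 3]) (use x in auto)
  have q1: "4 * nat \<bar>c div h k k\<bar> + 9 \<le> 4 * E + 9"
    using abs_zdiv_le_abs[of "h k k" c] hk c by simp
  \<comment> \<open>The number of rounds is bounded crudely by the dividend itself. This division
    dominates the step and is the origin of the term \<open>(n + 1) ^ 2 * E ^ 3\<close> in its
    cost.\<close>
  have q2: "4 * nat \<bar>x div y\<bar> + 9 \<le> 4 * ((n + 1) ^ 2 * E ^ 3) + 9"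
    using abs_zdiv_le_abs[of y x] y x by (simp add: nat_le_iff)
  have xm: "0 \<le> x mod y" "x mod y < y" using y by auto
  have q3: "4 * nat \<bar>x mod y div h k k\<bar> + 9 \<le> 4 * E + 9"
  proof -
    have "\<bar>x mod y div h k k\<bar> \<le> lam n"
      by (rule abs_zdiv_le) (use hk xm in \<open>auto simp: y_def mult.commute\<close>)
    then show ?thesis using l by simp
  qed
  have ag: "agree_outside ({6..9} \<union> {11..17} \<union> {23} \<union> {cell 5 k}) R R" by (rule agree_outside_refl)
  note Rs = loadedD[OF R(1)] R(2-4) c(1) u(1)
  show ?thesis
    unfolding Tau_Step_def
    apply (rule run_weaken)
     apply (rule run_Seq, rule run_Div_Mod[where N = "4 * E + 9"])
             apply (use hk q1 in \<open>simp_all add: Rs d_def[symmetric]\<close>)[7]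
     apply (simp add: Rs d_def[symmetric])
     apply (rule run_Seq, rule run_Mul[where N = "3 * E + 3"])
            apply (use hk d ldV in \<open>simp_all add: Rs\<close>)[7]
     apply (simp add: Rs)
     apply (rule run_Seq, rule run_Copy)
      apply (simp add: Rs)
     apply (rule run_Seq, rule run_Sub)
      apply (use xV in \<open>simp add: Rs x_def[symmetric]\<close>)
     apply (simp add: Rs x_def[symmetric])
     apply (rule run_Seq, rule run_Mul[where N = "3 * E + 3"])
            apply (use hk yV in \<open>simp_all add: Rs y_def[symmetric]\<close>)[7]
     apply (simp add: Rs y_def[symmetric])
     apply (rule run_Seq, rule run_Div_Mod[where N = "4 * ((n + 1) ^ 2 * E ^ 3) + 9"])
             apply (use y q2 in \<open>simp_all add: Rs\<close>)[7]
     apply (simp add: Rs)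
     apply (rule run_Seq, rule run_Div_Mod[where N = "4 * E + 9"])
             apply (use hk q3 in \<open>simp_all add: Rs\<close>)[7]
     apply (simp add: Rs)
     apply (rule run_Array_Store)
           apply (use V_index[of k] R(5) in \<open>simp_all add: Rs\<close>)[6]
     apply (rule Q)
       apply (use ag in \<open>simp add: agree_outside_upd cell_simps Rs\<close>)
      apply (simp add: Rs cell_simps)
     apply (simp add: Rs cell_simps y_def[symmetric] d_def[symmetric] x_def[symmetric])
    using N by simp
qed

lemma run_Tau:
  assumes R: "loaded R" "R 5 = lam n" "R 20 = int a" "a \<le> E"
    and N: "200 * ((n + 1) ^ 3 * E ^ 3) \<le> N"
    and Q: "\<And>R'. agree_outside ({6..17} \<union> {23} \<union> range (cell 5)) R R' \<Longrightarrow>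
      (\<And>j. j \<le> n \<Longrightarrow> R' (cell 5 j) = tau a j) \<Longrightarrow> Q R' inp out"
  shows "run V Tau N R inp out Q"
proof -
  let ?T = "{6..17} \<union> {23} \<union> range (cell 5)"
  \<comment> \<open>Invariant of the clearing loop: the array may still hold the vector that belongs
    to the previous \<open>a\<close>.\<close>
  define J where "J m R' i' o' \<longleftrightarrow> m \<le> n + 1 \<and> agree_outside ?T R R' \<and> R' 10 = int m \<and> R' 23 = int a \<and>
    (\<forall>j\<in>{m..n}. R' (cell 5 j) = 0) \<and> i' = inp \<and> o' = out"
    for m R' and i' o' :: "int list"
  define I where "I m R' i' o' \<longleftrightarrow> m \<le> n \<and> agree_outside ?T R R' \<and> R' 10 = int m \<and>
    R' 23 = fst (tau_state a (n - m)) \<and>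
    (\<forall>j\<le>n. R' (cell 5 j) = snd (tau_state a (n - m)) j) \<and> i' = inp \<and> o' = out"
    for m R' and i' o' :: "int list"
  have J_loaded: "loaded R'" if "J m R' i' o'" for m R' i' o'
    by (rule loaded_agree[OF R(1), of ?T]) (use that in \<open>auto simp: J_def cell_simps\<close>)
  have I_loaded: "loaded R'" if "I m R' i' o'" for m R' i' o'
    by (rule loaded_agree[OF R(1), of ?T]) (use that in \<open>auto simp: I_def cell_simps\<close>)
  have clear: "run V (Array_Store 5 10 0) 6 (R'(10 := int m)) i' o' (J m)"
    if m: "m < n + 1" and J: "J (Suc m) R' i' o'" for m R' i' o'
  proof (rule run_Array_Store)
    show "8 * (R'(10 := int m)) 10 + 48 \<le> V" using V_index[of m] m by simp
    have z: "R' 0 = 0" using loadedD(1)[OF J_loaded[OF J]] .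
    show "J m ((R'(10 := int m))(6 := v, 7 := w,
      cell 5 (nat ((R'(10 := int m)) 10)) := (R'(10 := int m)) 0)) i' o'" for v w
      using J m z by (auto simp: J_def cell_simps intro!: agree_outside_upd)
  qed auto
  have body: "run V (Seq (Dot_Col 5) (Seq Diag Tau_Step))
      ((n + 1) * (3 * E + 19) + 4 + ((3 * n + 10) + (4 * (n + 1) ^ 2 * E ^ 3 + 14 * E + 60)))
      (R'(10 := int m)) i' o' (I m)"
    if m: "m < n" and I: "I (Suc m) R' i' o'" for m R' i' o'
  proof -
    define s where "s = n - Suc m"
    have s: "s \<le> n" "n - m = Suc s" "n - Suc s = m" using m by (auto simp: s_def)
    obtain c X where cX: "tau_state a s = (c, X)" by fastforce
    have ag: "agree_outside ?T R R'" and r: "R' 23 = c" "\<And>j. j \<le> n \<Longrightarrow> R' (cell 5 j) = X j"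
      and io: "i' = inp" "o' = out"
      using I cX by (auto simp: I_def s_def)
    have ld: "loaded R'" using I_loaded[OF I] .
    have c: "0 \<le> c" "c \<le> int E" using tau_state_bounds(1)[OF s(1), of a] cX R(4) by auto
    have X: "0 \<le> X j" "X j \<le> int E" for j
      using tau_state_bounds(2)[OF s(1), of a j] cX lam_le[of n] by auto
    let ?u = "\<Sum>j\<le>n. h j m * X j"
    have u: "\<bar>?u\<bar> \<le> int (n + 1) * (int (n * E) * int E)"
      using dot_partial_bound(1)[where X = X and B = E and k = m and m = 0] X m by (simp add: atMost_atLeast0)
    show ?thesis
    proof (rule run_Seq, rule run_Dot_Col[where k = m and X = X and B = E, OF _ _ m])
      show "loaded (R'(10 := int m))" using ld by (simp add: loaded_upd)
      show "int (n + 1) * (int (n * E) * int E) \<le> V" by (rule V_dot) (simp add: power2_eq_square)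
      fix R1 assume a1: "agree_outside {6, 7, 8, 11, 12, 13, 14, 15, 16} (R'(10 := int m)) R1"
        and r1: "R1 12 = ?u"
      have ag1: "agree_outside ?T R R1"
        by (rule agree_outside_trans[OF agree_outside_upd[OF ag] a1]) auto
      show "run V (Seq Diag Tau_Step) ((3 * n + 10) + (4 * (n + 1) ^ 2 * E ^ 3 + 14 * E + 60)) R1 i' o' (I m)"
      proof (rule run_Seq, rule run_Diag[where k = m, OF _ _ m order_refl])
        show "loaded R1" by (rule loaded_agree[OF R(1) ag1]) (auto simp: cell_simps)
        show "R1 10 = int m" using agree_outsideD[OF a1, of 10] by simp
        fix R2 assume a2: "agree_outside {6, 7, 8, 15, 16} R1 R2" and r2: "R2 16 = h m m"
        have ag2: "agree_outside ?T R R2" by (rule agree_outside_trans[OF ag1 a2]) auto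
        note R1 = agree_outsideD[OF a1] and R2 = agree_outsideD[OF a2]
        show "run V Tau_Step (4 * (n + 1) ^ 2 * E ^ 3 + 14 * E + 60) R2 i' o' (I m)"
        proof (rule run_Tau_Step[where k = m and c = c and u = ?u])
          show "loaded R2" by (rule loaded_agree[OF R(1) ag2]) (auto simp: cell_simps)
          show "R2 5 = lam n" using agree_outsideD[OF ag2, of 5] R(2) by (simp add: cell_simps)
          fix R3 assume a3: "agree_outside ({6..9} \<union> {11..17} \<union> {23} \<union> {cell 5 m}) R2 R3"
            and r3: "R3 23 = c div h m m"
              "R3 (cell 5 m) = (lam n * (c mod h m m) - ?u) mod (lam n * h m m) div h m m"
          have ag3: "agree_outside ?T R R3" by (rule agree_outside_trans[OF ag2 a3]) auto
          have "R3 (cell 5 j) = snd (tau_state a (Suc s)) j" if "j \<le> n" for j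
            using r3 agree_outsideD[OF a3, of "cell 5 j"] R2[of "cell 5 j"] R1[of "cell 5 j"] r(2)[OF that] cX s
            by (cases "j = m") (simp_all add: Let_def cell_simps)
          moreover have "R3 10 = int m"
            using agree_outsideD[OF a3, of 10] R2[of 10] R1[of 10] by (simp add: cell_simps)
          ultimately show "I m R3 i' o'"
            using m ag3 r3 io s cX by (simp add: I_def Let_def)
        qed (use r2 r1 r c u m R1 R2 in \<open>auto simp: cell_simps\<close>)
      qed
    qed (use r X in \<open>auto simp: cell_simps\<close>)
  qed
  let ?B = "(n + 1) * (3 * E + 19) + 4 + ((3 * n + 10) + (4 * (n + 1) ^ 2 * E ^ 3 + 14 * E + 60))"
  have total: "1 + (1 + (((n + 1) * (6 + 2) + 1) + (1 + (n * (?B + 2) + 1)))) \<le> 200 * ((n + 1) ^ 3 * E ^ 3)"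
  proof -
    define x M where "x = n + 1" and "M = x ^ 3 * E ^ 3"
    have mono: "x ^ i * E ^ j \<le> M" if "i \<le> 3" "j \<le> 3" for i j
      unfolding M_def x_def using that E_ge by (intro mult_mono power_increasing) auto
    have m: "1 \<le> M" "x \<le> M" "x * x \<le> M" "x * (x * E) \<le> M" "x * E \<le> M" "x * (x * (x * (E * (E * E)))) \<le> M"
      using mono[of 0 0] mono[of 1 0] mono[of 2 0] mono[of 2 1] mono[of 1 1] mono[of 3 3]
      by (simp_all add: power2_eq_square power3_eq_cube mult_ac)
    define z where "z = n * (?B + 2)"
    have "z \<le> x * (?B + 2)" by (simp add: x_def z_def)
    also have "?B \<le> x * (3 * E + 19) + 4 + ((3 * x + 10) + (4 * x ^ 2 * E ^ 3 + 14 * E + 60))"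
      by (simp add: x_def)
    finally have "z \<le> x * (x * (3 * E + 19) + 4 + ((3 * x + 10) + (4 * x ^ 2 * E ^ 3 + 14 * E + 60)) + 2)"
      by simp
    also have "\<dots> = 3 * (x * (x * E)) + 22 * (x * x) + 76 * x + 4 * (x * (x * (x * (E * (E * E))))) + 14 * (x * E)"
      by (simp add: algebra_simps power2_eq_square power3_eq_cube)
    also have "\<dots> \<le> 3 * M + 22 * M + 76 * M + 4 * M + 14 * M"
      by (intro add_mono mult_left_mono m) auto
    finally have "z \<le> 119 * M" by simp
    moreover have "1 + (1 + ((x * (6 + 2) + 1) + (1 + (z + 1)))) = 8 * x + z + 5" by simp
    ultimately show ?thesis
      using m(1,2) unfolding M_def[symmetric] x_def[symmetric] z_def[unfolded x_def[symmetric], symmetric] by linarith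
  qed
  show ?thesis
    unfolding Tau_def
    apply (rule run_weaken)
     apply (rule run_Seq, rule run_Copy)
      apply (use R in \<open>simp add: loadedD\<close>)
     apply (rule run_Seq, rule run_Copy)
      apply (use R in \<open>simp add: loadedD\<close>)
     apply (rule run_Seq, rule run_For_Down[where I = J and m = "n + 1" and N = 6, OF _ _ clear])
          apply (use R in \<open>auto simp: J_def loadedD intro!: agree_outside_upd agree_outside_refl\<close>)[1]
         apply (use loadedD(2)[OF J_loaded] in \<open>fastforce simp: J_def\<close>)
        apply assumption+
      apply (rule run_Seq, rule run_Copy)
       apply (drule J_loaded, simp add: loadedD)
      apply (rule run_For_Down[where I = I and m = "n" and N = ?B, OF _ _ body])
          apply (frule J_loaded)
          apply (auto simp: J_def I_def loadedD cell_simps intro!: agree_outside_upd)[1]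
         apply (use loadedD(2)[OF I_loaded] in \<open>fastforce simp: I_def\<close>)
        apply assumption+
      apply (use Q in \<open>auto simp: I_def tau_def\<close>)[1]
     apply (rule order_refl)+
    using N total by linarith
qed

end

section \<open>The candidates as integer vectors over a common denominator\<close>

context simplex_matrix begin

text \<open>Over the denominator \<open>lam n * lam i\<close> this is the fractional part of
  \<open>tau a k / lam n + g * lam k\<close>, where the shift
  \<open>g = (m - tau a i / lam n) / lam i\<close> brings entry \<open>i\<close> to the integer
  \<open>m\<close>.\<close>

definition cand_frac :: "nat \<Rightarrow> nat \<Rightarrow> nat \<Rightarrow> nat \<Rightarrow> int" where
  "cand_frac a i m k =
     (tau a k * lam i + (int m * lam n - tau a i) * lam k) mod (lam n * lam i)"

text \<open>The unit vector at \<open>i\<close> stands in for a zero fractional part. It accounts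
  for integral \<open>t\<close>, for which some single row is at least as good.\<close>

definition cand :: "nat \<Rightarrow> nat \<Rightarrow> nat \<Rightarrow> nat \<Rightarrow> int" where
  "cand a i m k = (if \<forall>j\<le>n. cand_frac a i m j = 0 then (if k = i then lam n * lam i else 0)
     else cand_frac a i m k)"

lemma tau_bounds: "0 \<le> tau a j" "tau a j < lam n"
  using tau_state_bounds(2)[of n a j] by (simp_all add: tau_def)

lemma modulus_bounds:
  assumes "i \<le> n"
  shows "1 \<le> lam n * lam i" "lam n * lam i \<le> int E ^ 2"
proof -
  have "1 * 1 \<le> lam n * lam i" using lam_pos[OF assms] lam_pos[of n] by (intro mult_mono) auto
  then show "1 \<le> lam n * lam i" by simp
  have "lam n * lam i \<le> int E * int E"
    using lam_pos[OF assms] lam_le[OF assms] lam_pos[of n] lam_le[of n] by (intro mult_mono) auto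
  then show "lam n * lam i \<le> int E ^ 2" by (simp add: power2_eq_square)
qed

lemma cand_frac_bounds:
  "i \<le> n \<Longrightarrow> 0 \<le> cand_frac a i m k" "i \<le> n \<Longrightarrow> cand_frac a i m k < lam n * lam i"
  using modulus_bounds(1)[of i] by (auto simp: cand_frac_def)

lemma cand_bounds:
  "i \<le> n \<Longrightarrow> 0 \<le> cand a i m k" "i \<le> n \<Longrightarrow> cand a i m k \<le> lam n * lam i"
  using modulus_bounds(1)[of i] cand_frac_bounds[of i a m k] by (auto simp: cand_def)

end

section \<open>Running the computation of one candidate\<close>

context width_program begin

definition ready :: "(reg \<Rightarrow> int) \<Rightarrow> bool" where
  "ready R \<longleftrightarrow> loaded R \<and> R 5 = lam n \<and> (\<forall>j\<le>n. R (cell 0 j) = lam j)"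

lemma ready_agree:
  "ready R \<Longrightarrow> agree_outside X R R' \<Longrightarrow> X \<inter> ({..<6} \<union> range (cell 4) \<union> range (cell 0)) = {} \<Longrightarrow> ready R'"
proof -
  assume a: "ready R" "agree_outside X R R'" "X \<inter> ({..<6} \<union> range (cell 4) \<union> range (cell 0)) = {}"
  have "R' r = R r" if "r \<in> {..<6} \<union> range (cell 4) \<union> range (cell 0)" for r
    using a(2,3) that by (auto simp: agree_outside_def)
  moreover have "loaded R'"
  proof (rule loaded_agree)
    have "X \<inter> ({..<5} \<union> range (cell 4)) \<subseteq> X \<inter> ({..<6} \<union> range (cell 4) \<union> range (cell 0))"
      by (rule Int_mono[OF order_refl]) auto
    then show "X \<inter> ({..<5} \<union> range (cell 4)) = {}" using a(3) by simp
  qed (use a in \<open>auto simp: ready_def\<close>)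
  ultimately show ?thesis using a(1) by (auto simp: ready_def)
qed

lemma readyD:
  assumes "ready R"
  shows "R 0 = 0" "R 1 = 1" "R (Suc 0) = 1" "R 2 = int n" "R 3 = int n + 1" "R 5 = lam n"
    "j \<le> n \<Longrightarrow> R (cell 0 j) = lam j"
  using assms loadedD[of R] by (auto simp: ready_def)

lemma ready_upd: "r \<ge> 6 \<Longrightarrow> r < 40 \<Longrightarrow> ready (R(r := v)) = ready R"
  by (auto simp: ready_def loaded_upd cell_simps)

lemma run_Update_Max:
  assumes R: "ready R" "R 14 = v" "R 16 = l" "R 24 = p" "R 25 = q"
    and b: "0 \<le> v" "v \<le> int E ^ 2" "0 \<le> p" "p \<le> int E ^ 2" "1 \<le> q" "q \<le> int E" "1 \<le> l" "l \<le> int E"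
    and N: "6 * E + 10 \<le> N"
    and Q: "\<And>R'. agree_outside {7, 8, 17, 18, 24, 25} R R' \<Longrightarrow>
      (R' 24, R' 25) = (if v * q > p * l then (v, l) else (p, q)) \<Longrightarrow> Q R' inp out"
  shows "run V Update_Max N R inp out Q"
proof -
  have vq: "0 \<le> v * q" "v * q \<le> int E ^ 2 * int E" using b by (auto intro!: mult_mono)
  have pl: "0 \<le> p * l" "p * l \<le> int E ^ 2 * int E" using b by (auto intro!: mult_mono)
  have b1: "v * q \<le> V" "p * l \<le> V"
    using vq pl by (auto intro!: V_prod[of 0 3] simp: power2_eq_square power3_eq_cube)
  have b2: "\<bar>v * q - p * l\<bar> \<le> V" using b1 vq pl by linarith
  have ag: "agree_outside {7, 8, 17, 18, 24, 25} R R" by (rule agree_outside_refl)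
  note Rs = readyD[OF R(1)] R(2-)
  show ?thesis
    unfolding Update_Max_def
    apply (rule run_weaken)
     apply (rule run_Seq, rule run_Mul[where N = "3 * E + 3"])
            apply (use b vq b1 in \<open>simp_all add: Rs\<close>)[7]
     apply (simp add: Rs)
     apply (rule run_Seq, rule run_Mul[where N = "3 * E + 3"])
            apply (use b pl b1 in \<open>simp_all add: Rs\<close>)[7]
     apply (simp add: Rs)
     apply (rule run_Seq, rule run_Sub)
      apply (use b2 in \<open>simp add: Rs\<close>)
     apply (simp add: Rs)
     apply (rule run_Cond[where N = 2])
      apply (rule run_weaken)
       apply (rule run_Seq, rule run_Copy)
        apply (simp add: Rs)
       apply (rule run_Copy)
        apply (simp add: Rs)
       apply (rule Q)
        apply (use ag in \<open>simp add: agree_outside_upd\<close>)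
       apply (simp add: Rs)
      apply simp
     apply (rule run_weaken)
      apply (rule run_Assign)
       apply (use V_const in simp)
      apply (rule Q)
       apply (use ag in \<open>simp add: agree_outside_upd\<close>)
      apply (simp add: Rs)
     apply simp
    using N by simp
qed

lemma run_Cand_Step:
  assumes R: "ready R" "R 10 = int k" "k \<le> n" "R (cell 5 k) = t" "R 30 = li" "R 31 = s" "R 28 = M"
      "R 24 = p" "R 25 = q"
    and b: "0 \<le> t" "t * li \<le> M" "0 \<le> li" "li \<le> int E" "\<bar>s\<bar> \<le> M" "1 \<le> M" "M \<le> int E ^ 2"
      "0 \<le> p" "p \<le> int E ^ 2" "1 \<le> q" "q \<le> int E"
    and v: "v = (t * li + s * lam k) mod M"
    and N: "16 * E + 60 \<le> N"
    and Q: "\<And>R'. agree_outside ({6..9} \<union> {14..18} \<union> {24, 25} \<union> {cell 2 k}) R R' \<Longrightarrow>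
      R' (cell 2 k) = v \<Longrightarrow>
      (R' 24, R' 25) = (if v * q > p * lam k then (v, lam k) else (p, q)) \<Longrightarrow> Q R' inp out"
  shows "run V Cand_Step N R inp out Q"
proof -
  let ?T = "{6..9} \<union> {14..18} \<union> {24, 25} \<union> {cell 2 k}"
  have l: "1 \<le> lam k" "lam k \<le> int E" using lam_pos lam_le R(3) by auto
  have tl: "0 \<le> t * li" "t * li \<le> int E ^ 2" using b by auto
  have sl: "\<bar>s * lam k\<bar> \<le> M * lam k"
    unfolding abs_mult using b l by (intro mult_mono) auto
  have Ml: "M * lam k \<le> int E ^ 2 * int E" using b l by (intro mult_mono) auto
  have "int E ^ 2 * 1 \<le> int E ^ 2 * int E" using E_ge by (intro mult_left_mono) auto
  then have sum: "\<bar>t * li + s * lam k\<bar> \<le> 2 * int E ^ 3"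
    using tl sl Ml by (simp add: power2_eq_square power3_eq_cube)
  have V3: "64 * int E ^ 3 \<le> V" using V_ge[of 0 3] by simp
  have b1: "\<bar>t * li\<bar> \<le> V" using tl by (intro V_prod[of 0 2]) auto
  have "M * lam k \<le> V" using Ml by (intro V_prod[of 0 3]) (auto simp: power2_eq_square power3_eq_cube)
  then have b2: "\<bar>s * lam k\<bar> \<le> V" using sl by linarith
  have "2 * int E ^ 3 \<le> 64 * int E ^ 3" by simp
  then have b3: "\<bar>s * lam k + t * li\<bar> \<le> V" using V3 sum by (simp add: add.commute)
  \<comment> \<open>As \<open>t * li\<close> and \<open>s\<close> are at most \<open>M\<close> in
    absolute value, the quotient is at most \<open>lam k + 1\<close>. The division takes a number of
    rounds linear in \<open>E\<close> although the dividend may be cubic.\<close>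
  have "\<bar>(s * lam k + t * li) div M\<bar> \<le> lam k + 1"
  proof (rule abs_zdiv_le)
    show "\<bar>s * lam k + t * li\<bar> \<le> M * (lam k + 1)"
      using tl(1) b(2) sl unfolding distrib_left by linarith
  qed (use b in simp)
  then have quot: "4 * nat \<bar>(s * lam k + t * li) div M\<bar> + 9 \<le> 4 * E + 13" using l by simp
  have v': "v = (s * lam k + t * li) mod M" using v by (simp add: add.commute)
  have "0 \<le> v" "v < M" using b(6) by (simp_all add: v)
  then have vb: "0 \<le> v" "v \<le> int E ^ 2" using b(7) by linarith+
  have ag: "agree_outside ?T R R" by (rule agree_outside_refl)
  note Rs = readyD[OF R(1)] R(2,4-)
  show ?thesis
    unfolding Cand_Step_def
    apply (rule run_weaken)
     apply (rule run_Seq, rule run_Array_Load)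
         apply (use V_index[OF R(3)] in \<open>simp_all add: Rs\<close>)[4]
     apply (simp add: Rs)
     apply (rule run_Seq, rule run_Mul[where N = "3 * E + 3"])
            apply (use b b1 in \<open>simp_all add: Rs\<close>)[7]
     apply (simp add: Rs)
     apply (rule run_Seq, rule run_Array_Load)
         apply (use V_index[OF R(3)] in \<open>simp_all add: Rs\<close>)[4]
     apply (simp add: Rs R(3) cell_simps)
     apply (rule run_Seq, rule run_Mul[where N = "3 * E + 3"])
            apply (use l b2 in \<open>simp_all add: Rs\<close>)[7]
     apply (simp add: Rs)
     apply (rule run_Seq, rule run_Add)
      apply (use b3 in \<open>simp add: Rs\<close>)
     apply (simp add: Rs)
     apply (rule run_Seq, rule run_Div_Mod[where N = "4 * E + 13"])
             apply (use b quot in \<open>simp_all add: Rs\<close>)[7]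
     apply (simp add: Rs v'[symmetric])
     apply (rule run_Seq, rule run_Array_Store)
           apply (use V_index[OF R(3)] in \<open>simp_all add: Rs\<close>)[6]
     apply (simp add: Rs)
     apply (rule run_Update_Max[where v = v and l = "lam k" and p = p and q = q and N = "6 * E + 10"])
                   apply (use R(1) in \<open>simp add: ready_def loaded_upd cell_simps\<close>)
                  apply (use b vb l in \<open>simp_all add: Rs cell_simps\<close>)[13]
     apply (rule Q)
       apply (erule agree_outside_trans[rotated])
        apply (simp (no_asm))
       apply (use ag in \<open>simp add: agree_outside_upd cell_simps\<close>)
      apply (drule agree_outsideD[where r = "cell 2 k"])
       apply (simp add: cell_simps)
      apply (simp add: cell_simps)
     apply assumption
    using N by simp
qed

text \<open>The initial maximum \<open>0 / 1\<close> need not be attained by an entry. It survives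
  exactly if all fractional parts vanish, whence the disjunction in the postcondition.\<close>

lemma run_Cand_Loop:
  assumes R: "ready R" "R 10 = int (n + 1)" "\<And>j. j \<le> n \<Longrightarrow> R (cell 5 j) = tau a j"
      "R 30 = lam i" "R 31 = int m * lam n - tau a i" "R 28 = lam n * lam i" "R 24 = 0" "R 25 = 1"
    and i: "i \<le> n" and m: "int m < lam i"
    and N: "(n + 1) * (16 * E + 62) + 1 \<le> N"
    and Q: "\<And>R'. agree_outside ({6..10} \<union> {14..18} \<union> {24, 25} \<union> range (cell 2)) R R' \<Longrightarrow>
      (\<And>k. k \<le> n \<Longrightarrow> R' (cell 2 k) = cand_frac a i m k) \<Longrightarrow>
      0 \<le> R' 24 \<Longrightarrow> 1 \<le> R' 25 \<Longrightarrow>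
      (\<And>k. k \<le> n \<Longrightarrow> cand_frac a i m k * R' 25 \<le> R' 24 * lam k) \<Longrightarrow>
      (R' 24 = 0 \<or> (\<exists>k\<le>n. R' 24 = cand_frac a i m k \<and> R' 25 = lam k)) \<Longrightarrow> Q R' inp out"
  shows "run V (For_Down 10 Cand_Step) N R inp out Q"
proof -
  let ?T = "{6..10} \<union> {14..18} \<union> {24, 25} \<union> range (cell 2)"
  let ?f = "cand_frac a i m"
  define I where "I j R' i' o' \<longleftrightarrow> j \<le> n + 1 \<and> agree_outside ?T R R' \<and> R' 10 = int j \<and>
    (\<forall>k\<in>{j..n}. R' (cell 2 k) = ?f k) \<and> 0 \<le> R' 24 \<and> R' 24 \<le> int E ^ 2 \<and> 1 \<le> R' 25 \<and> R' 25 \<le> int E \<and>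
    (\<forall>k\<in>{j..n}. ?f k * R' 25 \<le> R' 24 * lam k) \<and>
    (R' 24 = 0 \<or> (\<exists>k\<in>{j..n}. R' 24 = ?f k \<and> R' 25 = lam k)) \<and> i' = inp \<and> o' = out"
    for j R' and i' o' :: "int list"
  have I_ready: "ready R'" if "I j R' i' o'" for j R' i' o'
    by (rule ready_agree[OF R(1), of ?T]) (use that in \<open>auto simp: I_def cell_simps\<close>)
  have li: "1 \<le> lam i" "lam i \<le> int E" using lam_pos lam_le i by auto
  note M = modulus_bounds[OF i]
  have s: "\<bar>int m * lam n - tau a i\<bar> \<le> lam n * lam i"
  proof -
    have "(int m + 1) * lam n \<le> lam i * lam n" using m lam_pos[of n] by (intro mult_right_mono) auto
    moreover have "0 \<le> int m * lam n" using lam_pos[of n] by simp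
    moreover have "lam n * 1 \<le> lam n * lam i" using li lam_pos[of n] by (intro mult_left_mono) auto
    ultimately show ?thesis
      using tau_bounds[of a i] unfolding distrib_right by (simp only: mult.commute)
  qed
  have body: "run V Cand_Step (16 * E + 60) (R'(10 := int k)) i' o' (I k)"
    if k: "k < n + 1" and I: "I (Suc k) R' i' o'" for k R' i' o'
  proof -
    have ag: "agree_outside ?T R R'" and cells: "\<And>j. j \<in> {Suc k..n} \<Longrightarrow> R' (cell 2 j) = ?f j"
      and pq: "0 \<le> R' 24" "R' 24 \<le> int E ^ 2" "1 \<le> R' 25" "R' 25 \<le> int E"
      and le: "\<And>j. j \<in> {Suc k..n} \<Longrightarrow> ?f j * R' 25 \<le> R' 24 * lam j"
      and ex: "R' 24 = 0 \<or> (\<exists>j\<in>{Suc k..n}. R' 24 = ?f j \<and> R' 25 = lam j)"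
      and io: "i' = inp" "o' = out"
      using I by (simp_all add: I_def)
    note R' = agree_outsideD[OF ag]
    have kn: "k \<le> n" using k by simp
    have tli: "tau a k * lam i \<le> lam n * lam i"
      using tau_bounds[of a k] li by (intro mult_right_mono) auto
    have f: "0 \<le> ?f k" "?f k \<le> int E ^ 2" using cand_frac_bounds[OF i, of a m k] M by linarith+
    have lk: "1 \<le> lam k" "lam k \<le> int E" using lam_pos lam_le kn by auto
    have split: "j = k \<or> j \<in> {Suc k..n}" if "j \<in> {k..n}" for j using that by auto
    have next_I: "I k R2 i' o'"
      if a2: "agree_outside ({6..9} \<union> {14..18} \<union> {24, 25} \<union> {cell 2 k}) (R'(10 := int k)) R2"
        and r2: "R2 (cell 2 k) = ?f k"
          "(R2 24, R2 25) = (if ?f k * R' 25 > R' 24 * lam k then (?f k, lam k) else (R' 24, R' 25))" for R2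
    proof -
      have ag2: "agree_outside ?T R R2"
        by (rule agree_outside_trans[OF agree_outside_upd[OF ag] a2]) auto
      have c: "\<forall>j\<in>{k..n}. R2 (cell 2 j) = ?f j"
      proof
        fix j assume "j \<in> {k..n}"
        from split[OF this] show "R2 (cell 2 j) = ?f j"
          using r2(1) cells[of j] agree_outsideD[OF a2, of "cell 2 j"] by (cases "j = k") (auto simp: cell_simps)
      qed
      have R210: "R2 10 = int k" using agree_outsideD[OF a2, of 10] by (simp add: cell_simps)
      show ?thesis
      proof (cases "?f k * R' 25 > R' 24 * lam k")
        case True
        \<comment> \<open>The order of fractions is transitive: the comparison passes through the
          old maximum, whose positive denominator is cancelled at the end.\<close>
        have "\<forall>j\<in>{k..n}. ?f j * lam k \<le> ?f k * lam j"
        proof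
          fix j assume j: "j \<in> {k..n}"
          from split[OF this] show "?f j * lam k \<le> ?f k * lam j"
          proof
            assume "j \<in> {Suc k..n}"
            then have "(?f j * R' 25) * lam k \<le> (R' 24 * lam j) * lam k"
              using lk le by (intro mult_right_mono) auto
            also have "\<dots> = (R' 24 * lam k) * lam j" by simp
            also have "\<dots> \<le> (?f k * R' 25) * lam j" using True lam_pos[of j] j by (intro mult_right_mono) auto
            finally have "(?f j * lam k) * R' 25 \<le> (?f k * lam j) * R' 25" by (simp add: mult_ac)
            then show ?thesis using pq by (simp add: mult_le_cancel_right)
          qed simp
        qed
        moreover have "\<exists>j\<in>{k..n}. R2 24 = ?f j \<and> R2 25 = lam j"
          using kn r2(2) True by (intro bexI[of _ k]) auto
        ultimately show ?thesis
          unfolding I_def using True r2(2) c ag2 f lk R210 kn io by simp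
      next
        case False
        have "\<forall>j\<in>{k..n}. ?f j * R' 25 \<le> R' 24 * lam j"
        proof
          fix j assume "j \<in> {k..n}"
          from split[OF this] show "?f j * R' 25 \<le> R' 24 * lam j"
            using le[of j] False by (elim disjE) simp_all
        qed
        moreover have "R' 24 = 0 \<or> (\<exists>j\<in>{k..n}. R' 24 = ?f j \<and> R' 25 = lam j)"
          using ex
        proof
          assume "\<exists>j\<in>{Suc k..n}. R' 24 = ?f j \<and> R' 25 = lam j"
          then obtain j where "j \<in> {Suc k..n}" "R' 24 = ?f j \<and> R' 25 = lam j" ..
          then show ?thesis by (intro disjI2 bexI[of _ j]) simp_all
        qed simp
        ultimately show ?thesis
          unfolding I_def using False r2(2) c ag2 R210 kn io pq by simp
      qed
    qed
    show ?thesis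
    proof (rule run_Cand_Step[where k = k and t = "tau a k" and li = "lam i" and
          s = "int m * lam n - tau a i" and M = "lam n * lam i" and p = "R' 24" and q = "R' 25" and v = "?f k"])
      show "ready (R'(10 := int k))" using I_ready[OF I] by (simp add: ready_upd)
      show "?f k = (tau a k * lam i + (int m * lam n - tau a i) * lam k) mod (lam n * lam i)"
        by (simp add: cand_frac_def)
    qed (use kn R R' next_I li M s tli pq tau_bounds[of a k] in \<open>simp_all add: cell_simps\<close>)
  qed
  have cnt: "R' 10 = int k \<and> R' 1 = 1" if "I k R' i' o'" for k R' i' o'
    using that readyD(2)[OF I_ready[OF that]] by (simp add: I_def)
  have post: "Q R' i' o'" if "I 0 R' i' o'" for R' i' o'
  proof -
    have io: "i' = inp" "o' = out" using that by (simp_all add: I_def)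
    have "R' 24 = 0 \<or> (\<exists>k\<le>n. R' 24 = ?f k \<and> R' 25 = lam k)"
      using that by (simp add: I_def Bex_def)
    then show ?thesis
      unfolding io using that by (intro Q) (simp_all add: I_def)
  qed
  have init: "I (n + 1) R inp out"
    using R E_ge by (simp add: I_def agree_outside_refl)
  show ?thesis
    by (rule run_For_Down[where I = I, OF init cnt body post]) (use N in \<open>simp_all add: algebra_simps\<close>)
qed

end

section \<open>The candidates reach all cosets and give integral directions\<close>

context simplex_matrix begin

declare tau_state.simps(2) [simp del]

lemma tau_state_Suc:
  assumes "tau_state a s = (c, X)" "k = n - Suc s"
  shows "tau_state a (Suc s) = (c div h k k,
    X(k := ((lam n * (c mod h k k) - (\<Sum>j\<le>n. h j k * X j)) mod (lam n * h k k)) div h k k))"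
  using assms by (simp add: tau_state.simps(2) Let_def)

lemma sum_fun_upd_column:
  assumes "X k = (0 :: int)" "k \<le> n"
  shows "(\<Sum>j\<le>n. h j c * (X(k := v)) j) = (\<Sum>j\<le>n. h j c * X j) + h k c * v"
proof -
  have "(\<Sum>j\<le>n. h j c * (X(k := v)) j) = (\<Sum>j\<le>n. h j c * X j + (if j = k then h k c * v else 0))"
    by (rule sum.cong) (use assms(1) in auto)
  then show ?thesis using assms(2) by (simp add: sum.distrib)
qed

text \<open>Only the diagonal entries up to position \<open>j\<close> enter the denominator of the \<open>j\<close>-th entry,
  which is why the divisions of the back substitution stay exact after a reduction modulo \<open>lam n\<close>.\<close>

lemma tau_state_dvd:
  "s \<le> n \<Longrightarrow> (\<Prod>l<n - s. h l l) dvd snd (tau_state a s) j"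
  "Suc s \<le> n \<Longrightarrow> h (n - Suc s) (n - Suc s) dvd
     (lam n * d - (\<Sum>j\<le>n. h j (n - Suc s) * snd (tau_state a s) j)) mod (lam n * h (n - Suc s) (n - Suc s))"
proof -
  have exact: "(\<Prod>l<k. h l l) * h k k dvd (lam n * d - (\<Sum>j\<le>n. h j k * X j)) mod (lam n * h k k)"
    if k: "k < n" and X: "\<And>j. (\<Prod>l<Suc k. h l l) dvd X j" for k d and X :: "nat \<Rightarrow> int"
  proof -
    have "(\<Prod>l<Suc k. h l l) dvd lam n"
      unfolding lam_last by (rule prod_dvd_prod_subset) (use k in auto)
    then have l: "(\<Prod>l<k. h l l) * h k k dvd lam n" by simp
    moreover have "(\<Prod>l<k. h l l) * h k k dvd (\<Sum>j\<le>n. h j k * X j)"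
      by (rule dvd_sum) (use X in simp)
    ultimately show ?thesis by (intro dvd_mod dvd_diff dvd_mult2) auto
  qed
  show dvd: "(\<Prod>l<n - s. h l l) dvd snd (tau_state a s) j" if "s \<le> n" for s j
    using that
  proof (induction s arbitrary: j)
    case 0
    then show ?case by simp
  next
    case (Suc s)
    define k where "k = n - Suc s"
    have k: "k < n" "n - s = Suc k" using Suc.prems by (auto simp: k_def)
    obtain c X where cX: "tau_state a s = (c, X)" by fastforce
    have X: "\<And>j. (\<Prod>l<Suc k. h l l) dvd X j" using Suc.IH Suc.prems cX k by simp
    define r where "r = (lam n * (c mod h k k) - (\<Sum>j\<le>n. h j k * X j)) mod (lam n * h k k)"
    define Z where "Z = (\<Prod>l<k. h l l)"
    have "Z * h k k dvd r" unfolding r_def Z_def by (rule exact[OF k(1) X])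
    then obtain g where "r = Z * h k k * g" by (rule dvdE)
    then have "r = h k k * (Z * g)" by simp
    moreover have "h k k \<noteq> 0" using diag_pos[OF k(1)] by simp
    ultimately have 1: "Z dvd r div h k k" by simp
    have "Z * h k k dvd X j" using X[of j] by (simp add: Z_def)
    then have 2: "Z dvd X j" by (rule dvd_mult_left)
    have e: "snd (tau_state a (Suc s)) = X(k := r div h k k)"
      unfolding tau_state_Suc[OF cX k_def] r_def by (rule snd_conv)
    have "Z dvd (X(k := r div h k k)) j" using 1 2 by simp
    then show ?case unfolding e Z_def k_def .
  qed
  show "h (n - Suc s) (n - Suc s) dvd
     (lam n * d - (\<Sum>j\<le>n. h j (n - Suc s) * snd (tau_state a s) j)) mod (lam n * h (n - Suc s) (n - Suc s))"
    if "Suc s \<le> n"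
  proof -
    define k where "k = n - Suc s"
    have k: "k < n" "n - s = Suc k" using that by (auto simp: k_def)
    have X: "(\<Prod>l<Suc k. h l l) dvd snd (tau_state a s) j" for j
      using dvd[of s j] that unfolding k(2) by simp
    show ?thesis
      unfolding k_def[symmetric]
      by (rule dvd_trans[OF _ exact[where X = "snd (tau_state a s)", OF k(1) X]]) simp
  qed
qed

text \<open>Exactness of the division makes column \<open>i\<close> a multiple of
  \<open>lam n\<close> at the moment when entry \<open>i\<close> is set. Entries set later have an
  index \<open>i < k\<close> and do not touch column \<open>k\<close>, because
  \<open>h i k = 0\<close>.\<close>

lemma tau_state_kernel:
  "s \<le> n \<Longrightarrow> n - s \<le> k \<Longrightarrow> k < n \<Longrightarrow> lam n dvd (\<Sum>j\<le>n. h j k * snd (tau_state a s) j)"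
proof (induction s)
  case (Suc s)
  define i where "i = n - Suc s"
  have i: "i < n" "n - s = Suc i" using Suc.prems by (auto simp: i_def)
  obtain c X where cX: "tau_state a s = (c, X)" by fastforce
  have Xi: "X i = 0" using tau_state_bounds(3)[of s i a] Suc.prems i cX by simp
  let ?u = "\<Sum>j\<le>n. h j i * X j"
  let ?x = "lam n * (c mod h i i) - ?u"
  let ?y = "lam n * h i i"
  have sum: "(\<Sum>j\<le>n. h j k * snd (tau_state a (Suc s)) j) = (\<Sum>j\<le>n. h j k * X j) + h i k * (?x mod ?y div h i i)"
    unfolding tau_state_Suc[OF cX i_def] snd_conv by (rule sum_fun_upd_column) (use Xi i in auto)
  show ?case
  proof (cases "k = i")
    case True
    have "h i i dvd ?x mod ?y" using tau_state_dvd(2)[of s "c mod h i i" a] Suc.prems cX by (simp add: i_def)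
    then have "?u + h i i * (?x mod ?y div h i i) = ?u + ?x mod ?y" by simp
    also have "\<dots> = ?u + (?x - ?y * (?x div ?y))" by (simp only: minus_mult_div_eq_mod)
    also have "\<dots> = lam n * ((c mod h i i) - h i i * (?x div ?y))" by (simp add: algebra_simps)
    finally show ?thesis unfolding sum unfolding True by simp
  next
    case False
    then have "n - s \<le> k" "i < k" using Suc.prems i by (auto simp: i_def)
    then show ?thesis unfolding sum using Suc.IH Suc.prems cX upper_zero[of i k] i by simp
  qed
qed simp

lemma tau_kernel: "k < n \<Longrightarrow> lam n dvd (\<Sum>j\<le>n. h j k * tau a j)"
  using tau_state_kernel[of n k a] by (simp add: tau_def)

text \<open>\<open>X\<close> is what back substitution computes for the coset of \<open>c\<close>,
  and \<open>w\<close> collects the integral multiples of rows removed on the way. The remainder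
  \<open>r\<close> is arbitrary because the induction hides the next digit \<open>d\<close> in it:
  the previous step is used with remainder \<open>r * h i i + d\<close>.\<close>

lemma tau_state_surj:
  assumes "s \<le> n"
  shows "\<exists>X w. (\<forall>j<n - s. w j = 0) \<and>
     (\<forall>k<n. n - s \<le> k \<longrightarrow> lam n * c k = (\<Sum>j\<le>n. h j k * X j) + lam n * (\<Sum>j<n. h j k * w j)) \<and>
     (\<forall>r. \<exists>a. int a < (\<Prod>l\<in>{n - s..<n}. h l l) * (int r + 1) \<and> tau_state a s = (int r, X))"
  using assms
proof (induction s)
  case 0
  show ?case by (intro exI[of _ "\<lambda>_. 0"]) auto
next
  case (Suc s)
  define i where "i = n - Suc s"
  have i: "i < n" "n - s = Suc i" using Suc.prems by (auto simp: i_def)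
  obtain X w where w: "\<And>j. j < n - s \<Longrightarrow> w j = 0"
    and eq: "\<And>k. k < n \<Longrightarrow> n - s \<le> k \<Longrightarrow> lam n * c k = (\<Sum>j\<le>n. h j k * X j) + lam n * (\<Sum>j<n. h j k * w j)"
    and a: "\<And>r. \<exists>a. int a < (\<Prod>l\<in>{n - s..<n}. h l l) * (int r + 1) \<and> tau_state a s = (int r, X)"
    using Suc by auto
  have hi: "1 \<le> h i i" using diag_pos i by simp
  \<comment> \<open>What is left of entry \<open>i\<close> of \<open>c\<close> after removing the
    multiples \<open>w\<close> of later rows. Its residue \<open>d\<close> is the next digit;
    \<open>e\<close> and \<open>f\<close> are the multiples of row \<open>i\<close> lost by passing
    to the digit and by reducing modulo \<open>lam n * h i i\<close>.\<close>
  define y where "y = c i - (\<Sum>j<n. h j i * w j)"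
  define d e where "d = y mod h i i" and "e = y div h i i"
  define u where "u = (\<Sum>j\<le>n. h j i * X j)"
  define x where "x = lam n * d - u"
  define f where "f = x div (lam n * h i i)"
  define v where "v = x mod (lam n * h i i) div h i i"
  have d: "0 \<le> d" "d < h i i" using hi by (auto simp: d_def)
  obtain a0 where a0: "tau_state a0 s = (int 0, X)" using a[of 0] by blast
  have Xi: "X i = 0" using tau_state_bounds(3)[of s i a0] Suc.prems i a0 by simp
  have "h i i dvd x mod (lam n * h i i)"
    using tau_state_dvd(2)[of s d a0] Suc.prems a0 by (simp add: i_def x_def u_def)
  then have hv: "h i i * v = x mod (lam n * h i i)" by (simp add: v_def)
  show ?case
  proof (rule exI[of _ "X(i := v)"], rule exI[of _ "w(i := e + f)"], intro conjI allI impI)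
    show "(w(i := e + f)) j = 0" if "j < n - Suc s" for j using w that i by (auto simp: i_def)
    have sumw: "(\<Sum>j<n. h j k * (w(i := e + f)) j) = (\<Sum>j<n. h j k * w j) + h i k * (e + f)" for k
    proof -
      have "(\<Sum>j<n. h j k * (w(i := e + f)) j) = (\<Sum>j<n. h j k * w j + (if j = i then h i k * (e + f) else 0))"
        by (rule sum.cong) (use w[of i] i in auto)
      then show ?thesis using i by (simp add: sum.distrib)
    qed
    have sumX: "(\<Sum>j\<le>n. h j k * (X(i := v)) j) = (\<Sum>j\<le>n. h j k * X j) + h i k * v" for k
      by (rule sum_fun_upd_column) (use Xi i in auto)
    show "lam n * c k = (\<Sum>j\<le>n. h j k * (X(i := v)) j) + lam n * (\<Sum>j<n. h j k * (w(i := e + f)) j)"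
      if k: "k < n" "n - Suc s \<le> k" for k
    proof (cases "k = i")
      case True
      have ye: "y = h i i * e + d" by (simp add: d_def e_def)
      have xf: "x = (lam n * h i i) * f + h i i * v" unfolding hv f_def by simp
      have sw: "(\<Sum>j<n. h j i * w j) = c i - y" by (simp add: y_def)
      have "u + h i i * v + lam n * ((c i - y) + h i i * (e + f)) = u + x - lam n * d + lam n * c i"
        by (simp add: ye xf algebra_simps)
      also have "\<dots> = lam n * c i" by (simp add: x_def)
      finally show ?thesis unfolding True sumX sumw sw u_def[symmetric] ..
    next
      case False
      then have "n - s \<le> k" "i < k" using k i by (auto simp: i_def)
      then show ?thesis unfolding sumX sumw using eq k upper_zero[of i k] i by simp
    qed
    fix r
    obtain a1 where a1: "int a1 < (\<Prod>l\<in>{n - s..<n}. h l l) * (int (r * nat (h i i) + nat d) + 1)"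
        "tau_state a1 s = (int (r * nat (h i i) + nat d), X)"
      using a by blast
    \<comment> \<open>The bound on the number survives the change of remainder because a digit
      satisfies \<open>d + 1 \<le> h i i\<close>.\<close>
    have carry: "int (r * nat (h i i) + nat d) = int r * h i i + d" using hi d by simp
    have "(\<Prod>l\<in>{n - s..<n}. h l l) * (int r * h i i + d + 1) \<le> (\<Prod>l\<in>{n - s..<n}. h l l) * (h i i * (int r + 1))"
      using d partial_det_bounds(1)[of "n - s"] by (intro mult_left_mono) (auto simp: algebra_simps)
    also have "\<dots> = (\<Prod>l\<in>{n - Suc s..<n}. h l l) * (int r + 1)"
      using i by (simp add: i_def[symmetric] prod.atLeast_Suc_lessThan[of i n] mult_ac)
    finally have "int a1 < (\<Prod>l\<in>{n - Suc s..<n}. h l l) * (int r + 1)"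
      using a1(1) unfolding carry by linarith
    moreover have "tau_state a1 (Suc s) = (int r, X(i := v))"
      unfolding tau_state_Suc[OF a1(2) i_def] carry
      using d by (simp add: v_def x_def u_def)
    ultimately show "\<exists>a. int a < (\<Prod>l\<in>{n - Suc s..<n}. h l l) * (int r + 1) \<and> tau_state a (Suc s) = (int r, X(i := v))"
      by blast
  qed
qed

text \<open>With remainder 0 all digits are used up, and the bound on \<open>a\<close> becomes the
  product of the diagonal. So the numbers below \<open>lam n\<close> reach every coset of the
  lattice spanned by the first \<open>n\<close> rows.\<close>

lemma tau_surj:
  "\<exists>a w. int a < lam n \<and> (\<forall>k<n. lam n * c k = (\<Sum>j\<le>n. h j k * tau a j) + lam n * (\<Sum>j<n. h j k * w j))"
proof -
  obtain X w where w: "\<forall>k<n. lam n * c k = (\<Sum>j\<le>n. h j k * X j) + lam n * (\<Sum>j<n. h j k * w j)"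
    and a: "\<forall>r. \<exists>a. int a < (\<Prod>l\<in>{0..<n}. h l l) * (int r + 1) \<and> tau_state a n = (int r, X)"
    using tau_state_surj[of n c] by auto
  from a obtain a where "int a < lam n" "tau_state a n = (int 0, X)"
    using a[rule_format, of 0] by (auto simp: lam_last atLeast0LessThan)
  then have "int a < lam n \<and>
      (\<forall>k<n. lam n * c k = (\<Sum>j\<le>n. h j k * tau a j) + lam n * (\<Sum>j<n. h j k * w j))"
    using w by (simp add: tau_def)
  then show ?thesis by blast
qed

text \<open>A certificate for the direction with coefficients \<open>N j / M\<close>: it is integral
  and its width is at most \<open>\<beta> P / Q\<close>. As every relation between the rows is a
  multiple of the positive \<open>lam\<close>, a zero and a nonzero entry of \<open>N\<close>
  together exclude the zero direction.\<close>

definition good :: "int \<Rightarrow> int \<Rightarrow> int \<Rightarrow> (nat \<Rightarrow> int) \<Rightarrow> bool" where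
  "good P Q M N \<longleftrightarrow> 1 \<le> Q \<and> 1 \<le> M \<and> M \<le> int E ^ 2 \<and>
     (\<forall>j\<le>n. 0 \<le> N j \<and> N j \<le> M \<and> N j * Q \<le> P * M * lam j) \<and>
     (\<forall>k<n. M dvd (\<Sum>j\<le>n. h j k * N j)) \<and> (\<exists>j\<le>n. N j = 0) \<and> (\<exists>j\<le>n. N j \<noteq> 0)"

text \<open>Reduction modulo the denominator changes the coefficients by integers, the shift by a
  multiple of \<open>lam\<close> drops out by the kernel equations, and \<open>tau\<close>
  contributes a multiple of \<open>lam n\<close>, completed by the factor
  \<open>lam i\<close>.\<close>

lemma cand_dvd:
  assumes "i \<le> n" "k < n"
  shows "lam n * lam i dvd (\<Sum>j\<le>n. h j k * cand a i m j)"
proof (cases "\<forall>j\<le>n. cand_frac a i m j = 0")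
  case True
  have "(\<Sum>j\<le>n. h j k * cand a i m j) = (\<Sum>j\<le>n. if j = i then h i k * (lam n * lam i) else 0)"
    by (rule sum.cong) (use True in \<open>auto simp: cand_def\<close>)
  then show ?thesis using assms by simp
next
  case False
  let ?M = "lam n * lam i"
  define s where "s = int m * lam n - tau a i"
  let ?x = "\<lambda>j. tau a j * lam i + s * lam j"
  have "(\<Sum>j\<le>n. h j k * cand a i m j) = (\<Sum>j\<le>n. h j k * ?x j - ?M * (h j k * (?x j div ?M)))"
  proof (rule sum.cong)
    fix j
    have "cand a i m j = cand_frac a i m j" unfolding cand_def using False by (rule if_not_P)
    then have "cand a i m j = ?x j mod ?M" by (simp add: cand_frac_def s_def)
    also have "\<dots> = ?x j - ?M * (?x j div ?M)" by (simp only: minus_mult_div_eq_mod)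
    finally have e: "cand a i m j = ?x j - ?M * (?x j div ?M)" .
    show "h j k * cand a i m j = h j k * ?x j - ?M * (h j k * (?x j div ?M))"
      unfolding e by (simp only: right_diff_distrib mult_ac)
  qed simp
  also have "\<dots> = (\<Sum>j\<le>n. h j k * ?x j) - ?M * (\<Sum>j\<le>n. h j k * (?x j div ?M))"
    by (simp add: sum_subtractf sum_distrib_left)
  also have "(\<Sum>j\<le>n. h j k * ?x j) = (\<Sum>j\<le>n. h j k * tau a j) * lam i + s * (\<Sum>j\<le>n. h j k * lam j)"
    by (simp add: sum_distrib_left sum_distrib_right sum.distrib algebra_simps)
  finally have "(\<Sum>j\<le>n. h j k * cand a i m j) =
      (\<Sum>j\<le>n. h j k * tau a j) * lam i - ?M * (\<Sum>j\<le>n. h j k * (?x j div ?M))"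
    using lam_kernel[OF assms(2)] by simp
  then show ?thesis using tau_kernel[OF assms(2), of a] by (simp add: mult_dvd_mono)
qed

lemma cand_frac_self: "cand_frac a i m i = 0"
  by (simp add: cand_frac_def algebra_simps)

lemma cand_zero: "i \<le> n \<Longrightarrow> \<exists>j\<le>n. cand a i m j = 0"
proof (cases "\<forall>j\<le>n. cand_frac a i m j = 0")
  case True
  assume "i \<le> n"
  have "\<exists>j\<le>n. j \<noteq> i" using n_pos by (intro exI[of _ "if i = 0 then 1 else 0"]) auto
  then show ?thesis using True by (auto simp: cand_def)
next
  case False
  assume "i \<le> n"
  then show ?thesis using False cand_frac_self[of a i m] by (auto simp: cand_def)
qed

lemma cand_nonzero: "i \<le> n \<Longrightarrow> \<exists>j\<le>n. cand a i m j \<noteq> 0"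
proof (cases "\<forall>j\<le>n. cand_frac a i m j = 0")
  case True
  assume "i \<le> n"
  then show ?thesis using True lam_pos[of i] lam_pos[of n] by (intro exI[of _ i]) (simp add: cand_def)
next
  case False
  then show ?thesis by (auto simp: cand_def)
qed

lemma good_cand:
  assumes "i \<le> n" "q = lam l" "l \<le> n" "\<And>k. k \<le> n \<Longrightarrow> cand a i m k * q \<le> p * lam k"
  shows "good p (lam n * lam i * q) (lam n * lam i) (cand a i m)"
proof -
  have M: "1 \<le> lam n * lam i" "lam n * lam i \<le> int E ^ 2" using modulus_bounds assms(1) by auto
  have "1 * 1 \<le> lam n * lam i * q" unfolding assms(2) using M lam_pos[OF assms(3)] by (intro mult_mono) auto
  moreover have "cand a i m j * (lam n * lam i * q) \<le> p * (lam n * lam i) * lam j" if "j \<le> n" for j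
    using mult_left_mono[OF assms(4)[OF that], of "lam n * lam i"] M by (simp add: mult_ac)
  ultimately show ?thesis
    unfolding good_def using M cand_bounds[OF assms(1)] cand_dvd[OF assms(1)] cand_zero[OF assms(1)] cand_nonzero[OF assms(1)]
    by auto
qed

text \<open>For every triple in \<open>S\<close>, \<open>P / Q\<close> is at most the largest
  \<open>cand a i m k / (lam n * lam i * lam k)\<close>, with all denominators cleared.
  \<open>Q = 0\<close> encodes the infinite value before the first candidate, when there is no
  certificate yet.\<close>

definition best_among :: "(nat \<times> nat \<times> nat) set \<Rightarrow> int \<Rightarrow> int \<Rightarrow> int \<Rightarrow> (nat \<Rightarrow> int) \<Rightarrow> bool" where
  "best_among S P Q M N \<longleftrightarrow> 1 \<le> P \<and> P \<le> int E ^ 2 \<and> 0 \<le> Q \<and> Q \<le> int E ^ 3 \<and> (Q = 0 \<or> good P Q M N) \<and>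
     (\<forall>a i m. (a, i, m) \<in> S \<longrightarrow> i \<le> n \<longrightarrow> (\<exists>k\<le>n. P * (lam n * lam i * lam k) \<le> cand a i m k * Q))"

lemma best_among_insert:
  assumes best: "best_among S P Q M N"
    and i: "i \<le> n" and l: "l \<le> n" "q = lam l" "p = cand a i m l"
    and max: "\<And>k. k \<le> n \<Longrightarrow> cand a i m k * q \<le> p * lam k"
  shows "P * (lam n * lam i * q) > Q * p \<Longrightarrow>
      best_among (insert (a, i, m) S) p (lam n * lam i * q) (lam n * lam i) (cand a i m)"
    and "P * (lam n * lam i * q) \<le> Q * p \<Longrightarrow> best_among (insert (a, i, m) S) P Q M N"
proof -
  have M: "1 \<le> lam n * lam i" "lam n * lam i \<le> int E ^ 2" using modulus_bounds i by auto
  have q: "1 \<le> q" "q \<le> int E" using lam_pos[OF l(1)] lam_le[OF l(1)] l(2) by auto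
  obtain k where k: "k \<le> n" "cand a i m k \<noteq> 0" using cand_nonzero[OF i] by blast
  have "1 \<le> cand a i m k" using k cand_bounds(1)[OF i, of a m k] by simp
  then have "1 * 1 \<le> cand a i m k * q" using q by (intro mult_mono) auto
  then have "1 \<le> p * lam k" using max[OF k(1)] by simp
  then have p: "1 \<le> p" using lam_pos[OF k(1)] by (metis int_one_le_iff_zero_less less_le_trans
      linorder_not_less mult_nonpos_nonneg order_le_less zero_less_one)
  have pE: "p \<le> int E ^ 2" using cand_bounds(2)[OF i, of a m l] M l by simp
  show "best_among (insert (a, i, m) S) p (lam n * lam i * q) (lam n * lam i) (cand a i m)"
    if less: "P * (lam n * lam i * q) > Q * p"
  proof -
    have "lam n * lam i * q \<le> int E ^ 2 * int E" using M q by (intro mult_mono) auto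
    then have Q': "lam n * lam i * q \<le> int E ^ 3" by (simp add: power2_eq_square power3_eq_cube)
    have low: "\<exists>k\<le>n. p * (lam n * lam i' * lam k) \<le> cand a' i' m' k * (lam n * lam i * q)"
      if S: "(a', i', m') \<in> S" and i': "i' \<le> n" for a' i' m'
    proof -
      obtain k where k: "k \<le> n" "P * (lam n * lam i' * lam k) \<le> cand a' i' m' k * Q"
        using best S i' unfolding best_among_def by blast
      have PQ: "1 \<le> P" "0 \<le> Q" using best by (auto simp: best_among_def)
      show ?thesis
      proof -
        let ?X = "lam n * lam i' * lam k" and ?Y = "cand a' i' m' k"
        have "1 \<le> lam n * lam i'" "1 \<le> lam k" using modulus_bounds(1) lam_pos i' k(1) by auto
        then have X: "0 < ?X" by simp
        have "0 < P * ?X" by (rule mult_pos_pos) (use PQ X in simp_all)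
        \<comment> \<open>Once a triple is covered, \<open>Q = 0\<close> is impossible, as a
          positive number would have to be at most 0. Hence \<open>Q\<close> may be cancelled
          below.\<close>
        then have "Q \<noteq> 0" using k(2) by auto
        then have Q: "0 < Q" using PQ by simp
        have "p * ?X * Q \<le> P * (lam n * lam i * q) * ?X"
          using mult_right_mono[OF less_imp_le[OF less], of ?X] X by (simp add: mult_ac)
        also have "\<dots> \<le> ?Y * Q * (lam n * lam i * q)"
          using mult_right_mono[OF k(2), of "lam n * lam i * q"] M q by (simp add: mult_ac)
        finally have "(p * ?X) * Q \<le> (?Y * (lam n * lam i * q)) * Q" by (simp add: mult_ac)
        then show ?thesis using Q k(1) by (auto simp: mult_le_cancel_right)
      qed
    qed
    have self: "p * (lam n * lam i * lam l) \<le> cand a i m l * (lam n * lam i * q)" using l by simp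
    have g: "good p (lam n * lam i * q) (lam n * lam i) (cand a i m)"
      by (rule good_cand[OF i l(2,1) max])
    show ?thesis
      unfolding best_among_def using p pE Q' low self l(1) g by (auto simp: good_def)
  qed
  show "best_among (insert (a, i, m) S) P Q M N" if le: "P * (lam n * lam i * q) \<le> Q * p"
    using best le l unfolding best_among_def by (auto simp: mult.commute)
qed

end

section \<open>Running the search over all triples\<close>

context width_program begin

lemma run_Cand:
  assumes R: "ready R" "\<And>j. j \<le> n \<Longrightarrow> R (cell 5 j) = tau a j" "R 21 = int i" "R 22 = int m"
    and i: "i \<le> n" and m: "int m < lam i"
    and N: "200 * ((n + 1) * E) \<le> N"
    and Q: "\<And>R'. agree_outside ({6..10} \<union> {14..18} \<union> {24, 25, 28, 30, 31} \<union> range (cell 2)) R R' \<Longrightarrow>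
      (\<And>k. k \<le> n \<Longrightarrow> R' (cell 2 k) = cand a i m k) \<Longrightarrow> R' 28 = lam n * lam i \<Longrightarrow>
      (\<exists>k\<le>n. R' 24 = cand a i m k \<and> R' 25 = lam k) \<Longrightarrow>
      (\<And>k. k \<le> n \<Longrightarrow> cand a i m k * R' 25 \<le> R' 24 * lam k) \<Longrightarrow> Q R' inp out"
  shows "run V Cand N R inp out Q"
proof -
  let ?T = "{6..10} \<union> {14..18} \<union> {24, 25, 28, 30, 31} \<union> range (cell 2)"
  let ?f = "cand_frac a i m"
  let ?M = "lam n * lam i"
  have li: "1 \<le> lam i" "lam i \<le> int E" using lam_pos lam_le i by auto
  have ln: "1 \<le> lam n" "lam n \<le> int E" using lam_pos lam_le by auto
  note M = modulus_bounds[OF i]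
  have MV: "\<bar>?M\<bar> \<le> V" using M by (intro V_prod[of 0 2]) auto
  have EE: "lam n * int m \<le> int E * int E" using m li ln by (intro mult_mono) auto
  have mD: "0 \<le> lam n * int m" using ln by simp
  have b1: "\<bar>lam n * int m\<bar> \<le> V" using EE mD by (intro V_prod[of 0 2]) (auto simp: power2_eq_square)
  have "lam n \<le> int E * int E" using ln E_ge mult_mono[of 1 "int E" "lam n" "int E"] by simp
  then have "\<bar>lam n * int m - tau a i\<bar> \<le> int E * int E" using EE mD tau_bounds[of a i] by linarith
  then have b2: "\<bar>lam n * int m - tau a i\<bar> \<le> V" by (intro V_prod[of 0 2]) (auto simp: power2_eq_square)
  \<comment> \<open>The state reached after the loop over the entries. Case \<open>A\<close> treats
    vanishing fractional parts; in case \<open>B\<close> the candidate stays as computed.\<close>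
  have zero: "run V Fix_Zero 10 R2 inp out Q"
    if ag: "agree_outside ?T R R2" and c: "\<And>k. k \<le> n \<Longrightarrow> R2 (cell 2 k) = ?f k"
      and r: "R2 28 = ?M" "R2 30 = lam i" and pq: "0 \<le> R2 24" "1 \<le> R2 25"
      and max: "\<And>k. k \<le> n \<Longrightarrow> ?f k * R2 25 \<le> R2 24 * lam k"
      and ex: "R2 24 = 0 \<or> (\<exists>k\<le>n. R2 24 = ?f k \<and> R2 25 = lam k)" for R2
  proof -
    have ready2: "ready R2" by (rule ready_agree[OF R(1) ag]) (auto simp: cell_simps)
    have r21: "R2 21 = int i" using agree_outsideD[OF ag, of 21] R(3) by (simp add: cell_simps)
    note Rs = readyD[OF ready2] r r21
    let ?R3 = "R2(17 := 1 - R2 24)"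
    have A: "run V (Seq (Array_Store 2 21 28) (Seq (Copy 24 28) (Copy 25 30))) (6 + (1 + 1)) ?R3 inp out Q"
      if z: "R2 24 = 0"
    proof -
      have "?f k = 0" if "k \<le> n" for k
      proof -
        have "?f k * R2 25 \<le> 0" using max[OF that] z by simp
        then show ?thesis using cand_frac_bounds(1)[OF i, of a m k] pq(2) by (auto simp: mult_le_0_iff)
      qed
      then have cd: "cand a i m k = (if k = i then ?M else 0)" for k by (simp add: cand_def)
      have fin: "Q (R2(17 := 1, 6 := v, 7 := w, cell 2 i := ?M, 24 := ?M, 25 := lam i)) inp out" for v w
      proof (rule Q)
        show "agree_outside ?T R (R2(17 := 1, 6 := v, 7 := w, cell 2 i := ?M, 24 := ?M, 25 := lam i))"
          using ag by (simp add: agree_outside_upd cell_simps)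
        show "\<exists>k\<le>n. (R2(17 := 1, 6 := v, 7 := w, cell 2 i := ?M, 24 := ?M, 25 := lam i)) 24 = cand a i m k \<and>
          (R2(17 := 1, 6 := v, 7 := w, cell 2 i := ?M, 24 := ?M, 25 := lam i)) 25 = lam k"
          using i by (intro exI[of _ i]) (simp add: cd)
        show "cand a i m k * (R2(17 := 1, 6 := v, 7 := w, cell 2 i := ?M, 24 := ?M, 25 := lam i)) 25 \<le>
          (R2(17 := 1, 6 := v, 7 := w, cell 2 i := ?M, 24 := ?M, 25 := lam i)) 24 * lam k" if "k \<le> n" for k
          using M lam_pos[OF that] by (simp add: cd)
        show "(R2(17 := 1, 6 := v, 7 := w, cell 2 i := ?M, 24 := ?M, 25 := lam i)) (cell 2 k) = cand a i m k"
          if "k \<le> n" for k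
          using c[OF that] \<open>\<And>k. k \<le> n \<Longrightarrow> ?f k = 0\<close>[OF that] by (simp add: cd cell_simps)
      qed (simp add: cell_simps r)
      show ?thesis
        apply (rule run_Seq, rule run_Array_Store)
              apply (use V_index[OF i] in \<open>simp_all add: Rs\<close>)[6]
        apply (rule run_Seq, rule run_Copy)
         apply (simp add: Rs cell_simps)
        apply (rule run_Copy)
         apply (simp add: Rs cell_simps)
        apply (use fin z in \<open>simp add: Rs cell_simps\<close>)
        done
    qed
    have B: "run V (Assign 7 0) (6 + (1 + 1)) ?R3 inp out Q" if z: "R2 24 > 0"
    proof -
      obtain l where l: "l \<le> n" "R2 24 = ?f l" "R2 25 = lam l" using ex z by auto
      then have "\<not> (\<forall>j\<le>n. ?f j = 0)" using z by auto
      then have cd: "cand a i m k = ?f k" for k unfolding cand_def by (rule if_not_P)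
      have fin: "Q (R2(17 := 1 - R2 24, 7 := 0)) inp out"
      proof (rule Q)
        show "agree_outside ?T R (R2(17 := 1 - R2 24, 7 := 0))"
          using ag by (simp add: agree_outside_upd cell_simps)
        show "\<exists>k\<le>n. (R2(17 := 1 - R2 24, 7 := 0)) 24 = cand a i m k \<and> (R2(17 := 1 - R2 24, 7 := 0)) 25 = lam k"
          using l by (intro exI[of _ l]) (simp add: cd)
      qed (use c r max in \<open>simp_all add: cell_simps cd\<close>)
      show ?thesis
        by (rule run_weaken, rule run_Assign) (use V_const fin in simp_all)
    qed
    show ?thesis
    proof (rule run_bounded)
      assume bd: "bounded_by V R2"
      have b: "\<bar>1 - R2 24\<bar> \<le> V"
        using bounded_byD[OF bd, of 24] pq V_const by linarith
      show ?thesis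
        unfolding Fix_Zero_def
        apply (rule run_weaken)
         apply (rule run_Seq, rule run_Sub)
          apply (use b in \<open>simp add: Rs\<close>)
         apply (simp add: Rs)
         apply (rule run_Cond)
          apply (rule A)
          apply (use pq in simp)
         apply (rule B)
         apply simp
        apply simp
        done
    qed
  qed
  have sub: "{6..10} \<union> {14..18} \<union> {24, 25} \<union> range (cell 2) \<subseteq> ?T" by auto
  have "2 * (n + 1) \<le> E * (n + 1)" using E_ge by (intro mult_right_mono) auto
  then have total: "6 + (6 + (3 * E + 3 + (3 * E + 3 + (1 + (1 + (1 + (1 + ((n + 1) * (16 * E + 62) + 1 + 10)))))))) \<le> N"
    using N E_ge by (simp add: algebra_simps)
  show ?thesis
    unfolding Cand_def
    apply (rule run_weaken)
     apply (rule run_Seq, rule run_Array_Load)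
         apply (use V_index[OF i] R in \<open>simp_all add: readyD\<close>)[4]
     apply (simp add: R readyD[OF R(1)] i)
     apply (rule run_Seq, rule run_Array_Load)
         apply (use V_index[OF i] R in \<open>simp_all add: readyD\<close>)[4]
     apply (simp add: R readyD[OF R(1)] i cell_simps)
     apply (rule run_Seq, rule run_Mul[where N = "3 * E + 3"])
            apply (use li MV in \<open>simp_all add: readyD[OF R(1)]\<close>)[7]
     apply (simp add: R readyD[OF R(1)])
     apply (rule run_Seq, rule run_Mul[where N = "3 * E + 3"])
            apply (use li m R b1 in \<open>simp_all add: readyD[OF R(1)]\<close>)[7]
     apply (simp add: R readyD[OF R(1)])
     apply (rule run_Seq, rule run_Sub)
      apply (use b2 in simp)
     apply simp
     apply (rule run_Seq, rule run_Assign)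
      apply (use V_const in simp)
     apply (rule run_Seq, rule run_Assign)
      apply (use V_const in simp)
     apply (rule run_Seq, rule run_Copy)
      apply (simp add: readyD[OF R(1)])
     apply (simp add: readyD[OF R(1)])
     apply (rule run_Seq, rule run_Cand_Loop[where a = a and i = i and m = m, OF _ _ _ _ _ _ _ _ i m order_refl])
             apply (use R(1) in \<open>simp add: ready_upd\<close>)
            apply (simp_all add: R cell_simps)[7]
     apply (rule zero)
           apply (erule agree_outside_trans[rotated])
            apply (rule sub)
           apply (simp add: agree_outside_upd agree_outside_refl cell_simps)
          apply simp
         apply (drule agree_outsideD[where r = 28], simp (no_asm) add: cell_simps, simp)
        apply (drule agree_outsideD[where r = 30], simp (no_asm) add: cell_simps, simp)
       apply assumption
      apply assumption
     apply simp
    apply assumption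
    using total by simp
qed

lemma run_Copy_Best:
  assumes R: "ready R"
    and N: "(n + 1) * 14 + 2 \<le> N"
    and Q: "\<And>R'. agree_outside ({6, 7, 10, 14} \<union> range (cell 3)) R R' \<Longrightarrow>
      (\<And>j. j \<le> n \<Longrightarrow> R' (cell 3 j) = R (cell 2 j)) \<Longrightarrow> Q R' inp out"
  shows "run V Copy_Best N R inp out Q"
proof -
  let ?T = "{6, 7, 10, 14} \<union> range (cell 3)"
  define I where "I k R' i' o' \<longleftrightarrow> k \<le> n + 1 \<and> agree_outside ?T R R' \<and> R' 10 = int k \<and>
    (\<forall>j\<in>{k..n}. R' (cell 3 j) = R (cell 2 j)) \<and> i' = inp \<and> o' = out"
    for k R' and i' o' :: "int list"
  have I_ready: "ready R'" if "I j R' i' o'" for j R' i' o'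
    by (rule ready_agree[OF R(1), of ?T]) (use that in \<open>auto simp: I_def cell_simps\<close>)
  have body: "run V (Seq (Array_Load 14 2 10) (Array_Store 3 10 14)) (6 + 6) (R'(10 := int k)) i' o' (I k)"
    if k: "k < n + 1" and I: "I (Suc k) R' i' o'" for k R' i' o'
  proof -
    have ag: "agree_outside ?T R R'" and c: "\<And>j. j \<in> {Suc k..n} \<Longrightarrow> R' (cell 3 j) = R (cell 2 j)"
      and io: "i' = inp" "o' = out" using I by (simp_all add: I_def)
    have rc: "R' (cell 2 k) = R (cell 2 k)" by (rule agree_outsideD[OF ag]) (simp add: cell_simps)
    have kn: "k \<le> n" using k by simp
    have fin: "I k (R'(10 := int k, 6 := v, 7 := w, 14 := R (cell 2 k), cell 3 k := R (cell 2 k))) i' o'"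
      for v w
      unfolding I_def
    proof (intro conjI ballI)
      fix j assume "j \<in> {k..n}"
      then show "(R'(10 := int k, 6 := v, 7 := w, 14 := R (cell 2 k), cell 3 k := R (cell 2 k))) (cell 3 j) = R (cell 2 j)"
        using c[of j] by (cases "j = k") (simp_all add: cell_simps)
    qed (use kn io ag in \<open>simp_all add: agree_outside_upd cell_simps\<close>)
    have fin': "I k (R'(10 := int k, 14 := R (cell 2 k), 6 := v, 7 := w, cell 3 k := R (cell 2 k))) i' o'"
      for v w
      using fin[of v w] by (simp add: fun_upd_twist[of 14])
    show ?thesis
      apply (rule run_Seq, rule run_Array_Load)
          apply (use V_index[OF kn] in simp_all)[4]
      apply (simp add: rc cell_simps)
      apply (rule run_Array_Store)
            apply (use V_index[OF kn] in simp_all)[6]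
      apply (simp add: fun_upd_twist[of 14] fin fin')
      done
  qed
  have cnt: "R' 10 = int k \<and> R' 1 = 1" if "I k R' i' o'" for k R' i' o'
    using that readyD(2)[OF I_ready[OF that]] by (simp add: I_def)
  have post: "Q R' i' o'" if "I 0 R' i' o'" for R' i' o'
    using that Q by (simp add: I_def)
  have init: "I (n + 1) (R(10 := int (n + 1))) inp out"
    by (simp add: I_def agree_outside_upd agree_outside_refl)
  show ?thesis
    unfolding Copy_Best_def
    apply (rule run_weaken)
     apply (rule run_Seq, rule run_Copy)
      apply (simp add: readyD[OF R])
     apply (rule run_For_Down[where I = I, OF _ cnt body post order_refl])
      apply (use init in \<open>simp add: readyD[OF R] add.commute\<close>)
     apply assumption+
    using N by (simp_all add: algebra_simps)
qed

text \<open>The numerators \<open>p\<close> and \<open>P\<close>, of size up to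
  \<open>E ^ 2\<close>, are counting factors, which makes the cost quadratic in \<open>E\<close>.
  The compared products reach \<open>E ^ 5\<close>, the power of \<open>E\<close> in
  \<open>V_large\<close>.\<close>

lemma run_Consider:
  assumes R: "ready R" "R 24 = p" "R 25 = q" "R 28 = M" "R 26 = P" "R 27 = Z"
    and b: "0 \<le> p" "p \<le> int E ^ 2" "1 \<le> q" "q \<le> int E" "1 \<le> M" "M \<le> int E ^ 2"
      "0 \<le> P" "P \<le> int E ^ 2" "0 \<le> Z" "Z \<le> int E ^ 3"
    and N: "60 * ((n + 1) * E ^ 2) \<le> N"
    and Q: "\<And>R'. agree_outside ({6, 7, 8, 10, 14, 15, 16, 26, 27, 29} \<union> range (cell 3)) R R' \<Longrightarrow>
      (if P * (M * q) > Z * p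
       then R' 26 = p \<and> R' 27 = M * q \<and> R' 29 = M \<and> (\<forall>j\<le>n. R' (cell 3 j) = R (cell 2 j))
       else R' 26 = P \<and> R' 27 = Z \<and> R' 29 = R 29 \<and> (\<forall>j\<le>n. R' (cell 3 j) = R (cell 3 j))) \<Longrightarrow>
      Q R' inp out"
  shows "run V Consider N R inp out Q"
proof -
  let ?T = "{6, 7, 8, 10, 14, 15, 16, 26, 27, 29} \<union> range (cell 3)"
  have "Z * p \<le> int E ^ 3 * int E ^ 2" using b by (intro mult_mono) auto
  then have Zp: "0 \<le> Z * p" "Z * p \<le> int E ^ 3 * int E ^ 2" using b by auto
  have Mq: "0 \<le> M * q" "M * q \<le> int E ^ 2 * int E" using b by (auto intro!: mult_mono)
  have "M * q * P \<le> (int E ^ 2 * int E) * int E ^ 2" using b Mq by (intro mult_mono) auto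
  then have MqP: "0 \<le> M * q * P" "M * q * P \<le> int E ^ 5"
    using Mq b by (simp_all add: power_numeral_reduce mult_ac)
  have Zp': "Z * p \<le> int E ^ 5" using Zp(2) by (simp flip: power_add)
  have E5: "int E ^ 5 \<le> V" by (rule V_prod[of 0 5]) auto
  have b1: "\<bar>Z * p\<bar> \<le> V" "\<bar>M * q * P\<bar> \<le> V" "\<bar>M * q * P - Z * p\<bar> \<le> V"
    using Zp Zp' MqP E5 by linarith+
  have b2: "\<bar>M * q\<bar> \<le> V"
    using Mq by (intro V_prod[of 0 3]) (auto simp: power2_eq_square power3_eq_cube)
  have cnt: "3 * nat p + 3 \<le> 3 * E ^ 2 + 3" "3 * nat P + 3 \<le> 3 * E ^ 2 + 3" "3 * nat q + 3 \<le> 3 * E + 3"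
    using b by (simp_all add: nat_le_iff)
  let ?R1 = "R(14 := Z * p, 15 := M * q, 16 := M * q * P - Z * p, 8 := 0)"
  have ag1: "agree_outside ?T R ?R1" by (simp add: agree_outside_upd agree_outside_refl)
  have A: "run V (Seq (Copy 26 24) (Seq (Copy 27 15) (Seq (Copy 29 28) Copy_Best)))
      (1 + (1 + (1 + ((n + 1) * 14 + 2)))) ?R1 inp out Q" if less: "P * (M * q) > Z * p"
  proof -
    let ?R2 = "?R1(26 := p, 27 := M * q, 29 := M)"
    have ag2: "agree_outside ?T R ?R2" by (simp add: agree_outside_upd agree_outside_refl)
    have copy: "run V Copy_Best ((n + 1) * 14 + 2) ?R2 inp out Q"
    proof (rule run_Copy_Best[OF _ order_refl])
      show "ready ?R2" by (rule ready_agree[OF R(1) ag2]) (auto simp: cell_simps)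
      fix R' assume a: "agree_outside ({6, 7, 10, 14} \<union> range (cell 3)) ?R2 R'"
        and c: "\<And>j. j \<le> n \<Longrightarrow> R' (cell 3 j) = ?R2 (cell 2 j)"
      show "Q R' inp out"
      proof (rule Q)
        show "agree_outside ?T R R'" by (rule agree_outside_trans[OF ag2 a]) auto
        show "if P * (M * q) > Z * p
          then R' 26 = p \<and> R' 27 = M * q \<and> R' 29 = M \<and> (\<forall>j\<le>n. R' (cell 3 j) = R (cell 2 j))
          else R' 26 = P \<and> R' 27 = Z \<and> R' 29 = R 29 \<and> (\<forall>j\<le>n. R' (cell 3 j) = R (cell 3 j))"
          unfolding if_P[OF less] using c agree_outsideD[OF a] by (simp add: cell_simps)
      qed
    qed
    show ?thesis
      apply (rule run_Seq, rule run_Copy)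
       apply (simp add: readyD[OF R(1)])
      apply (rule run_Seq, rule run_Copy)
       apply (simp add: readyD[OF R(1)])
      apply (rule run_Seq, rule run_Copy)
       apply (simp add: readyD[OF R(1)])
      apply (use copy in \<open>simp add: R\<close>)
      done
  qed
  have B: "run V (Assign 7 0) (1 + (1 + (1 + ((n + 1) * 14 + 2)))) ?R1 inp out Q" if le: "\<not> P * (M * q) > Z * p"
  proof -
    have fin: "Q (?R1(7 := 0)) inp out"
    proof (rule Q)
      show "agree_outside ?T R (?R1(7 := 0))" using ag1 by (simp add: agree_outside_upd)
    next
      show "if P * (M * q) > Z * p
          then (?R1(7 := 0)) 26 = p \<and> (?R1(7 := 0)) 27 = M * q \<and> (?R1(7 := 0)) 29 = M \<and> (\<forall>j\<le>n. (?R1(7 := 0)) (cell 3 j) = R (cell 2 j))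
          else (?R1(7 := 0)) 26 = P \<and> (?R1(7 := 0)) 27 = Z \<and> (?R1(7 := 0)) 29 = R 29 \<and> (\<forall>j\<le>n. (?R1(7 := 0)) (cell 3 j) = R (cell 3 j))"
        unfolding if_not_P[OF le] by (simp add: R cell_simps)
    qed
    show ?thesis
      by (rule run_weaken, rule run_Assign) (use V_const fin in simp_all)
  qed
  have four: "4 \<le> E * E" using E_ge mult_mono[of 2 E 2 E] by simp
  have sq: "1 \<le> E * E" "E \<le> E * E" "E * E \<le> (n + 1) * (E * E)" "(n + 1) * 4 \<le> (n + 1) * (E * E)"
  proof -
    show "(n + 1) * 4 \<le> (n + 1) * (E * E)" by (rule mult_left_mono[OF four]) simp
  qed (use E_ge in simp_all)
  have total: "3 * E ^ 2 + 3 + (3 * E + 3 + (3 * E ^ 2 + 3 + (1 + Suc (1 + (1 + (1 + ((n + 1) * 14 + 2))))))) \<le> N"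
  proof -
    define y z where "y = (n + 1) * (E * E)" and "z = E * E"
    have "1 \<le> z" "E \<le> z" "z \<le> y" "(n + 1) * 4 \<le> y" "60 * y \<le> N"
      using sq N by (simp_all add: y_def z_def power2_eq_square)
    then show ?thesis unfolding power2_eq_square z_def[symmetric] by simp
  qed
  show ?thesis
    unfolding Consider_def
    apply (rule run_weaken)
     apply (rule run_Seq, rule run_Mul[where N = "3 * E ^ 2 + 3"])
            apply (use b b1 cnt in \<open>simp_all add: R readyD[OF R(1)]\<close>)[7]
     apply (simp add: R)
     apply (rule run_Seq, rule run_Mul[where N = "3 * E + 3"])
            apply (use b b2 cnt in \<open>simp_all add: R readyD[OF R(1)]\<close>)[7]
     apply (simp add: R)
     apply (rule run_Seq, rule run_Mul[where N = "3 * E ^ 2 + 3"])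
            apply (use b b1 cnt in \<open>simp_all add: R readyD[OF R(1)]\<close>)[7]
     apply (simp add: R)
     apply (rule run_Seq, rule run_Sub)
      apply (use b1 in simp)
     apply (simp add: fun_upd_twist[of 8])
     apply (rule run_Cond)
      apply (rule A)
      apply (simp add: mult_ac)
     apply (rule B)
     apply (simp add: mult_ac)
    using total by simp
qed

definition triples :: "(nat \<times> nat \<times> nat) set" where
  "triples = {(a, i, m). int a < lam n \<and> i \<le> n \<and> int m < lam i}"

text \<open>All three loops count down, so the triples treated so far are those lexicographically at
  or above the current counters. \<open>done1\<close>, \<open>done2\<close> and \<open>done3\<close>
  describe the progress of the outer, the middle and the inner loop.\<close>

definition done1 :: "nat \<Rightarrow> (nat \<times> nat \<times> nat) set" where
  "done1 a = {(a', i', m') \<in> triples. a \<le> a'}"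

definition done2 :: "nat \<Rightarrow> nat \<Rightarrow> (nat \<times> nat \<times> nat) set" where
  "done2 a i = {(a', i', m') \<in> triples. a < a' \<or> a = a' \<and> i \<le> i'}"

definition done3 :: "nat \<Rightarrow> nat \<Rightarrow> nat \<Rightarrow> (nat \<times> nat \<times> nat) set" where
  "done3 a i m = {(a', i', m') \<in> triples. a < a' \<or> a = a' \<and> (i < i' \<or> i = i' \<and> m \<le> m')}"

lemma done_steps:
  "done1 (nat (lam n)) = {}" "done1 0 = triples"
  "done2 a (Suc n) \<subseteq> done1 (Suc a)" "done1 a \<subseteq> done2 a 0"
  "done3 a i (nat (lam i)) \<subseteq> done2 a (Suc i)" "done2 a i \<subseteq> done3 a i 0"
  "done3 a i m \<subseteq> insert (a, i, m) (done3 a i (Suc m))"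
  using lam_pos by (auto simp: done1_def done2_def done3_def triples_def)

lemma best_among_subset: "best_among S P Q M N \<Longrightarrow> S' \<subseteq> S \<Longrightarrow> best_among S' P Q M N"
  unfolding best_among_def by blast

definition holds_best :: "(nat \<times> nat \<times> nat) set \<Rightarrow> (reg \<Rightarrow> int) \<Rightarrow> bool" where
  "holds_best S R \<longleftrightarrow> (\<exists>N. best_among S (R 26) (R 27) (R 29) N \<and> (\<forall>j\<le>n. R (cell 3 j) = N j))"

lemma holds_best_subset: "holds_best S R \<Longrightarrow> S' \<subseteq> S \<Longrightarrow> holds_best S' R"
  unfolding holds_best_def using best_among_subset by blast

lemma holds_best_agree:
  assumes "holds_best S R" "agree_outside X R R'" "X \<inter> ({26, 27, 29} \<union> range (cell 3)) = {}"
  shows "holds_best S R'"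
proof -
  have "R' r = R r" if "r \<in> {26, 27, 29} \<union> range (cell 3)" for r
    using assms(2,3) that by (auto simp: agree_outside_def)
  then show ?thesis using assms(1) by (auto simp: holds_best_def)
qed

lemma run_Cand_Consider:
  assumes R: "ready R" "\<And>j. j \<le> n \<Longrightarrow> R (cell 5 j) = tau a j" "R 21 = int i" "R 22 = int m"
    and i: "i \<le> n" and m: "int m < lam i" and best: "holds_best S R"
    and N: "160 * ((n + 1) * E ^ 2) \<le> N"
    and Q: "\<And>R'. agree_outside ({6..18} \<union> {24..31} \<union> range (cell 2) \<union> range (cell 3)) R R' \<Longrightarrow>
      holds_best (insert (a, i, m) S) R' \<Longrightarrow> Q R' inp out"
  shows "run V (Seq Cand Consider) N R inp out Q"
proof (rule run_weaken, rule run_Seq)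
  show "run V Cand (200 * ((n + 1) * E)) R inp out (\<lambda>R inp out. run V Consider (60 * ((n + 1) * E ^ 2)) R inp out Q)"
  proof (rule run_Cand[OF R i m order_refl])
    fix R1 assume a1: "agree_outside ({6..10} \<union> {14..18} \<union> {24, 25, 28, 30, 31} \<union> range (cell 2)) R R1"
      and c: "\<And>k. k \<le> n \<Longrightarrow> R1 (cell 2 k) = cand a i m k" and r28: "R1 28 = lam n * lam i"
      and ex: "\<exists>k\<le>n. R1 24 = cand a i m k \<and> R1 25 = lam k"
      and max: "\<And>k. k \<le> n \<Longrightarrow> cand a i m k * R1 25 \<le> R1 24 * lam k"
    obtain l where l: "l \<le> n" "R1 25 = lam l" "R1 24 = cand a i m l" using ex by auto
    have hb: "holds_best S R1" by (rule holds_best_agree[OF best a1]) (auto simp: cell_simps)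
    then obtain N where N: "best_among S (R1 26) (R1 27) (R1 29) N" "\<forall>j\<le>n. R1 (cell 3 j) = N j"
      by (auto simp: holds_best_def)
    have ready1: "ready R1" by (rule ready_agree[OF R(1) a1]) (auto simp: cell_simps)
    have cb: "0 \<le> cand a i m l" "cand a i m l \<le> int E ^ 2"
      using cand_bounds[OF i, of a m l] modulus_bounds[OF i] by linarith+
    have lb: "1 \<le> lam l" "lam l \<le> int E" using lam_pos lam_le l by auto
    have PQ: "0 \<le> R1 26" "R1 26 \<le> int E ^ 2" "0 \<le> R1 27" "R1 27 \<le> int E ^ 3"
      using N(1) unfolding best_among_def by linarith+
    show "run V Consider (60 * ((n + 1) * E ^ 2)) R1 inp out Q"
    proof (rule run_Consider[OF ready1 l(3,2) r28 refl refl cb lb modulus_bounds[OF i] PQ order_refl])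
      fix R2 assume a2: "agree_outside ({6, 7, 8, 10, 14, 15, 16, 26, 27, 29} \<union> range (cell 3)) R1 R2"
        and upd: "if R1 26 * (lam n * lam i * lam l) > R1 27 * cand a i m l
          then R2 26 = cand a i m l \<and> R2 27 = lam n * lam i * lam l \<and> R2 29 = lam n * lam i \<and>
            (\<forall>j\<le>n. R2 (cell 3 j) = R1 (cell 2 j))
          else R2 26 = R1 26 \<and> R2 27 = R1 27 \<and> R2 29 = R1 29 \<and> (\<forall>j\<le>n. R2 (cell 3 j) = R1 (cell 3 j))"
      have max': "\<And>k. k \<le> n \<Longrightarrow> cand a i m k * lam l \<le> cand a i m l * lam k"
        using max l by simp
      note ins = best_among_insert[OF N(1) i l(1) refl refl]
      show "Q R2 inp out"
      proof (rule Q)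
        have "agree_outside ({6..18} \<union> {24..31} \<union> range (cell 2) \<union> range (cell 3)) R R1"
          by (rule agree_outside_trans[OF agree_outside_refl a1]) auto
        then show "agree_outside ({6..18} \<union> {24..31} \<union> range (cell 2) \<union> range (cell 3)) R R2"
          by (rule agree_outside_trans[OF _ a2]) auto
        show "holds_best (insert (a, i, m) S) R2"
        proof (cases "R1 26 * (lam n * lam i * lam l) > R1 27 * cand a i m l")
          case True
          then show ?thesis
            using upd ins(1)[OF max' True] c unfolding holds_best_def by (intro exI[of _ "cand a i m"]) simp
        next
          case False
          then show ?thesis
            using upd ins(2)[OF max'] N(2) unfolding holds_best_def by (intro exI[of _ N]) simp
        qed
      qed
    qed
  qed
  have "100 * ((n + 1) * (2 * E)) \<le> 100 * ((n + 1) * (E * E))"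
    using E_ge by (intro mult_left_mono mult_right_mono) auto
  then have "200 * ((n + 1) * E) \<le> 100 * ((n + 1) * E ^ 2)"
    by (simp add: power2_eq_square)
  then show "200 * ((n + 1) * E) + 60 * ((n + 1) * E ^ 2) \<le> N" using N by linarith
qed

lemma run_Inner:
  assumes R: "ready R" "\<And>j. j \<le> n \<Longrightarrow> R (cell 5 j) = tau a j" "R 21 = int i"
    and i: "i \<le> n" and best: "holds_best (done2 a (Suc i)) R"
    and N: "E * (160 * ((n + 1) * E ^ 2) + 2) + 7 \<le> N"
    and Q: "\<And>R'. agree_outside ({6..18} \<union> {22} \<union> {24..31} \<union> range (cell 2) \<union> range (cell 3)) R R' \<Longrightarrow>
      holds_best (done2 a i) R' \<Longrightarrow> Q R' inp out"
  shows "run V Inner N R inp out Q"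
proof -
  let ?T = "{6..18} \<union> {22} \<union> {24..31} \<union> range (cell 2) \<union> range (cell 3)"
  let ?c = "160 * ((n + 1) * E ^ 2)"
  have li: "1 \<le> lam i" "lam i \<le> int E" using lam_pos lam_le i by auto
  define I where "I m R' i' o' \<longleftrightarrow> int m \<le> lam i \<and> agree_outside ?T R R' \<and> R' 22 = int m \<and>
    holds_best (done3 a i m) R' \<and> i' = inp \<and> o' = out" for m R' and i' o' :: "int list"
  have I_ready: "ready R'" if "I j R' i' o'" for j R' i' o'
    by (rule ready_agree[OF R(1), of ?T]) (use that in \<open>auto simp: I_def cell_simps\<close>)
  have body: "run V (Seq Cand Consider) ?c (R'(22 := int m)) i' o' (I m)"
    if m: "m < nat (lam i)" and I: "I (Suc m) R' i' o'" for m R' i' o'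
  proof -
    have ag: "agree_outside ?T R R'" and hb: "holds_best (done3 a i (Suc m)) R'" and io: "i' = inp" "o' = out"
      using I by (simp_all add: I_def)
    note R' = agree_outsideD[OF ag]
    have mi: "int m < lam i" using m by simp
    show ?thesis
    proof (rule run_Cand_Consider[OF _ _ _ _ i mi _ order_refl])
      show "ready (R'(22 := int m))" using I_ready[OF I] by (simp add: ready_upd)
      show "(R'(22 := int m)) (cell 5 j) = tau a j" if "j \<le> n" for j
        using R(2)[OF that] R'[of "cell 5 j"] by (simp add: cell_simps)
      show "(R'(22 := int m)) 21 = int i" using R(3) R'[of 21] by (simp add: cell_simps)
      show "holds_best (done3 a i (Suc m)) (R'(22 := int m))"
        by (rule holds_best_agree[OF hb, of "{22}"]) (auto simp: agree_outside_upd agree_outside_refl cell_simps)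
      fix R2 assume a2: "agree_outside ({6..18} \<union> {24..31} \<union> range (cell 2) \<union> range (cell 3)) (R'(22 := int m)) R2"
        and hb2: "holds_best (insert (a, i, m) (done3 a i (Suc m))) R2"
      show "I m R2 i' o'"
        unfolding I_def
      proof (intro conjI)
        show "agree_outside ?T R R2"
          by (rule agree_outside_trans[OF agree_outside_upd[OF ag] a2]) auto
        show "R2 22 = int m" using agree_outsideD[OF a2, of 22] by (simp add: cell_simps)
        show "holds_best (done3 a i m) R2" by (rule holds_best_subset[OF hb2 done_steps(7)])
      qed (use mi io in auto)
    qed simp
  qed
  have cnt: "R' 22 = int k \<and> R' 1 = 1" if "I k R' i' o'" for k R' i' o'
    using that readyD(2)[OF I_ready[OF that]] by (simp add: I_def)
  have post: "Q R' i' o'" if "I 0 R' i' o'" for R' i' o'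
  proof -
    have "holds_best (done3 a i 0) R'" using that by (simp add: I_def)
    then have "holds_best (done2 a i) R'" by (rule holds_best_subset[OF _ done_steps(6)])
    then show ?thesis using that Q by (simp add: I_def)
  qed
  have init: "I (nat (lam i)) (R(6 := v, 7 := w, 22 := lam i)) inp out" for v w
    unfolding I_def
  proof (intro conjI)
    show "agree_outside ?T R (R(6 := v, 7 := w, 22 := lam i))"
      by (simp add: agree_outside_upd agree_outside_refl)
    have "holds_best (done3 a i (nat (lam i))) R" by (rule holds_best_subset[OF best done_steps(5)])
    then show "holds_best (done3 a i (nat (lam i))) (R(6 := v, 7 := w, 22 := lam i))"
      by (rule holds_best_agree[of _ _ "{6, 7, 22}"]) (auto simp: agree_outside_upd agree_outside_refl cell_simps)
  qed (use li in auto)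
  have "nat (lam i) * (?c + 2) \<le> E * (?c + 2)" using li by (intro mult_right_mono) auto
  then have total: "6 + (nat (lam i) * (?c + 2) + 1) \<le> N" using N by linarith
  show ?thesis
    unfolding Inner_def
    apply (rule run_weaken[OF _ total])
    apply (rule run_Seq, rule run_Array_Load)
        apply (use V_index[OF i] R in \<open>simp_all add: readyD\<close>)[4]
    apply (rule run_For_Down[where I = I, OF _ cnt body post order_refl])
      apply (use init in \<open>simp add: R readyD[OF R(1)] i\<close>)
     apply assumption+
    done
qed

lemma run_Middle:
  assumes R: "ready R" "\<And>j. j \<le> n \<Longrightarrow> R (cell 5 j) = tau a j" "R 21 = int (n + 1)"
    and best: "holds_best (done1 (Suc a)) R"
    and N: "(n + 1) * (E * (160 * ((n + 1) * E ^ 2) + 2) + 9) + 1 \<le> N"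
    and Q: "\<And>R'. agree_outside ({6..18} \<union> {21, 22} \<union> {24..31} \<union> range (cell 2) \<union> range (cell 3)) R R' \<Longrightarrow>
      holds_best (done1 a) R' \<Longrightarrow> Q R' inp out"
  shows "run V (For_Down 21 Inner) N R inp out Q"
proof -
  let ?T = "{6..18} \<union> {21, 22} \<union> {24..31} \<union> range (cell 2) \<union> range (cell 3)"
  let ?c = "E * (160 * ((n + 1) * E ^ 2) + 2) + 7"
  define I where "I i R' i' o' \<longleftrightarrow> i \<le> n + 1 \<and> agree_outside ?T R R' \<and> R' 21 = int i \<and>
    holds_best (done2 a i) R' \<and> i' = inp \<and> o' = out" for i R' and i' o' :: "int list"
  have I_ready: "ready R'" if "I j R' i' o'" for j R' i' o'
    by (rule ready_agree[OF R(1), of ?T]) (use that in \<open>auto simp: I_def cell_simps\<close>)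
  have body: "run V Inner ?c (R'(21 := int i)) i' o' (I i)"
    if i: "i < n + 1" and I: "I (Suc i) R' i' o'" for i R' i' o'
  proof -
    have ag: "agree_outside ?T R R'" and hb: "holds_best (done2 a (Suc i)) R'" and io: "i' = inp" "o' = out"
      using I by (simp_all add: I_def)
    note R' = agree_outsideD[OF ag]
    have iin: "i \<le> n" using i by simp
    show ?thesis
    proof (rule run_Inner[OF _ _ _ iin _ order_refl])
      show "ready (R'(21 := int i))" using I_ready[OF I] by (simp add: ready_upd)
      show "(R'(21 := int i)) (cell 5 j) = tau a j" if "j \<le> n" for j
        using R(2)[OF that] R'[of "cell 5 j"] by (simp add: cell_simps)
      show "holds_best (done2 a (Suc i)) (R'(21 := int i))"
        by (rule holds_best_agree[OF hb, of "{21}"]) (auto simp: agree_outside_upd agree_outside_refl cell_simps)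
      fix R2 assume a2: "agree_outside ({6..18} \<union> {22} \<union> {24..31} \<union> range (cell 2) \<union> range (cell 3)) (R'(21 := int i)) R2"
        and hb2: "holds_best (done2 a i) R2"
      show "I i R2 i' o'"
        unfolding I_def
      proof (intro conjI)
        show "agree_outside ?T R R2"
          by (rule agree_outside_trans[OF agree_outside_upd[OF ag] a2]) auto
        show "R2 21 = int i" using agree_outsideD[OF a2, of 21] by (simp add: cell_simps)
      qed (use i io hb2 in auto)
    qed simp
  qed
  have cnt: "R' 21 = int k \<and> R' 1 = 1" if "I k R' i' o'" for k R' i' o'
    using that readyD(2)[OF I_ready[OF that]] by (simp add: I_def)
  have post: "Q R' i' o'" if "I 0 R' i' o'" for R' i' o'
  proof -
    have "holds_best (done2 a 0) R'" using that by (simp add: I_def)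
    then have "holds_best (done1 a) R'" by (rule holds_best_subset[OF _ done_steps(4)])
    then show ?thesis using that Q by (simp add: I_def)
  qed
  have init: "I (n + 1) R inp out"
    using holds_best_subset[OF best done_steps(3)] R by (simp add: I_def agree_outside_refl)
  show ?thesis
    by (rule run_For_Down[where I = I, OF init cnt body post]) (use N in \<open>simp_all add: algebra_simps\<close>)
qed

text \<open>For each \<open>a\<close>, the back substitution costs order
  \<open>(n + 1) ^ 3 * E ^ 3\<close>, and the at most \<open>(n + 1) * E\<close> candidates cost
  order \<open>(n + 1) * E ^ 2\<close> each. The range of \<open>a\<close> contributes another
  factor \<open>E\<close>.\<close>

lemma run_Search:
  assumes R: "ready R" "R 27 = 0"
    and N: "1000 * ((n + 1) ^ 3 * E ^ 4) \<le> N"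
    and Q: "\<And>R'. agree_outside ({6..18} \<union> {20..31} \<union> range (cell 5) \<union> range (cell 2) \<union> range (cell 3)) R R' \<Longrightarrow>
      holds_best triples R' \<Longrightarrow> Q R' inp out"
  shows "run V Search N R inp out Q"
proof -
  let ?T = "{6..18} \<union> {20..31} \<union> range (cell 5) \<union> range (cell 2) \<union> range (cell 3)"
  let ?t = "200 * ((n + 1) ^ 3 * E ^ 3)"
  let ?m = "(n + 1) * (E * (160 * ((n + 1) * E ^ 2) + 2) + 9) + 1"
  have ln: "1 \<le> lam n" "lam n \<le> int E" using lam_pos lam_le by auto
  define I where "I a R' i' o' \<longleftrightarrow> int a \<le> lam n \<and> agree_outside ?T R R' \<and> R' 20 = int a \<and>
    holds_best (done1 a) R' \<and> i' = inp \<and> o' = out" for a R' and i' o' :: "int list"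
  have I_ready: "ready R'" if "I j R' i' o'" for j R' i' o'
    by (rule ready_agree[OF R(1), of ?T]) (use that in \<open>auto simp: I_def cell_simps\<close>)
  have body: "run V (Seq Tau (Seq (Copy 21 3) (For_Down 21 Inner))) (?t + (1 + ?m)) (R'(20 := int a)) i' o' (I a)"
    if a: "a < nat (lam n)" and I: "I (Suc a) R' i' o'" for a R' i' o'
  proof (rule run_Seq, rule run_Tau[OF _ _ _ _ order_refl])
    have ag: "agree_outside ?T R R'" and hb: "holds_best (done1 (Suc a)) R'" and io: "i' = inp" "o' = out"
      using I by (simp_all add: I_def)
    show "loaded (R'(20 := int a))" using I_ready[OF I] by (simp add: ready_def loaded_upd)
    show "(R'(20 := int a)) 5 = lam n" using readyD(6)[OF I_ready[OF I]] by simp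
    show "(R'(20 := int a)) 20 = int a" by simp
    show "a \<le> E" using a ln by simp
    fix R1 assume a1: "agree_outside ({6..17} \<union> {23} \<union> range (cell 5)) (R'(20 := int a)) R1"
      and t: "\<And>j. j \<le> n \<Longrightarrow> R1 (cell 5 j) = tau a j"
    have ag1: "agree_outside ?T R R1"
      by (rule agree_outside_trans[OF agree_outside_upd[OF ag] a1]) auto
    have hb0: "holds_best (done1 (Suc a)) (R'(20 := int a))"
      by (rule holds_best_agree[OF hb, of "{20}"]) (auto simp: agree_outside_upd agree_outside_refl cell_simps)
    have hb1: "holds_best (done1 (Suc a)) R1" by (rule holds_best_agree[OF hb0 a1]) (auto simp: cell_simps)
    have ready1: "ready R1" by (rule ready_agree[OF R(1) ag1]) (auto simp: cell_simps)
    let ?R1 = "R1(21 := int n + 1)"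
    have "run V (For_Down 21 Inner) ?m ?R1 i' o' (I a)"
    proof (rule run_Middle[OF _ _ _ _ order_refl])
      show "ready ?R1" using ready1 by (simp add: ready_upd)
      show "?R1 (cell 5 j) = tau a j" if "j \<le> n" for j using t[OF that] by (simp add: cell_simps)
      show "holds_best (done1 (Suc a)) ?R1"
        by (rule holds_best_agree[OF hb1, of "{21}"]) (auto simp: agree_outside_upd agree_outside_refl cell_simps)
      fix R2 assume a2: "agree_outside ({6..18} \<union> {21, 22} \<union> {24..31} \<union> range (cell 2) \<union> range (cell 3)) ?R1 R2"
        and hb2: "holds_best (done1 a) R2"
      show "I a R2 i' o'"
        unfolding I_def
      proof (intro conjI)
        show "agree_outside ?T R R2"
          by (rule agree_outside_trans[OF agree_outside_upd[OF ag1] a2]) auto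
        show "R2 20 = int a"
          using agree_outsideD[OF a2, of 20] agree_outsideD[OF a1, of 20] by (simp add: cell_simps)
      qed (use a io hb2 in auto)
    qed simp
    then show "run V (Seq (Copy 21 3) (For_Down 21 Inner)) (1 + ?m) R1 i' o' (I a)"
      by (intro run_Seq run_Copy) (simp_all add: readyD[OF ready1])
  qed
  have cnt: "R' 20 = int k \<and> R' 1 = 1" if "I k R' i' o'" for k R' i' o'
    using that readyD(2)[OF I_ready[OF that]] by (simp add: I_def)
  have post: "Q R' i' o'" if "I 0 R' i' o'" for R' i' o'
    using that Q by (simp add: I_def done_steps)
  have init: "I (nat (lam n)) (R(26 := 1, 20 := lam n)) inp out"
    unfolding I_def
  proof (intro conjI)
    show "agree_outside ?T R (R(26 := 1, 20 := lam n))"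
      by (simp add: agree_outside_upd agree_outside_refl)
    \<comment> \<open>The quotient \<open>1 / 0\<close> before any candidate; only the numerator has
      to be assigned, since register 27 is still 0.\<close>
    have "best_among {} 1 0 (R 29) (\<lambda>j. R (cell 3 j))"
      using E_ge by (simp add: best_among_def)
    then show "holds_best (done1 (nat (lam n))) (R(26 := 1, 20 := lam n))"
      using R by (auto simp: holds_best_def done_steps cell_simps intro!: exI[of _ "\<lambda>j. R (cell 3 j)"])
  qed (use ln in auto)
  have total: "1 + (1 + (nat (lam n) * (?t + (1 + ?m) + 2) + 1)) \<le> N"
  proof -
    define x M where "x = n + 1" and "M = x ^ 3 * E ^ 4"
    have mono: "x ^ i * E ^ j \<le> M" if "i \<le> 3" "j \<le> 4" for i j
      unfolding M_def x_def using that E_ge by (intro mult_mono power_increasing) auto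
    have m: "1 \<le> M" "E \<le> M" "x * E \<le> M" "x * (E * E) \<le> M" "x * (x * (E * (E * (E * E)))) \<le> M"
        "x * (x * (x * (E * (E * (E * E))))) \<le> M"
      using mono[of 0 0] mono[of 0 1] mono[of 1 1] mono[of 1 2] mono[of 2 4] mono[of 3 4]
      by (simp_all add: power_numeral_reduce mult_ac)
    define z where "z = nat (lam n) * (?t + (1 + ?m) + 2)"
    have "z \<le> E * (?t + (1 + ?m) + 2)" unfolding z_def using ln by (intro mult_right_mono) auto
    also have "\<dots> = 200 * (x * (x * (x * (E * (E * (E * E)))))) + 160 * (x * (x * (E * (E * (E * E))))) +
        2 * (x * (E * E)) + 9 * (x * E) + 4 * E"
      unfolding x_def[symmetric] by (simp add: power_numeral_reduce algebra_simps)
    also have "\<dots> \<le> 200 * M + 160 * M + 2 * M + 9 * M + 4 * M"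
      by (intro add_mono mult_left_mono m) auto
    finally have "z \<le> 375 * M" by simp
    then have "1 + (1 + (z + 1)) \<le> 1000 * M" using m(1) by linarith
    then show ?thesis using N unfolding z_def M_def x_def by linarith
  qed
  show ?thesis
    unfolding Search_def
    apply (rule run_weaken[OF _ total])
    apply (rule run_Seq, rule run_Assign)
     apply (use V_const in simp)
    apply (rule run_Seq, rule run_Copy)
     apply (simp add: readyD[OF R(1)])
    apply (rule run_For_Down[where I = I, OF _ cnt body post order_refl])
      apply (use init in \<open>simp add: readyD[OF R(1)]\<close>)
     apply assumption+
    done
qed

section \<open>Input, output and the complete program\<close>

lemma V_sq: "8 * (int n * int n + int n) + 48 \<le> V"
  by (rule V_address_le) simp

lemma run_Init:
  assumes N: "20 * ((n + 1) * (n + 1)) \<le> N"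
    and Q: "\<And>R'. agree_outside ({1, 2, 3, 4, 6, 7, 8, 10, 11, 14} \<union> range (cell 4)) (\<lambda>_. 0) R' \<Longrightarrow>
      loaded R' \<Longrightarrow> Q R' rest out"
  shows "run V Init N (\<lambda>_. 0) (int n # map (\<lambda>e. h (e div n) (e mod n)) [0..<n * (n + 1)] @ rest) out Q"
proof -
  let ?T = "{1, 2, 3, 4, 6, 7, 8, 10, 11, 14} \<union> range (cell 4)"
  let ?f = "\<lambda>e. h (e div n) (e mod n)"
  let ?L = "n * (n + 1)"
  define I where "I k R' i' o' \<longleftrightarrow> k \<le> ?L \<and> agree_outside ?T (\<lambda>_. 0) R' \<and> R' 10 = int k \<and>
    R' 1 = 1 \<and> R' 2 = int n \<and> R' 3 = int n + 1 \<and> R' 4 = int ?L \<and> R' 11 = int (?L - k) \<and>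
    (\<forall>e<?L - k. R' (cell 4 e) = ?f e) \<and> i' = map ?f [?L - k..<?L] @ rest \<and> o' = out"
    for k R' and i' o' :: "int list"
  have LV: "8 * int ?L + 48 \<le> V" using V_sq by (simp add: algebra_simps)
  have body: "run V (Seq (Read 14) (Seq (Array_Store 4 11 14) (Add 11 11 1))) (1 + (6 + 1))
      (R'(10 := int k)) i' o' (I k)"
    if k: "k < ?L" and I: "I (Suc k) R' i' o'" for k R' i' o'
  proof -
    define e where "e = ?L - Suc k"
    have e: "e < ?L" "?L - k = Suc e" "int e + 1 = int (?L - k)" using k by (auto simp: e_def)
    have ag: "agree_outside ?T (\<lambda>_. 0) R'" and r: "R' 1 = 1" "R' 2 = int n" "R' 3 = int n + 1" "R' 4 = int ?L"
      "R' 11 = int e" and c: "\<And>d. d < e \<Longrightarrow> R' (cell 4 d) = ?f d"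
      and io: "i' = map ?f [e..<?L] @ rest" "o' = out"
      using I unfolding I_def e_def by blast+
    have i': "i' = ?f e # map ?f [Suc e..<?L] @ rest" using e(1) unfolding io by (simp add: upt_conv_Cons)
    have "e div n \<le> n" "e mod n < n"
      using e(1) n_pos less_mult_imp_div_less[of e "n + 1" n] by (auto simp: mult.commute)
    then have "\<bar>?f e\<bar> \<le> int (n * E)" by (rule entry_le)
    also have "\<dots> \<le> V" by (rule V_prod[of 1 1]) (simp_all add: distrib_right)
    finally have fV: "\<bar>?f e\<bar> \<le> V" .
    have eV: "8 * int e + 48 \<le> V" using LV e(1) by linarith
    have e1V: "\<bar>int e + 1\<bar> \<le> V" using eV by linarith
    have fin: "I k (R'(10 := int k, 14 := ?f e, 6 := v, 7 := w, cell 4 e := ?f e, 11 := int e + 1))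
       (map ?f [Suc e..<?L] @ rest) o'" for v w
      unfolding I_def
    proof (intro conjI allI impI)
      fix d assume "d < ?L - k"
      then have "d < Suc e" using e(2) by simp
      then show "(R'(10 := int k, 14 := ?f e, 6 := v, 7 := w, cell 4 e := ?f e, 11 := int e + 1)) (cell 4 d) = ?f d"
        using c[of d] by (cases "d = e") (simp_all add: cell_simps)
    qed (use k ag r io e in \<open>simp_all add: agree_outside_upd cell_simps\<close>)
    show ?thesis
      unfolding i'
      apply (rule run_Seq, rule run_Read)
       apply (rule fV)
      apply (rule run_Seq, rule run_Array_Store)
            apply (use eV r in simp_all)[6]
      apply (simp add: r)
      apply (rule run_Add[unfolded One_nat_def])
       apply (use e1V r in \<open>simp add: cell_simps\<close>)
      apply (use fin r in \<open>simp add: cell_simps\<close>)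
      done
  qed
  have cnt: "R' 10 = int k \<and> R' 1 = 1" if "I k R' i' o'" for k R' i' o'
    using that unfolding I_def by blast
  have post: "Q R' i' o'" if I0: "I 0 R' i' o'" for R' i' o'
  proof -
    have ag: "agree_outside ?T (\<lambda>_. 0) R'" and c: "\<And>e. e < ?L \<Longrightarrow> R' (cell 4 e) = ?f e"
      and r: "R' 1 = 1" "R' 2 = int n" "R' 3 = int n + 1" "R' 4 = int ?L" and io: "i' = rest" "o' = out"
      using I0 by (simp_all add: I_def)
    have "R' 0 = 0" using agree_outsideD[OF ag, of 0] by (simp add: cell_simps)
    moreover have "R' (cell 4 (j * n + k)) = h j k" if "j \<le> n" "k < n" for j k
    proof -
      have "j * n \<le> n * n" using that(1) by (rule mult_le_mono1)
      then have "j * n + k < n * n + n" using that(2) by linarith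
      then have "j * n + k < (n + 1) * n" by simp
      then show ?thesis using c[of "j * n + k"] that by (simp add: mult.commute)
    qed
    ultimately have "loaded R'" using r by (simp add: loaded_def)
    then show ?thesis unfolding io using Q[OF ag] by simp
  qed
  have b1: "\<bar>int n + 1\<bar> \<le> V" "\<bar>int n\<bar> \<le> V" "\<bar>(int n + 1) * int n\<bar> \<le> V"
  proof -
    show "\<bar>int n + 1\<bar> \<le> V" "\<bar>int n\<bar> \<le> V" using V_index[of n] by simp_all
    have "\<bar>int ?L\<bar> \<le> V" by (rule abs_le_address) (use LV in simp_all)
    then show "\<bar>(int n + 1) * int n\<bar> \<le> V" by (simp add: algebra_simps)
  qed
  have init: "I ?L ((\<lambda>_. 0)(Suc 0 := 1, 2 := int n, 3 := int n + 1, 8 := 0, 4 := (int n + 1) * int n,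
      10 := (int n + 1) * int n, 11 := 0)) (map ?f [0..<?L] @ rest) out"
    by (simp add: I_def agree_outside_upd agree_outside_refl algebra_simps)
  have total: "1 + (1 + (1 + (3 * n + 3 + (1 + (1 + (?L * (1 + (6 + 1) + 2) + 1)))))) \<le> N"
    using N n_pos by (simp add: algebra_simps)
  show ?thesis
    unfolding Init_def Read_Matrix_def
    apply (rule run_weaken)
     apply (rule run_Seq, rule run_Assign)
      apply (use V_const in simp)
     apply (rule run_Seq, rule run_Read)
      apply (rule b1)
     apply (rule run_Seq, rule run_Add)
      apply (use b1 in \<open>simp add: add.commute\<close>)
     apply (simp add: add.commute)
     apply (rule run_Seq, rule run_Mul[where N = "3 * n + 3"])
            apply (use b1 in \<open>simp_all add: add.commute\<close>)[7]
     apply (simp add: add.commute)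
     apply (rule run_Seq, rule run_Copy)
      apply simp
     apply (rule run_Seq, rule run_Assign)
      apply (use V_const in simp)
     apply (rule run_For_Down[where I = I, OF _ cnt body[unfolded One_nat_def] post order_refl])
       apply (use init in \<open>simp add: algebra_simps\<close>)
      apply assumption+
    using total by (simp_all add: algebra_simps)
qed

text \<open>The entries of \<open>b\<close> are repeated summands and never counters, so
  \<open>B\<close> restricts the register size through \<open>V\<close> without entering the number
  of instructions.\<close>

lemma run_Beta:
  assumes R: "ready R" and b: "\<And>j. j \<le> n \<Longrightarrow> \<bar>b j\<bar> \<le> B" and BV: "int (n + 1) * (int E * B) \<le> V"
    and N: "(n + 1) * (3 * E + 16) + 4 \<le> N"
    and Q: "\<And>R'. agree_outside ({6, 7, 8, 10, 11, 14, 15, 16, 32}) R R' \<Longrightarrow>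
      R' 32 = (\<Sum>j\<le>n. b j * lam j) \<Longrightarrow> Q R' rest out"
  shows "run V Beta N R (map b [0..<n + 1] @ rest) out Q"
proof -
  let ?T = "{6, 7, 8, 10, 11, 14, 15, 16, 32} :: nat set"
  define I where "I k R' i' o' \<longleftrightarrow> k \<le> n + 1 \<and> agree_outside ?T R R' \<and> R' 11 = int k \<and>
    R' 10 = int (n + 1 - k) \<and> R' 32 = (\<Sum>j<n + 1 - k. b j * lam j) \<and>
    i' = map b [n + 1 - k..<n + 1] @ rest \<and> o' = out"
    for k R' and i' o' :: "int list"
  have summand: "\<bar>b j * lam j\<bar> \<le> int E * B" "0 \<le> B" if "j \<le> n" for j
  proof -
    show "0 \<le> B" using b[OF that] by linarith
    have "\<bar>b j * lam j\<bar> \<le> B * int E"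
      unfolding abs_mult using b[OF that] lam_pos[OF that] lam_le[OF that] \<open>0 \<le> B\<close>
      by (intro mult_mono) auto
    then show "\<bar>b j * lam j\<bar> \<le> int E * B" by (simp add: mult.commute)
  qed
  have B0: "0 \<le> B" using summand(2)[of 0] by simp
  have sumV: "\<bar>\<Sum>j<l. b j * lam j\<bar> \<le> V" if "l \<le> n + 1" for l
  proof -
    have "\<bar>\<Sum>j<l. b j * lam j\<bar> \<le> (\<Sum>j<l. \<bar>b j * lam j\<bar>)" by (rule sum_abs)
    also have "\<dots> \<le> of_nat (card {..<l}) * (int E * B)"
      by (rule sum_bounded_above) (use summand that in auto)
    also have "\<dots> \<le> int (n + 1) * (int E * B)" using that B0 by (intro mult_right_mono) auto
    finally show ?thesis using BV by linarith
  qed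
  have EB: "int E * B \<le> V"
  proof -
    have "1 * (int E * B) \<le> int (n + 1) * (int E * B)" using B0 by (intro mult_right_mono) auto
    then show ?thesis using BV by linarith
  qed
  have BV': "B \<le> V"
  proof -
    have "1 * B \<le> int E * B" using B0 E_ge by (intro mult_right_mono) auto
    then show ?thesis using EB by linarith
  qed
  have body: "run V (Seq (Read 14) (Seq (Array_Load 16 0 10) (Seq (Mul 15 14 16) (Seq (Add 32 32 15) (Add 10 10 1)))))
      (1 + (6 + ((3 * E + 3) + (1 + 1)))) (R'(11 := int k)) i' o' (I k)"
    if k: "k < n + 1" and I: "I (Suc k) R' i' o'" for k R' i' o'
  proof -
    define e where "e = n + 1 - Suc k"
    have e: "e \<le> n" "n + 1 - k = Suc e" using k by (auto simp: e_def)
    have ag: "agree_outside ?T R R'" and r: "R' 10 = int e" "R' 32 = (\<Sum>j<e. b j * lam j)"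
      and io: "i' = map b [e..<n + 1] @ rest" "o' = out"
      using I unfolding I_def e_def by blast+
    have "[e..<n + 1] = e # [Suc e..<n + 1]" by (rule upt_conv_Cons) (use e in simp)
    then have i'0: "i' = b e # map b [Suc e..<n + 1] @ rest" unfolding io by (simp only: list.map append_Cons)
    define L where "L = map b [Suc e..<n + 1] @ rest"
    have i': "i' = b e # L" unfolding i'0 L_def ..
    have ready': "ready R'" by (rule ready_agree[OF R ag]) (auto simp: cell_simps)
    note Rs = readyD[OF ready'] r
    have le: "1 \<le> lam e" "lam e \<le> int E" using lam_pos lam_le e by auto
    have bV: "\<bar>b e\<bar> \<le> V" using b[OF e(1)] BV' by linarith
    have blV: "\<bar>b e * lam e\<bar> \<le> V" using summand(1)[OF e(1)] EB by linarith
    have sV: "\<bar>(\<Sum>j<e. b j * lam j) + b e * lam e\<bar> \<le> V" using sumV[of "Suc e"] e by simp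
    have eV: "8 * int e + 48 \<le> V" by (rule V_index[OF e(1)])
    have e1V: "\<bar>int e + 1\<bar> \<le> V" using eV by linarith
    have fin: "I k (R'(11 := int k, 14 := b e, 6 := v, 7 := w, 16 := lam e, 8 := 0, 15 := b e * lam e,
       32 := (\<Sum>j<e. b j * lam j) + b e * lam e, 10 := int e + 1)) L o'" for v w
      unfolding I_def using k ag r io e by (simp add: agree_outside_upd L_def)
    show ?thesis
      unfolding i'
      apply (rule run_weaken)
       apply (rule run_Seq, rule run_Read)
        apply (rule bV)
       apply (rule run_Seq, rule run_Array_Load)
           apply (use eV in \<open>simp_all add: Rs\<close>)[4]
       apply (simp add: Rs e cell_simps)
       apply (rule run_Seq, rule run_Mul[where N = "3 * E + 3"])
              apply (use le blV in \<open>simp_all add: Rs\<close>)[7]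
       apply (simp add: Rs)
       apply (rule run_Seq, rule run_Add)
        apply (use sV in \<open>simp add: Rs\<close>)
       apply (simp add: Rs)
       apply (rule run_Add)
        apply (use e1V in \<open>simp add: Rs\<close>)
       apply (use fin in \<open>simp add: Rs\<close>)
      apply simp
      done
  qed
  have cnt: "R' 11 = int k \<and> R' 1 = 1" if I: "I k R' i' o'" for k R' i' o'
  proof -
    have ag: "agree_outside ?T R R'" using I by (simp add: I_def)
    then show ?thesis using I agree_outsideD[OF ag, of 1] readyD(2)[OF R] by (simp add: I_def)
  qed
  have post: "Q R' i' o'" if "I 0 R' i' o'" for R' i' o'
    using that Q by (simp add: I_def lessThan_Suc_atMost)
  have init: "I (n + 1) (R(32 := 0, 11 := int n + 1, 10 := 0)) (map b [0..<n + 1] @ rest) out"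
    unfolding I_def by (simp add: agree_outside_upd agree_outside_refl)
  have total: "1 + (1 + (1 + ((n + 1) * (1 + (6 + ((3 * E + 3) + (1 + 1))) + 2) + 1))) \<le> N"
    using N by (simp add: algebra_simps)
  show ?thesis
    unfolding Beta_def
    apply (rule run_weaken[OF _ total])
    apply (rule run_Seq, rule run_Assign)
     apply (use V_const in simp)
    apply (rule run_Seq, rule run_Copy)
     apply (simp add: readyD[OF R])
    apply (rule run_Seq, rule run_Assign)
     apply (use V_const in simp)
    apply (rule run_For_Down[where I = I, OF _ cnt body post order_refl])
      apply (use init in \<open>simp add: readyD[OF R]\<close>)
     apply assumption+
    done
qed

lemma run_Output:
  assumes R: "ready R" "R 32 = be" "R 26 = P" "R 27 = Z" "R 29 = M" "\<And>j. j \<le> n \<Longrightarrow> R (cell 3 j) = X j"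
    and X: "\<And>j. j \<le> n \<Longrightarrow> 0 \<le> X j \<and> X j \<le> int (E ^ 2)"
    and P: "0 \<le> P" "P \<le> int E ^ 2" and M: "1 \<le> M" and PV: "\<bar>be * P\<bar> \<le> V"
    and N: "200 * ((n + 1) ^ 3 * E ^ 3) \<le> N"
    and Q: "\<And>R'. Q R' inp (out @ [be * P, Z] @ map (\<lambda>k. (\<Sum>j\<le>n. h j k * X j) div M) [0..<n])"
  shows "run V Output N R inp out Q"
proof -
  let ?T = "{6..16} \<union> {33}"
  let ?c = "\<lambda>k. (\<Sum>j\<le>n. h j k * X j) div M"
  define I where "I k R' i' o' \<longleftrightarrow> k \<le> n \<and> agree_outside ?T R R' \<and> R' 33 = int k \<and>
    R' 10 = int (n - k) \<and> i' = inp \<and> o' = out @ [be * P, Z] @ map ?c [0..<n - k]"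
    for k R' and i' o' :: "int list"
  let ?d = "(n + 1) * (3 * E ^ 2 + 19) + 4"
  let ?q = "4 * ((n + 1) ^ 2 * E ^ 3) + 9"
  have body: "run V (Seq (Dot_Col 3) (Seq (Div_Mod 14 12 29) (Seq (Print 14) (Add 10 10 1))))
      (?d + (?q + (1 + 1))) (R'(33 := int k)) i' o' (I k)"
    if k: "k < n" and I: "I (Suc k) R' i' o'" for k R' i' o'
  proof -
    define e where "e = n - Suc k"
    have e: "e < n" "n - k = Suc e" using k by (auto simp: e_def)
    have ag: "agree_outside ?T R R'" and r: "R' 10 = int e"
      and io: "i' = inp" "o' = out @ [be * P, Z] @ map ?c [0..<e]"
      using I unfolding I_def e_def by blast+
    have ready': "ready R'" by (rule ready_agree[OF R(1) ag]) (auto simp: cell_simps)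
    let ?u = "\<Sum>j\<le>n. h j e * X j"
    have u: "\<bar>?u\<bar> \<le> int ((n + 1) ^ 2 * E ^ 3)"
    proof -
      have "\<bar>?u\<bar> \<le> int (n + 1) * (int (n * E) * int (E ^ 2))"
        using dot_partial_bound(1)[where X = X and B = "E ^ 2" and k = e and m = 0] X e by (simp add: atMost_atLeast0)
      also have "\<dots> = int ((n + 1) * n * E ^ 3)" by (simp add: power2_eq_square power3_eq_cube algebra_simps)
      also have "\<dots> \<le> int ((n + 1) ^ 2 * E ^ 3)"
        unfolding of_nat_le_iff power2_eq_square by (intro mult_mono) auto
      finally show ?thesis .
    qed
    have q: "4 * nat \<bar>?u div M\<bar> + 9 \<le> ?q"
    proof -
      have "\<bar>?u div M\<bar> \<le> int ((n + 1) ^ 2 * E ^ 3)" using abs_zdiv_le_abs[of M ?u] M u by linarith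
      then show ?thesis by linarith
    qed
    have e1V: "\<bar>int e + 1\<bar> \<le> V" using V_index[of e] e by linarith
    have rest: "run V (Seq (Div_Mod 14 12 29) (Seq (Print 14) (Add 10 10 1))) (?q + (1 + 1)) R1 i' o' (I k)"
      if a1: "agree_outside {6, 7, 8, 11, 12, 13, 14, 15, 16} (R'(33 := int k)) R1" and r1: "R1 12 = ?u" for R1
    proof -
      have ag1: "agree_outside ?T R R1"
        by (rule agree_outside_trans[OF agree_outside_upd[OF ag] a1]) auto
      have ready1: "ready R1" by (rule ready_agree[OF R(1) ag1]) (auto simp: cell_simps)
      have R1: "R1 29 = M" "R1 10 = int e" "R1 33 = int k"
        using agree_outsideD[OF ag1, of 29] agree_outsideD[OF a1] R(5) r by simp_all
      have fin: "I k (R1(14 := ?u div M, 12 := ?u mod M, 9 := v, 10 := int e + 1)) i' (o' @ [?u div M])" for v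
        unfolding I_def using k io e R1 ag1 by (simp add: agree_outside_upd)
      show ?thesis
        apply (rule run_Seq, rule run_Div_Mod)
                apply (use M q in \<open>simp_all add: readyD[OF ready1] R1 r1\<close>)[7]
        apply (simp add: R1 r1)
        apply (rule run_weaken[where N = "1 + 1"])
         apply (rule run_Seq, rule run_Print)
         apply (rule run_Add)
          apply (use e1V in \<open>simp add: readyD[OF ready1] R1\<close>)
         apply (use fin in \<open>simp add: readyD[OF ready1] R1\<close>)
        apply simp
        done
    qed
    show ?thesis
    proof (rule run_Seq, rule run_Dot_Col[where k = e and X = X and B = "E ^ 2", OF _ _ e(1)])
      show "loaded (R'(33 := int k))" using ready' by (simp add: ready_def loaded_upd)
      show "(R'(33 := int k)) 10 = int e" using r by simp
      show "(R'(33 := int k)) (cell 3 j) = X j" if "j \<le> n" for j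
        using R(6)[OF that] agree_outsideD[OF ag, of "cell 3 j"] by (simp add: cell_simps)
      show "int (n + 1) * (int (n * E) * int (E ^ 2)) \<le> V" by (rule V_dot) simp
    qed (use X rest in auto)
  qed
  have cnt: "R' 33 = int k \<and> R' 1 = 1" if I: "I k R' i' o'" for k R' i' o'
  proof -
    have ag: "agree_outside ?T R R'" using I by (simp add: I_def)
    then show ?thesis using I agree_outsideD[OF ag, of 1] readyD(2)[OF R(1)] by (simp add: I_def)
  qed
  have post: "Q R' i' o'" if "I 0 R' i' o'" for R' i' o'
    using that Q by (simp add: I_def)
  have init: "I n (R(8 := 0, 14 := be * P, 33 := int n, 10 := 0)) inp (out @ [be * P, Z])"
    unfolding I_def by (simp add: agree_outside_upd agree_outside_refl)
  have PE: "3 * nat P + 3 \<le> 3 * E ^ 2 + 3" using P by (simp add: nat_le_iff)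
  have total: "(3 * E ^ 2 + 3) + (1 + (1 + (1 + (1 + (n * (?d + (?q + (1 + 1)) + 2) + 1))))) \<le> N"
  proof -
    define x L where "x = n + 1" and "L = x ^ 3 * E ^ 3"
    have mono: "x ^ i * E ^ j \<le> L" if "i \<le> 3" "j \<le> 3" for i j
      unfolding L_def x_def using that E_ge by (intro mult_mono power_increasing) auto
    have m: "1 \<le> L" "E ^ 2 \<le> L" "x \<le> L" "x * x \<le> L" "x * (x * (E * E)) \<le> L"
        "x * (x * (x * (E * (E * E)))) \<le> L"
      using mono[of 0 0] mono[of 0 2] mono[of 1 0] mono[of 2 0] mono[of 2 2] mono[of 3 3]
      by (simp_all add: power_numeral_reduce mult_ac)
    define z where "z = n * (?d + (?q + (1 + 1)) + 2)"
    have "z \<le> x * (?d + (?q + (1 + 1)) + 2)" unfolding z_def x_def by (intro mult_right_mono) auto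
    also have "\<dots> = 3 * (x * (x * (E * E))) + 19 * (x * x) + 4 * (x * (x * (x * (E * (E * E))))) + 17 * x"
      unfolding x_def[symmetric] by (simp add: power_numeral_reduce algebra_simps)
    also have "\<dots> \<le> 3 * L + 19 * L + 4 * L + 17 * L"
      by (intro add_mono mult_left_mono m) auto
    finally have "z \<le> 43 * L" by simp
    then have "(3 * E ^ 2 + 3) + (1 + (1 + (1 + (1 + (z + 1))))) \<le> 200 * L" using m(1,2) by linarith
    then show ?thesis using N unfolding z_def L_def x_def by linarith
  qed
  show ?thesis
    unfolding Output_def
    apply (rule run_weaken)
     apply (rule run_Seq, rule run_Mul[where N = "3 * E ^ 2 + 3"])
            apply (use P PV PE in \<open>simp_all add: readyD[OF R(1)] R\<close>)[7]
     apply (rule run_Seq, rule run_Print)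
     apply (rule run_Seq, rule run_Print)
     apply (rule run_Seq, rule run_Copy)
      apply (simp add: readyD[OF R(1)])
     apply (rule run_Seq, rule run_Assign)
      apply (use V_const in simp)
     apply (rule run_For_Down[where I = I, OF _ cnt body post order_refl])
       apply (use init in \<open>simp add: readyD[OF R(1)] R\<close>)
      apply assumption+
    apply (rule total)
    done
qed

text \<open>The condition on \<open>V\<close> concerns the printed numerator: the weighted sum of
  \<open>b\<close> is at most \<open>(n + 1) * E * B\<close> in absolute value, and its factor
  \<open>P\<close> is at most \<open>E ^ 2\<close>.\<close>

lemma run_Width_Program:
  assumes b: "\<And>j. j \<le> n \<Longrightarrow> \<bar>b j\<bar> \<le> B" and BV: "int (n + 1) * (int E ^ 3 * B) \<le> V"
  obtains t R P Z M X where
    "exec Width_Program (\<lambda>_. 0, int n # map (\<lambda>e. h (e div n) (e mod n)) [0..<n * (n + 1)] @ map b [0..<n + 1], [])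
       t (R, [], [(\<Sum>j\<le>n. b j * lam j) * P, Z] @ map (\<lambda>k. (\<Sum>j\<le>n. h j k * X j) div M) [0..<n])"
    "t \<le> 3000 * ((n + 1) ^ 3 * E ^ 4) * (3 * bit_size V)"
    "1 \<le> P" "good P Z M X"
    "\<And>a i m. int a < lam n \<Longrightarrow> i \<le> n \<Longrightarrow> int m < lam i \<Longrightarrow>
       \<exists>k\<le>n. P * (lam n * lam i * lam k) \<le> cand a i m k * Z"
proof -
  let ?inp = "int n # map (\<lambda>e. h (e div n) (e mod n)) [0..<n * (n + 1)] @ map b [0..<n + 1]"
  let ?be = "\<Sum>j\<le>n. b j * lam j"
  define Q where "Q R i' o' \<longleftrightarrow> i' = [] \<and> (\<exists>P Z M X.
     o' = [?be * P, Z] @ map (\<lambda>k. (\<Sum>j\<le>n. h j k * X j) div M) [0..<n] \<and> best_among triples P Z M X)"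
    for R :: "reg \<Rightarrow> int" and i' o' :: "int list"
  have B0: "0 \<le> B" using b[of 0] by simp
  have E1: "1 \<le> int E" using E_ge by simp
  have "int E * B \<le> int E ^ 3 * B" using power_increasing[of 1 3 "int E"] E1 B0 by (intro mult_right_mono) auto
  then have "int (n + 1) * (int E * B) \<le> int (n + 1) * (int E ^ 3 * B)" by (intro mult_left_mono) auto
  then have BV1: "int (n + 1) * (int E * B) \<le> V" using BV by linarith
  have beB: "\<bar>?be\<bar> \<le> int (n + 1) * (int E * B)"
  proof -
    have "\<bar>?be\<bar> \<le> (\<Sum>j\<le>n. \<bar>b j * lam j\<bar>)" by (rule sum_abs)
    also have "\<dots> \<le> of_nat (card {..n}) * (int E * B)"
    proof (rule sum_bounded_above)
      fix j assume "j \<in> {..n}"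
      then have "\<bar>b j\<bar> * \<bar>lam j\<bar> \<le> B * int E" using b[of j] lam_pos[of j] lam_le[of j] B0 by (intro mult_mono) auto
      then show "\<bar>b j * lam j\<bar> \<le> int E * B" by (simp add: abs_mult mult.commute)
    qed
    finally show ?thesis by simp
  qed
  let ?NI = "20 * ((n + 1) * (n + 1))" and ?ND = "n * (3 * n + 3 * E + 16) + 3"
    and ?NL = "n * ((n + 1) * (3 * E + 19) + 3 * n + 4 * E + 32) + 8"
    and ?NS = "1000 * ((n + 1) ^ 3 * E ^ 4)" and ?NB = "(n + 1) * (3 * E + 16) + 4"
    and ?NO = "200 * ((n + 1) ^ 3 * E ^ 3)"
  have finish: "run V (Seq Beta Output) (?NB + ?NO) R4 (map b [0..<n + 1]) [] Q"
    if ready: "ready R4" and hb: "holds_best triples R4" for R4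
  proof -
    obtain X where X: "best_among triples (R4 26) (R4 27) (R4 29) X" "\<And>j. j \<le> n \<Longrightarrow> R4 (cell 3 j) = X j"
      using hb by (auto simp: holds_best_def)
    have P: "1 \<le> R4 26" "R4 26 \<le> int E ^ 2" and Z: "R4 27 = 0 \<or> good (R4 26) (R4 27) (R4 29) X"
      using X(1) by (auto simp: best_among_def)
    have ln: "1 \<le> lam n" "1 \<le> lam 0" using lam_pos by auto
    \<comment> \<open>There is at least one candidate, so the final denominator is not the initial
      0.\<close>
    then have "(0, 0, 0) \<in> triples" by (simp add: triples_def)
    then obtain k where k: "k \<le> n" "R4 26 * (lam n * lam 0 * lam k) \<le> cand 0 0 0 k * R4 27"
      using X(1) unfolding best_among_def by blast
    have "0 < R4 26 * (lam n * lam 0 * lam k)" using P ln lam_pos[OF k(1)] by simp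
    then have "R4 27 \<noteq> 0" using k(2) by auto
    then have good: "good (R4 26) (R4 27) (R4 29) X" using Z by simp
    then have M: "1 \<le> R4 29" "R4 29 \<le> int E ^ 2" and Xb: "\<And>j. j \<le> n \<Longrightarrow> 0 \<le> X j \<and> X j \<le> R4 29"
      by (auto simp: good_def)
    have Xb': "0 \<le> X j \<and> X j \<le> int (E ^ 2)" if "j \<le> n" for j
      using Xb[OF that] M by simp
    have PV: "\<bar>?be * R4 26\<bar> \<le> V"
    proof -
      have "\<bar>?be\<bar> * \<bar>R4 26\<bar> \<le> (int (n + 1) * (int E * B)) * int E ^ 2"
        using beB P B0 by (intro mult_mono) auto
      also have "\<dots> = int (n + 1) * (int E ^ 3 * B)" by (simp add: power2_eq_square power3_eq_cube)
      finally show ?thesis using BV by (simp add: abs_mult)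
    qed
    have "run V Beta ?NB R4 (map b [0..<n + 1] @ []) [] (\<lambda>R i' o'. run V Output ?NO R i' o' Q)"
    proof (rule run_Beta[OF ready b BV1 order_refl])
      fix R5 assume a: "agree_outside {6, 7, 8, 10, 11, 14, 15, 16, 32} R4 R5" and be: "R5 32 = ?be"
      note R5 = agree_outsideD[OF a]
      show "run V Output ?NO R5 [] [] Q"
      proof (rule run_Output[where X = X and M = "R4 29" and P = "R4 26" and Z = "R4 27"])
        show "ready R5" by (rule ready_agree[OF ready a]) (auto simp: cell_simps)
        show "R5 (cell 3 j) = X j" if "j \<le> n" for j using X(2)[OF that] R5 by (simp add: cell_simps)
        show "\<bar>?be * R4 26\<bar> \<le> V" by (rule PV)
        show "Q R' [] ([] @ [?be * R4 26, R4 27] @ map (\<lambda>k. (\<Sum>j\<le>n. h j k * X j) div R4 29) [0..<n])" for R'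
          unfolding Q_def using X(1) by auto
      qed (use be R5 Xb' P M in auto)
    qed
    then show ?thesis by (intro run_Seq) simp
  qed
  have run: "run V Width_Program (?NI + (?ND + (?NL + (?NS + (?NB + ?NO))))) (\<lambda>_. 0) ?inp [] Q"
    unfolding Width_Program_def
  proof (rule run_Seq, rule run_Init[OF order_refl])
    fix R1 assume a1: "agree_outside ({1, 2, 3, 4, 6, 7, 8, 10, 11, 14} \<union> range (cell 4)) (\<lambda>_. 0) R1"
      and l1: "loaded R1"
    show "run V (Seq Det (Seq Lambda (Seq Search (Seq Beta Output)))) (?ND + (?NL + (?NS + (?NB + ?NO))))
      R1 (map b [0..<n + 1]) [] Q"
    proof (rule run_Seq, rule run_Det[OF l1 order_refl])
      fix R2 assume a2: "agree_outside {5, 6, 7, 8, 10, 14, 15, 16} R1 R2" and d: "R2 5 = lam n"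
      have l2: "loaded R2" by (rule loaded_agree[OF l1 a2]) (auto simp: cell_simps)
      have z2: "R2 (cell 0 j) = 0" for j
        using agree_outsideD[OF a2, of "cell 0 j"] agree_outsideD[OF a1, of "cell 0 j"] by (simp add: cell_simps)
      show "run V (Seq Lambda (Seq Search (Seq Beta Output))) (?NL + (?NS + (?NB + ?NO)))
        R2 (map b [0..<n + 1]) [] Q"
      proof (rule run_Seq, rule run_Lambda[OF l2 d z2 order_refl])
        fix R3 assume a3: "agree_outside ({6..16} \<union> range (cell 0)) R2 R3"
          and lm: "\<And>j. j \<le> n \<Longrightarrow> R3 (cell 0 j) = lam j"
        have l3: "loaded R3" by (rule loaded_agree[OF l2 a3]) (auto simp: cell_simps)
        have r3: "ready R3"
          using l3 lm d agree_outsideD[OF a3, of 5] by (simp add: ready_def cell_simps)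
        have z3: "R3 27 = 0"
          using agree_outsideD[OF a3, of 27] agree_outsideD[OF a2, of 27] agree_outsideD[OF a1, of 27]
          by (simp add: cell_simps)
        show "run V (Seq Search (Seq Beta Output)) (?NS + (?NB + ?NO)) R3 (map b [0..<n + 1]) [] Q"
        proof (rule run_Seq, rule run_Search[OF r3 z3 order_refl])
          fix R4 assume a4: "agree_outside ({6..18} \<union> {20..31} \<union> range (cell 5) \<union> range (cell 2) \<union> range (cell 3)) R3 R4"
            and hb: "holds_best triples R4"
          have "ready R4" by (rule ready_agree[OF r3 a4]) (auto simp: cell_simps)
          then show "run V (Seq Beta Output) (?NB + ?NO) R4 (map b [0..<n + 1]) [] Q"
            using hb by (rule finish)
        qed
      qed
    qed
  qed
  have total: "?NI + (?ND + (?NL + (?NS + (?NB + ?NO)))) \<le> 3000 * ((n + 1) ^ 3 * E ^ 4)"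
  proof -
    define x L where "x = n + 1" and "L = x ^ 3 * E ^ 4"
    have mono: "x ^ i * E ^ j \<le> L" if "i \<le> 3" "j \<le> 4" for i j
      unfolding L_def x_def using that E_ge by (intro mult_mono power_increasing) auto
    have m: "1 \<le> L" "x \<le> L" "x * x \<le> L" "x * E \<le> L" "x * (x * E) \<le> L" "x ^ 3 * E ^ 3 \<le> L"
      using mono[of 0 0] mono[of 1 0] mono[of 2 0] mono[of 1 1] mono[of 2 1] mono[of 3 3]
      by (simp_all add: power_numeral_reduce mult_ac)
    have "?ND \<le> x * (3 * x + 3 * E + 16) + 3" unfolding x_def by (intro add_mono mult_mono) auto
    also have "\<dots> = 3 * (x * x) + 3 * (x * E) + 16 * x + 3" by (simp add: algebra_simps)
    finally have D: "?ND \<le> 25 * L" using m by linarith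
    have "?NL \<le> x * (x * (3 * E + 19) + 3 * x + 4 * E + 32) + 8" unfolding x_def by (intro add_mono mult_mono) auto
    also have "\<dots> = 3 * (x * (x * E)) + 22 * (x * x) + 4 * (x * E) + 32 * x + 8" by (simp add: algebra_simps)
    finally have Lm: "?NL \<le> 69 * L" using m by linarith
    have "?NB = 3 * (x * E) + 16 * x + 4" unfolding x_def by (simp add: algebra_simps)
    then have Bt: "?NB \<le> 23 * L" using m by linarith
    have I: "?NI \<le> 20 * L" using m unfolding x_def by simp
    have O: "?NO \<le> 200 * L" using m unfolding x_def by simp
    have S: "?NS = 1000 * L" unfolding L_def x_def by simp
    show ?thesis using D Lm Bt I O S unfolding L_def x_def by linarith
  qed
  have "bounded_by V (\<lambda>_. 0)" using V_const by (simp add: bounded_by_def)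
  then obtain t R i' o' where ex: "exec Width_Program (\<lambda>_. 0, ?inp, []) t (R, i', o')"
    and t: "t \<le> (?NI + (?ND + (?NL + (?NS + (?NB + ?NO))))) * (3 * bit_size V)" and Q: "Q R i' o'"
    using run unfolding run_def by blast
  obtain P Z M X where i': "i' = []" and o': "o' = [?be * P, Z] @ map (\<lambda>k. (\<Sum>j\<le>n. h j k * X j) div M) [0..<n]"
    and best: "best_among triples P Z M X" using Q by (auto simp: Q_def)
  have P: "1 \<le> P" using best by (simp add: best_among_def)
  have low: "\<exists>k\<le>n. P * (lam n * lam i * lam k) \<le> cand a i m k * Z"
    if "int a < lam n" "i \<le> n" "int m < lam i" for a i m
    using best that by (simp add: best_among_def triples_def)
  have good: "good P Z M X"
  proof -
    have ln: "1 \<le> lam n" "1 \<le> lam 0" using lam_pos by auto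
    then obtain k where k: "k \<le> n" "P * (lam n * lam 0 * lam k) \<le> cand 0 0 0 k * Z"
      using low[of 0 0 0] by auto
    have "0 < P * (lam n * lam 0 * lam k)" using P ln lam_pos[OF k(1)] by simp
    then have "Z \<noteq> 0" using k(2) by auto
    then show ?thesis using best by (simp add: best_among_def)
  qed
  show thesis
  proof (rule that[OF _ _ P good low])
    show "exec Width_Program (\<lambda>_. 0, ?inp, []) t
       (R, [], [?be * P, Z] @ map (\<lambda>k. (\<Sum>j\<le>n. h j k * X j) div M) [0..<n])"
      using ex unfolding i' o' .
    show "t \<le> 3000 * ((n + 1) ^ 3 * E ^ 4) * (3 * bit_size V)"
      using t total by (meson le_trans mult_le_mono1)
  qed
qed

end

section \<open>The width of a simplex\<close>

lemma triangular_solvable: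
  fixes h :: "nat \<Rightarrow> nat \<Rightarrow> real"
  assumes "\<And>i k. i < n \<Longrightarrow> k < n \<Longrightarrow> i < k \<Longrightarrow> h i k = 0" "\<And>k. k < n \<Longrightarrow> h k k \<noteq> 0"
  shows "\<exists>x. \<forall>j<n. (\<Sum>k<n. h j k * x k) = s j"
proof -
  have "m \<le> n \<Longrightarrow> \<exists>x. \<forall>j<m. (\<Sum>k<m. h j k * x k) = s j" for m
  proof (induction m)
    case (Suc m)
    then obtain x where x: "\<And>j. j < m \<Longrightarrow> (\<Sum>k<m. h j k * x k) = s j" by auto
    define y where "y = x(m := (s m - (\<Sum>k<m. h m k * x k)) / h m m)"
    have "(\<Sum>k<m. h j k * y k) = (\<Sum>k<m. h j k * x k)" for j
      by (rule sum.cong) (auto simp: y_def)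
    then have "(\<Sum>k<Suc m. h j k * y k) = s j" if "j < Suc m" for j
      using that x[of j] assms(1)[of j m] assms(2)[of m] Suc.prems
      by (cases "j = m") (auto simp: y_def)
    then show ?case by blast
  qed simp
  then show ?thesis by blast
qed

lemma triangular_injective:
  fixes h :: "nat \<Rightarrow> nat \<Rightarrow> real"
  assumes "\<And>i k. i < n \<Longrightarrow> k < n \<Longrightarrow> i < k \<Longrightarrow> h i k = 0" "\<And>k. k < n \<Longrightarrow> h k k \<noteq> 0"
    and "\<And>j. j < n \<Longrightarrow> (\<Sum>k<n. h j k * z k) = 0" and "k < n"
  shows "z k = 0"
  using assms(4)
proof (induction k rule: less_induct)
  case (less k)
  have "(\<Sum>l<n. h k l * z l) = (\<Sum>l<n. if l = k then h k k * z k else 0)"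
    by (rule sum.cong) (use less assms(1)[OF less.prems] in \<open>auto simp: neq_iff\<close>)
  then show ?case using assms(2)[of k] assms(3)[of k] less.prems by simp
qed

definition halfspaces :: "nat \<Rightarrow> (nat \<Rightarrow> nat \<Rightarrow> int) \<Rightarrow> (nat \<Rightarrow> int) \<Rightarrow> real vec set" where
  "halfspaces n h b = {x \<in> carrier_vec n. \<forall>j\<le>n. (\<Sum>k<n. real_of_int (h j k) * x $ k) \<le> real_of_int (b j)}"

context simplex_matrix begin

text \<open>Subtracting the multiple of \<open>lam\<close> that kills entry \<open>n\<close> leaves
  a relation whose other entries vanish one by one from \<open>n - 1\<close> downwards, each by its
  own column. So the real relations between the rows form the line spanned by
  \<open>lam\<close>.\<close>

lemma real_kernel:
  fixes z :: "nat \<Rightarrow> real"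
  assumes "\<And>k. k < n \<Longrightarrow> (\<Sum>j\<le>n. h j k * z j) = 0" "j \<le> n"
  shows "z j = z n / lam n * lam j"
proof -
  define y where "y j = z j - z n / lam n * lam j" for j
  have yn: "y n = 0" using lam_pos[of n] by (simp add: y_def)
  have ys: "(\<Sum>j\<le>n. h j k * y j) = 0" if "k < n" for k
  proof -
    have "(\<Sum>j\<le>n. h j k * y j) = (\<Sum>j\<le>n. h j k * z j) - z n / lam n * real_of_int (\<Sum>j\<le>n. h j k * lam j)"
      by (simp add: y_def sum_subtractf sum_distrib_left algebra_simps)
    then show ?thesis using assms(1)[OF that] lam_kernel[OF that] by simp
  qed
  have "l \<le> n \<Longrightarrow> y (n - l) = 0" for l
  proof (induction l rule: less_induct)
    case (less l)
    show ?case
    proof (cases "l = 0")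
      case False
      define k where "k = n - l"
      have k: "k < n" using less.prems False by (auto simp: k_def)
      have above: "y j = 0" if "k < j" "j \<le> n" for j
        using less.IH[of "n - j"] that less.prems by (auto simp: k_def)
      have "(\<Sum>j\<le>n. h j k * y j) = (\<Sum>j\<le>n. if j = k then h k k * y k else 0)"
      proof (rule sum.cong)
        fix j assume "j \<in> {..n}"
        then show "h j k * y j = (if j = k then h k k * y k else 0)"
          using above[of j] upper_zero[of j k] k by (cases j k rule: linorder_cases) auto
      qed simp
      then have "h k k * y k = 0" using ys[OF k] k by simp
      then show ?thesis using diag_pos[OF k] by (simp add: k_def)
    qed (use yn in simp)
  qed
  from this[of "n - j"] assms(2) have "y j = 0" by simp
  then show ?thesis by (simp add: y_def)
qed

lemma lam_rows_sum:
  fixes x :: "nat \<Rightarrow> real"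
  shows "(\<Sum>j\<le>n. lam j * (\<Sum>k<n. h j k * x k)) = 0"
proof -
  have "(\<Sum>j\<le>n. lam j * (\<Sum>k<n. h j k * x k)) = (\<Sum>k<n. real_of_int (\<Sum>j\<le>n. h j k * lam j) * x k)"
    unfolding of_int_sum sum_distrib_left sum_distrib_right
    by (subst sum.swap) (simp add: mult_ac)
  then show ?thesis using lam_kernel by simp
qed

text \<open>\<open>tau_surj\<close> supplies some real coefficients, which may be shifted by
  multiples of \<open>lam\<close>. Shifting by the least ratio \<open>t0 i / lam i\<close> makes
  entry \<open>i\<close> vanish and leaves all others nonnegative.\<close>

lemma cone_representation:
  fixes c :: "nat \<Rightarrow> int"
  obtains t :: "nat \<Rightarrow> real" and i where "i \<le> n" "t i = 0" "\<And>j. j \<le> n \<Longrightarrow> 0 \<le> t j"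
    "\<And>k. k < n \<Longrightarrow> c k = (\<Sum>j\<le>n. h j k * t j)"
proof -
  obtain a w where w: "\<And>k. k < n \<Longrightarrow>
      lam n * c k = (\<Sum>j\<le>n. h j k * tau a j) + lam n * (\<Sum>j<n. h j k * w j)"
    using tau_surj[of c] by blast
  have ln: "1 \<le> lam n" using lam_pos by simp
  define t0 where "t0 j = real_of_int (tau a j) / lam n + (if j < n then w j else 0)" for j
  have t0: "c k = (\<Sum>j\<le>n. h j k * t0 j)" if "k < n" for k
  proof -
    have "(\<Sum>j\<le>n. real_of_int (h j k) * real_of_int (if j < n then w j else 0)) = (\<Sum>j<n. h j k * w j)"
      by (simp add: lessThan_Suc_atMost[symmetric])
    then have "lam n * (\<Sum>j\<le>n. h j k * t0 j) = real_of_int ((\<Sum>j\<le>n. h j k * tau a j) + lam n * (\<Sum>j<n. h j k * w j))"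
      using ln by (simp add: t0_def distrib_left sum.distrib sum_distrib_left[symmetric] sum_divide_distrib[symmetric])
    then have "lam n * (\<Sum>j\<le>n. h j k * t0 j) = real_of_int (lam n * c k)" unfolding w[OF that] .
    then show ?thesis using ln by simp
  qed
  let ?f = "\<lambda>j. t0 j / lam j"
  have "Min (?f ` {..n}) \<in> ?f ` {..n}" by (rule Min_in) auto
  then obtain i where fi: "Min (?f ` {..n}) = ?f i" and "i \<in> {..n}" by (rule imageE)
  then have i: "i \<le> n" by simp
  have min: "t0 i / lam i \<le> t0 j / lam j" if "j \<le> n" for j
    unfolding fi[symmetric] by (rule Min_le) (use that in auto)
  define t where "t j = t0 j - t0 i / lam i * lam j" for j
  show thesis
  proof (rule that[of i t])
    show "t i = 0" using lam_pos[OF i] by (simp add: t_def)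
    show "0 \<le> t j" if "j \<le> n" for j
    proof -
      have "t0 i / lam i * lam j \<le> t0 j / lam j * lam j"
        using min[OF that] lam_pos[OF that] by (intro mult_right_mono) auto
      then show ?thesis using lam_pos[OF that] by (simp add: t_def)
    qed
    show "c k = (\<Sum>j\<le>n. h j k * t j)" if "k < n" for k
    proof -
      have "(\<Sum>j\<le>n. h j k * t j) = (\<Sum>j\<le>n. h j k * t0 j) - t0 i / lam i * real_of_int (\<Sum>j\<le>n. h j k * lam j)"
        by (simp add: t_def sum_subtractf sum_distrib_left algebra_simps)
      then show ?thesis using t0[OF that] lam_kernel[OF that] by simp
    qed
  qed (rule i)
qed

text \<open>Consequently the triple \<open>(0, k, 0)\<close> has vanishing fractional parts and
  stands for the single row \<open>k\<close>.\<close>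

lemma tau_zero: "tau 0 j = 0"
proof -
  have "tau_state 0 s = (0, \<lambda>_. 0)" for s
    by (induction s) (simp_all add: tau_state.simps(2) fun_eq_iff)
  then show ?thesis by (simp add: tau_def)
qed

text \<open>Modulo integers there is only one choice of \<open>t\<close> for each coset of \<open>c\<close> and each integer
  \<open>m\<close>: the shift \<open>t + \<alpha> lam\<close> that makes the \<open>i\<close>-th entry vanish.\<close>

lemma candidate_below:
  fixes c :: "nat \<Rightarrow> int" and t :: "nat \<Rightarrow> real"
  assumes i: "i \<le> n" "t i = 0" and t: "\<And>j. j \<le> n \<Longrightarrow> 0 \<le> t j"
    and c: "\<And>k. k < n \<Longrightarrow> c k = (\<Sum>j\<le>n. h j k * t j)" and nz: "\<exists>k<n. c k \<noteq> 0"
    and PQ: "0 < P" "0 < Q"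
    and low: "\<And>a i m. int a < lam n \<Longrightarrow> i \<le> n \<Longrightarrow> int m < lam i \<Longrightarrow>
      \<exists>k\<le>n. P * (lam n * lam i * lam k) \<le> cand a i m k * Q"
  shows "\<exists>k\<le>n. P * lam k \<le> t k * Q"
proof -
  obtain a w where a: "int a < lam n" and w: "\<And>k. k < n \<Longrightarrow>
      lam n * c k = (\<Sum>j\<le>n. h j k * tau a j) + lam n * (\<Sum>j<n. h j k * w j)"
    using tau_surj[of c] by blast
  have ln: "1 \<le> lam n" and li: "1 \<le> lam i" using lam_pos i by auto
  define v where "v j = (if j < n then w j else 0)" for j
  have sumv: "(\<Sum>j\<le>n. h j k * v j) = (\<Sum>j<n. h j k * w j)" for k
    by (simp add: v_def lessThan_Suc_atMost[symmetric])
  \<comment> \<open>\<open>lam n\<close> times the difference between \<open>t\<close> and the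
    coefficients from \<open>tau_surj\<close>. Both represent \<open>c\<close>, so this is a
    relation between the rows and hence a multiple of \<open>lam\<close>.\<close>
  define z where "z j = lam n * t j - real_of_int (tau a j + lam n * v j)" for j
  have "(\<Sum>j\<le>n. h j k * z j) = 0" if "k < n" for k
  proof -
    have "(\<Sum>j\<le>n. h j k * z j) =
        lam n * (\<Sum>j\<le>n. h j k * t j) - real_of_int (\<Sum>j\<le>n. h j k * (tau a j + lam n * v j))"
      by (simp add: z_def sum_subtractf sum_distrib_left right_diff_distrib mult_ac)
    also have "(\<Sum>j\<le>n. h j k * (tau a j + lam n * v j)) = (\<Sum>j\<le>n. h j k * tau a j) + lam n * (\<Sum>j\<le>n. h j k * v j)"
      by (simp add: distrib_left sum.distrib sum_distrib_left mult_ac)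
    also have "\<dots> = lam n * c k" using w[OF that] sumv by simp
    finally show ?thesis using c[OF that] by simp
  qed
  then have zj: "z j = z n / lam n * lam j" if "j \<le> n" for j using real_kernel that by blast
  define g where "g = z n / lam n"
  have gi: "g * lam i = - real_of_int (tau a i + lam n * v i)"
    using zj[OF i(1)] i(2) by (simp add: z_def g_def)
  \<comment> \<open>Because \<open>t i = 0\<close>, the multiple of \<open>lam\<close> is determined
    by \<open>v i\<close>. The residue of \<open>- v i\<close> modulo \<open>lam i\<close> is the
    \<open>m\<close> of the triple, while the quotient \<open>q\<close> only changes the
    coefficients by integers.\<close>
  define q m where "q = (- v i) div lam i" and "m = nat ((- v i) mod lam i)"
  have m: "int m < lam i" "- v i = int m + lam i * q" using li by (simp_all add: m_def q_def)
  define T where "T j = (tau a j * lam i + (int m * lam n - tau a i) * lam j) + (lam n * lam i) * (v j + q * lam j)" for j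
  have T: "real_of_int (T j) = (lam n * lam i) * t j" if "j \<le> n" for j
  proof -
    have "lam n * t j = g * lam j + real_of_int (tau a j + lam n * v j)"
      using zj[OF that] by (simp add: z_def g_def)
    then have "(lam n * t j) * lam i = (g * lam i) * lam j + real_of_int (tau a j + lam n * v j) * lam i"
      by (simp add: algebra_simps)
    also have "\<dots> = real_of_int (- (tau a i + lam n * v i) * lam j + (tau a j + lam n * v j) * lam i)"
      unfolding gi by simp
    also have "- (tau a i + lam n * v i) * lam j + (tau a j + lam n * v j) * lam i =
        (- tau a i) * lam j + (- v i) * (lam n * lam j) + (tau a j + lam n * v j) * lam i"
      by (simp add: algebra_simps)
    also have "\<dots> = T j" unfolding m(2) T_def by (simp add: algebra_simps)
    finally show ?thesis by (simp add: mult_ac)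
  qed
  have M: "1 \<le> lam n * lam i" by (rule modulus_bounds(1)[OF i(1)])
  have frac: "cand_frac a i m j = T j mod (lam n * lam i)" for j
    by (simp add: cand_frac_def T_def)
  have T0: "0 \<le> T j" if "j \<le> n" for j
  proof -
    have "0 \<le> real_of_int (lam n * lam i)" by (subst of_int_0_le_iff) (use M in linarith)
    then have "0 \<le> real_of_int (lam n * lam i) * t j" using t[OF that] by (rule mult_nonneg_nonneg)
    then show ?thesis using T[OF that] by (metis of_int_0_le_iff of_int_mult)
  qed
  show ?thesis
  proof (cases "\<forall>j\<le>n. cand_frac a i m j = 0")
    case False
    obtain k where k: "k \<le> n" "P * (lam n * lam i * lam k) \<le> cand a i m k * Q"
      using low[OF a i(1) m(1)] by blast
    have "cand a i m k = cand_frac a i m k" unfolding cand_def using False by (rule if_not_P)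
    also have "\<dots> \<le> T k" unfolding frac using T0[OF k(1)] M by (intro zmod_le_nonneg_dividend)
    finally have "cand a i m k * Q \<le> T k * Q" using PQ by (intro mult_right_mono) auto
    then have "real_of_int (P * (lam n * lam i * lam k)) \<le> real_of_int (T k * Q)"
      using k(2) by linarith
    then have "(lam n * lam i) * (P * lam k) \<le> (real_of_int (lam n * lam i)) * (t k * Q)"
      using T[OF k(1)] by (simp add: mult_ac)
    moreover have "0 < real_of_int (lam n) * real_of_int (lam i)" using ln li by simp
    ultimately have "P * lam k \<le> t k * Q" by (simp add: mult_le_cancel_left)
    then show ?thesis using k(1) by auto
  next
    case True
    \<comment> \<open>Vanishing fractional parts mean that \<open>t\<close> is integral. Since
      \<open>c\<close> is nonzero, some \<open>t k\<close> is at least 1, and then the single row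
      \<open>k\<close> takes the role of the candidate.\<close>
    have int_t: "\<exists>u. t j = real_of_int u" if "j \<le> n" for j
    proof -
      have "T j mod (lam n * lam i) = 0" using True frac[of j] that by simp
      then obtain u where "T j = (lam n * lam i) * u" by (auto simp: mod_eq_0_iff_dvd)
      then have e1: "real_of_int (T j) = real_of_int (lam n * lam i) * u" by simp
      have e2: "real_of_int (T j) = real_of_int (lam n * lam i) * t j" using T[OF that] by simp
      have nz: "real_of_int (lam n * lam i) \<noteq> 0" using ln li by simp
      have "real_of_int (lam n * lam i) * t j = real_of_int (lam n * lam i) * u"
        using e1 e2 by (rule trans[OF sym, rotated])
      then have "t j = real_of_int u" by (rule mult_left_cancel[OF nz, THEN iffD1])
      then show ?thesis ..
    qed
    have "\<exists>k\<le>n. t k \<noteq> 0"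
    proof (rule ccontr)
      assume "\<not> ?thesis"
      then have "c k = 0" if "k < n" for k using c[OF that] by simp
      then show False using nz by auto
    qed
    then obtain k where k: "k \<le> n" "t k \<noteq> 0" by blast
    obtain u where u: "t k = real_of_int u" using int_t[OF k(1)] by blast
    have tk: "1 \<le> t k" using t[OF k(1)] k(2) u by simp
    have zero: "cand_frac 0 k 0 j = 0" for j by (simp add: cand_frac_def tau_zero)
    have lk: "1 \<le> lam k" using lam_pos k by simp
    obtain l where l: "l \<le> n" "P * (lam n * lam k * lam l) \<le> cand 0 k 0 l * Q"
      using low[of 0 k 0] k(1) lk ln by auto
    have cd: "cand 0 k 0 l = (if l = k then lam n * lam k else 0)" by (simp add: cand_def zero)
    have "1 \<le> lam n * lam k" by (rule modulus_bounds(1)[OF k(1)])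
    then have "0 < P * (lam n * lam k * lam l)" using PQ lam_pos[OF l(1)] by simp
    then have "l = k" using l(2) cd by (auto split: if_splits)
    then have "(lam n * lam k) * (P * lam k) \<le> (lam n * lam k) * Q" using l(2) cd by (simp add: mult_ac)
    then have "P * lam k \<le> Q" using \<open>1 \<le> lam n * lam k\<close> by (simp add: mult_le_cancel_left)
    then have "real_of_int (P * lam k) \<le> 1 * real_of_int Q" by linarith
    also have "\<dots> \<le> t k * Q" using tk PQ by (intro mult_right_mono) auto
    finally show ?thesis using k(1) by auto
  qed
qed

lemma good_nonzero:
  assumes "good P Q M N"
  shows "\<exists>k<n. (\<Sum>j\<le>n. h j k * N j) div M \<noteq> 0"
proof (rule ccontr)
  assume "\<not> ?thesis"
  then have z: "(\<Sum>j\<le>n. h j k * N j) div M = 0" if "k < n" for k using that by auto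
  have "(\<Sum>j\<le>n. real_of_int (h j k) * real_of_int (N j)) = 0" if "k < n" for k
  proof -
    have "M dvd (\<Sum>j\<le>n. h j k * N j)" using assms that by (auto simp: good_def)
    then have "(\<Sum>j\<le>n. h j k * N j) = 0" using z[OF that] by (metis dvd_div_eq_0_iff)
    then have "real_of_int (\<Sum>j\<le>n. h j k * N j) = 0" by simp
    then show ?thesis by simp
  qed
  then have p: "real_of_int (N j) = real_of_int (N n) / lam n * lam j" if "j \<le> n" for j
    using real_kernel[of "\<lambda>j. real_of_int (N j)"] that by blast
  obtain i where i: "i \<le> n" "N i = 0" using assms by (auto simp: good_def)
  then have z0: "real_of_int (N n) / lam n = 0" using p[OF i(1)] lam_pos[OF i(1)] by simp
  have "N j = 0" if "j \<le> n" for j using p[OF that] unfolding z0 by simp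
  then show False using assms by (auto simp: good_def)
qed

end

section \<open>The width along a direction in terms of slacks\<close>

locale width_simplex = simplex_matrix +
  fixes b :: "nat \<Rightarrow> int"
  assumes beta_pos: "0 < (\<Sum>j\<le>n. b j * lam j)"
begin

definition beta :: int where
  "beta = (\<Sum>j\<le>n. b j * lam j)"

abbreviation row_value :: "nat \<Rightarrow> real vec \<Rightarrow> real" where
  "row_value j x \<equiv> (\<Sum>k<n. real_of_int (h j k) * x $ k)"

lemma slack_sum: "(\<Sum>j\<le>n. lam j * (b j - row_value j x)) = beta"
proof -
  have "(\<Sum>j\<le>n. lam j * (b j - row_value j x)) =
      (\<Sum>j\<le>n. real_of_int (b j * lam j)) - (\<Sum>j\<le>n. lam j * row_value j x)"
    by (simp add: right_diff_distrib sum_subtractf mult.commute)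
  then show ?thesis using lam_rows_sum[of "\<lambda>k. x $ k"] by (simp add: beta_def)
qed

text \<open>The slacks of the first \<open>n\<close> rows are prescribed by forward substitution.
  The weighted sum of all slacks is \<open>beta\<close>, and this forces the slack of the last row,
  for \<open>i < n\<close> as well as for \<open>i = n\<close>.\<close>

lemma vertex_exists:
  assumes "i \<le> n"
  shows "\<exists>x\<in>halfspaces n h b. \<forall>j\<le>n. b j - row_value j x = (if j = i then beta / lam i else 0)"
proof -
  let ?s = "\<lambda>j. b j - (if j = i then beta / lam i else 0)"
  have "\<exists>f. \<forall>j<n. (\<Sum>k<n. real_of_int (h j k) * f k) = ?s j"
  proof (rule triangular_solvable)
    show "real_of_int (h i k) = 0" if "i < n" "k < n" "i < k" for i k using upper_zero[OF that] by simp
    show "real_of_int (h k k) \<noteq> 0" if "k < n" for k using diag_pos[OF that] by simp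
  qed
  then obtain f where f: "\<And>j. j < n \<Longrightarrow> (\<Sum>k<n. real_of_int (h j k) * f k) = ?s j" by blast
  define x where "x = vec n f"
  have r: "row_value j x = (\<Sum>k<n. real_of_int (h j k) * f k)" for j
    by (rule sum.cong) (auto simp: x_def)
  have s: "b j - row_value j x = (if j = i then beta / lam i else 0)" if "j < n" for j
    using f[OF that] r[of j] by simp
  have li: "1 \<le> lam i" "1 \<le> lam n" using lam_pos assms by auto
  have "lam n * (b n - row_value n x) + (\<Sum>j<n. lam j * (b j - row_value j x)) = beta"
    using slack_sum[of x] by (simp add: lessThan_Suc_atMost[symmetric])
  moreover have "(\<Sum>j<n. lam j * (b j - row_value j x)) = (\<Sum>j<n. if j = i then real_of_int beta else 0)"
    by (rule sum.cong) (use s li in auto)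
  ultimately have "lam n * (b n - row_value n x) = (if i = n then beta else 0)"
    using assms by (cases "i = n") auto
  then have "b n - row_value n x = (if n = i then beta / lam i else 0)"
    using li by (auto simp: field_simps split: if_splits)
  then have s': "b j - row_value j x = (if j = i then beta / lam i else 0)" if "j \<le> n" for j
    using s[of j] that by (cases "j = n") auto
  have "0 < beta" using beta_pos by (simp add: beta_def)
  then have "0 \<le> beta / lam i" using li by simp
  then have "row_value j x \<le> b j" if "j \<le> n" for j
    using s'[OF that] by (auto split: if_splits)
  then have "x \<in> halfspaces n h b" by (simp add: halfspaces_def x_def)
  then show ?thesis using s' by blast
qed

lemma linear_form:
  fixes t :: "nat \<Rightarrow> real"
  assumes c: "\<And>k. k < n \<Longrightarrow> real_of_int (c $ k) = (\<Sum>j\<le>n. h j k * t j)"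
    and "c \<in> carrier_vec n" "x \<in> carrier_vec n"
  shows "map_vec real_of_int c \<bullet> x = (\<Sum>j\<le>n. t j * b j) - (\<Sum>j\<le>n. t j * (b j - row_value j x))"
proof -
  have "map_vec real_of_int c \<bullet> x = (\<Sum>k<n. real_of_int (c $ k) * x $ k)"
    using assms(2,3) by (auto simp: scalar_prod_def atLeast0LessThan intro: sum.cong)
  also have "\<dots> = (\<Sum>k<n. (\<Sum>j\<le>n. h j k * t j) * x $ k)"
    by (rule sum.cong) (use c in auto)
  also have "\<dots> = (\<Sum>k<n. \<Sum>j\<le>n. t j * (h j k * x $ k))"
    unfolding sum_distrib_right by (simp only: mult_ac)
  also have "\<dots> = (\<Sum>j\<le>n. \<Sum>k<n. t j * (h j k * x $ k))"
    by (rule sum.swap)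
  also have "\<dots> = (\<Sum>j\<le>n. t j * row_value j x)"
    by (simp add: sum_distrib_left)
  finally show ?thesis by (simp add: right_diff_distrib sum_subtractf)
qed

lemma linear_form_bounds:
  fixes t :: "nat \<Rightarrow> real" and W :: real
  assumes c: "\<And>k. k < n \<Longrightarrow> real_of_int (c $ k) = (\<Sum>j\<le>n. h j k * t j)"
    and "c \<in> carrier_vec n" and x: "x \<in> halfspaces n h b"
    and t: "\<And>j. j \<le> n \<Longrightarrow> 0 \<le> t j" "\<And>j. j \<le> n \<Longrightarrow> t j \<le> W * lam j"
  shows "map_vec real_of_int c \<bullet> x \<le> (\<Sum>j\<le>n. t j * b j)"
    and "(\<Sum>j\<le>n. t j * b j) - W * beta \<le> map_vec real_of_int c \<bullet> x"
proof -
  have xc: "x \<in> carrier_vec n" and y: "\<And>j. j \<le> n \<Longrightarrow> 0 \<le> b j - row_value j x"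
    using x by (auto simp: halfspaces_def)
  have lf: "map_vec real_of_int c \<bullet> x = (\<Sum>j\<le>n. t j * b j) - (\<Sum>j\<le>n. t j * (b j - row_value j x))"
    by (rule linear_form[OF _ assms(2) xc]) (rule c)
  have "0 \<le> (\<Sum>j\<le>n. t j * (b j - row_value j x))"
    by (rule sum_nonneg) (use t y in \<open>auto intro: mult_nonneg_nonneg\<close>)
  then show "map_vec real_of_int c \<bullet> x \<le> (\<Sum>j\<le>n. t j * b j)" unfolding lf by simp
  have "(\<Sum>j\<le>n. t j * (b j - row_value j x)) \<le> (\<Sum>j\<le>n. W * lam j * (b j - row_value j x))"
    by (rule sum_mono) (use t y in \<open>auto intro: mult_right_mono\<close>)
  also have "\<dots> = W * beta" using slack_sum[of x] by (simp add: mult.assoc sum_distrib_left[symmetric])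
  finally show "(\<Sum>j\<le>n. t j * b j) - W * beta \<le> map_vec real_of_int c \<bullet> x" unfolding lf by simp
qed

lemma halfspaces_nonempty: "halfspaces n h b \<noteq> {}"
  using vertex_exists[of 0] by blast

lemma width_along_le:
  fixes t :: "nat \<Rightarrow> real" and W :: real
  assumes c: "\<And>k. k < n \<Longrightarrow> real_of_int (c $ k) = (\<Sum>j\<le>n. h j k * t j)"
    and "c \<in> carrier_vec n"
    and t: "\<And>j. j \<le> n \<Longrightarrow> 0 \<le> t j" "\<And>j. j \<le> n \<Longrightarrow> t j \<le> W * lam j"
  shows "width_along (halfspaces n h b) c \<le> W * beta"
proof -
  have bd: "map_vec real_of_int c \<bullet> x \<le> (\<Sum>j\<le>n. t j * b j)"
    "(\<Sum>j\<le>n. t j * b j) - W * beta \<le> map_vec real_of_int c \<bullet> x" if "x \<in> halfspaces n h b" for x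
    by (rule linear_form_bounds[OF _ assms(2) that]; (rule c t; assumption))+
  have "(SUP x\<in>halfspaces n h b. map_vec real_of_int c \<bullet> x) \<le> (\<Sum>j\<le>n. t j * b j)"
    by (rule cSUP_least) (use halfspaces_nonempty bd in auto)
  moreover have "(\<Sum>j\<le>n. t j * b j) - W * beta \<le> (INF x\<in>halfspaces n h b. map_vec real_of_int c \<bullet> x)"
    by (rule cINF_greatest) (use halfspaces_nonempty bd in auto)
  ultimately show ?thesis by (simp add: width_along_def)
qed

text \<open>At the vertex opposite to facet \<open>l\<close> only the slack of row \<open>l\<close>
  is nonzero, so the functional lies \<open>t l * beta / lam l\<close> below the constant
  \<open>\<Sum>j\<le>n. t j * b j\<close>. The bound is the difference between its values at the
  vertices for \<open>i\<close> and \<open>k\<close>.\<close>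

lemma width_along_ge:
  fixes t :: "nat \<Rightarrow> real"
  assumes c: "\<And>k. k < n \<Longrightarrow> real_of_int (c $ k) = (\<Sum>j\<le>n. h j k * t j)"
    and cc: "c \<in> carrier_vec n"
    and t: "\<And>j. j \<le> n \<Longrightarrow> 0 \<le> t j" and i: "i \<le> n" "t i = 0" and k: "k \<le> n"
  shows "t k * beta / lam k \<le> width_along (halfspaces n h b) c"
proof -
  \<comment> \<open>A crude bound on the ratios. It serves to show that the functional is bounded on
    the simplex, so that supremum and infimum can be compared with its values at vertices.\<close>
  define W where "W = (\<Sum>j\<le>n. t j)"
  have W: "t j \<le> W * lam j" if "j \<le> n" for j
  proof -
    have "t j \<le> W" unfolding W_def by (rule member_le_sum) (use t that in auto)
    moreover have "0 \<le> W" unfolding W_def by (rule sum_nonneg) (use t in auto)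
    then have "W * 1 \<le> W * lam j" using lam_pos[OF that] by (intro mult_left_mono) auto
    ultimately show ?thesis by simp
  qed
  have bd: "map_vec real_of_int c \<bullet> x \<le> (\<Sum>j\<le>n. t j * b j)"
    "(\<Sum>j\<le>n. t j * b j) - W * beta \<le> map_vec real_of_int c \<bullet> x" if "x \<in> halfspaces n h b" for x
    by (rule linear_form_bounds[OF _ cc that]; (rule c t W; assumption))+
  have above: "bdd_above ((\<lambda>x. map_vec real_of_int c \<bullet> x) ` halfspaces n h b)"
    by (rule bdd_aboveI2) (rule bd(1))
  have below: "bdd_below ((\<lambda>x. map_vec real_of_int c \<bullet> x) ` halfspaces n h b)"
    by (rule bdd_belowI2) (rule bd(2))
  have at_vertex: "\<exists>x\<in>halfspaces n h b. map_vec real_of_int c \<bullet> x = (\<Sum>j\<le>n. t j * b j) - t l * (beta / lam l)"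
    if l: "l \<le> n" for l
  proof -
    obtain x where x: "x \<in> halfspaces n h b"
      "\<And>j. j \<le> n \<Longrightarrow> b j - row_value j x = (if j = l then beta / lam l else 0)"
      using vertex_exists[OF l] by blast
    have "(\<Sum>j\<le>n. t j * (b j - row_value j x)) = (\<Sum>j\<le>n. if j = l then t l * (beta / lam l) else 0)"
      by (rule sum.cong) (use x in auto)
    then have "(\<Sum>j\<le>n. t j * (b j - row_value j x)) = t l * (beta / lam l)" using l by simp
    moreover have "map_vec real_of_int c \<bullet> x = (\<Sum>j\<le>n. t j * b j) - (\<Sum>j\<le>n. t j * (b j - row_value j x))"
      by (rule linear_form[OF _ cc]) (use c x(1) in \<open>auto simp: halfspaces_def\<close>)
    ultimately show ?thesis using x(1) by (intro bexI[of _ x]) simp_all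
  qed
  obtain x where x: "x \<in> halfspaces n h b" "map_vec real_of_int c \<bullet> x = (\<Sum>j\<le>n. t j * b j)"
    using at_vertex[OF i(1)] i(2) by auto
  obtain y where y: "y \<in> halfspaces n h b"
      "map_vec real_of_int c \<bullet> y = (\<Sum>j\<le>n. t j * b j) - t k * (beta / lam k)"
    using at_vertex[OF k] by blast
  have "(\<Sum>j\<le>n. t j * b j) \<le> (SUP x\<in>halfspaces n h b. map_vec real_of_int c \<bullet> x)"
    using cSUP_upper[OF x(1) above] x(2) by simp
  moreover have "(INF x\<in>halfspaces n h b. map_vec real_of_int c \<bullet> x) \<le> (\<Sum>j\<le>n. t j * b j) - t k * (beta / lam k)"
    using cINF_lower[OF below y(1)] y(2) by simp
  ultimately show ?thesis by (simp add: width_along_def)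
qed

text \<open>The certificate bounds the width along \<open>c\<close> from above. For any nonzero
  direction, \<open>candidate_below\<close> finds an entry of its cone representation whose ratio is
  at least \<open>P / Q\<close>, and the vertex belonging to that entry gives the lower
  bound.\<close>

lemma width_of_best:
  assumes good: "good P Q M N" and P: "1 \<le> P"
    and low: "\<And>a i m. int a < lam n \<Longrightarrow> i \<le> n \<Longrightarrow> int m < lam i \<Longrightarrow>
      \<exists>k\<le>n. P * (lam n * lam i * lam k) \<le> cand a i m k * Q"
    and c: "c = vec n (\<lambda>k. (\<Sum>j\<le>n. h j k * N j) div M)"
  shows "width n (halfspaces n h b) = real_of_int (beta * P) / real_of_int Q"
    and "flat_direction n (halfspaces n h b) c"
proof -
  let ?S = "halfspaces n h b"
  let ?w = "real_of_int (beta * P) / real_of_int Q"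
  have Q: "1 \<le> Q" and M: "1 \<le> M" using good by (auto simp: good_def)
  have be: "0 < beta" using beta_pos by (simp add: beta_def)
  have cc: "c \<in> carrier_vec n" by (simp add: c)
  obtain k where "k < n" "c $ k \<noteq> 0" using good_nonzero[OF good] by (auto simp: c)
  then have c0: "c \<in> carrier_vec n - {0\<^sub>v n}" using cc by auto
  have le: "width_along ?S c \<le> P / Q * beta"
  proof (rule width_along_le[OF _ cc])
    show "real_of_int (c $ k) = (\<Sum>j\<le>n. h j k * (N j / M))" if "k < n" for k
    proof -
      have d: "M dvd (\<Sum>j\<le>n. h j k * N j)" using good that by (auto simp: good_def)
      have "real_of_int (c $ k) = real_of_int (\<Sum>j\<le>n. h j k * N j) / M"
        using that d by (simp add: c real_of_int_div)
      then show ?thesis by (simp add: sum_divide_distrib)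
    qed
    show "0 \<le> real_of_int (N j) / M" if "j \<le> n" for j using good M that by (auto simp: good_def)
    show "real_of_int (N j) / M \<le> P / Q * lam j" if "j \<le> n" for j
    proof -
      have "N j * Q \<le> P * M * lam j" using good that by (auto simp: good_def)
      then have "real_of_int (N j * Q) \<le> real_of_int (P * M * lam j)" by linarith
      then show ?thesis using M Q by (simp add: field_simps)
    qed
  qed
  have ge: "?w \<le> width_along ?S d" if d: "d \<in> carrier_vec n - {0\<^sub>v n}" for d
  proof -
    obtain t :: "nat \<Rightarrow> real" and i where t: "i \<le> n" "t i = 0" "\<And>j. j \<le> n \<Longrightarrow> 0 \<le> t j"
      "\<And>k. k < n \<Longrightarrow> d $ k = (\<Sum>j\<le>n. h j k * t j)"
      by (rule cone_representation[of "\<lambda>k. d $ k"]) blast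
    have nz: "\<exists>k<n. d $ k \<noteq> 0"
    proof (rule ccontr)
      assume "\<not> ?thesis"
      then have "d = 0\<^sub>v n" using d by (intro eq_vecI) auto
      then show False using d by simp
    qed
    have "\<exists>k\<le>n. P * lam k \<le> t k * Q"
      by (rule candidate_below[where c = "\<lambda>k. d $ k", OF t nz _ _ low]) (use P Q in auto)
    then obtain k where k: "k \<le> n" "P * lam k \<le> t k * Q" by blast
    have lk: "1 \<le> lam k" using lam_pos[OF k(1)] .
    have "?w = (P * lam k) * (beta / (lam k * Q))" using lk Q by (simp add: field_simps)
    also have "\<dots> \<le> (t k * Q) * (beta / (lam k * Q))"
      using k(2) be lk Q by (intro mult_right_mono) auto
    also have "\<dots> = t k * beta / lam k" using Q by simp
    also have "\<dots> \<le> width_along ?S d"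
      by (rule width_along_ge[OF t(4) _ t(3,1,2) k(1)]) (use d in auto)
    finally show ?thesis .
  qed
  have wc: "width_along ?S c = ?w" using le ge[OF c0] by (simp add: field_simps)
  have "bdd_below (width_along ?S ` (carrier_vec n - {0\<^sub>v n}))"
    by (rule bdd_belowI2) (rule ge)
  then have "width n ?S \<le> width_along ?S c"
    unfolding width_def by (rule cINF_lower) (rule c0)
  moreover have "?w \<le> width n ?S"
    unfolding width_def by (rule cINF_greatest) (use c0 ge in auto)
  ultimately show "width n ?S = ?w" using wc by simp
  then show "flat_direction n ?S c" using c0 wc by (simp add: flat_direction_def)
qed

end

section \<open>Minors and simplices\<close>

lemma finite_minors:
  "finite {\<bar>det (submatrix A I J)\<bar> | I J. I \<subseteq> {..<dim_row A} \<and> J \<subseteq> {..<dim_col A} \<and> card I = k \<and> card J = k}"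
proof (rule finite_subset)
  show "{\<bar>det (submatrix A I J)\<bar> | I J. I \<subseteq> {..<dim_row A} \<and> J \<subseteq> {..<dim_col A} \<and> card I = k \<and> card J = k}
    \<subseteq> (\<lambda>(I, J). \<bar>det (submatrix A I J)\<bar>) ` (Pow {..<dim_row A} \<times> Pow {..<dim_col A})"
    by auto
qed auto

lemma minor_le_max_minor:
  assumes "I \<subseteq> {..<dim_row A}" "J \<subseteq> {..<dim_col A}" "card I = k" "card J = k"
  shows "\<bar>det (submatrix A I J)\<bar> \<le> max_minor k A"
  unfolding max_minor_def by (rule Max_ge[OF finite_minors]) (use assms in auto)

lemma pick_delete:
  assumes "r < m - 1" "i < m"
  shows "pick ({..<m} - {i}) r = (if r < i then r else Suc r)"
proof -
  let ?s = "if r < i then r else Suc r"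
  let ?I = "{..<m} - {i}"
  have s: "?s \<in> ?I" using assms by auto
  have "{a \<in> ?I. a < ?s} = (if r < i then {..<r} else {..<Suc r} - {i})"
    using assms by auto
  moreover have "card (if r < i then {..<r} else {..<Suc r} - {i}) = r"
    by (cases "r < i") (auto simp: card_Diff_singleton_if)
  ultimately have "card {a \<in> ?I. a < ?s} = r" by simp
  then show ?thesis using pick_card_in_set[OF s] by simp
qed

text \<open>Links minors, defined through \<open>submatrix\<close>, with cofactors, defined through
  \<open>mat_delete\<close>.\<close>

lemma submatrix_delete:
  assumes "i < dim_row A" "k < dim_col A"
  shows "submatrix A ({..<dim_row A} - {i}) ({..<dim_col A} - {k}) = mat_delete A i k"
proof -
  have r: "card {a. a < m \<and> a \<in> {..<m} - {i}} = m - 1" if "i < m" for i m :: nat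
  proof -
    have "{a. a < m \<and> a \<in> {..<m} - {i}} = {..<m} - {i}" by auto
    then show ?thesis using that by simp
  qed
  show ?thesis
    unfolding submatrix_def mat_delete_def r[OF assms(1)] r[OF assms(2)]
    by (rule cong_mat) (use assms in \<open>simp_all add: pick_delete\<close>)
qed

lemma cofactor_le_max_minor:
  assumes "A \<in> carrier_mat (Suc n) (Suc n)" "i \<le> n" "k \<le> n"
  shows "\<bar>cofactor A i k\<bar> \<le> max_minor n A"
proof -
  have "\<bar>cofactor A i k\<bar> = \<bar>det (submatrix A ({..<Suc n} - {i}) ({..<Suc n} - {k}))\<bar>"
    using submatrix_delete[of i A k] assms by (simp add: cofactor_def abs_mult)
  also have "\<dots> \<le> max_minor n A"
    by (rule minor_le_max_minor) (use assms in auto)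
  finally show ?thesis .
qed

lemma pick_lessThan: "r < n \<Longrightarrow> pick {..<n} r = r"
proof -
  assume r: "r < n"
  have "{a \<in> {..<n}. a < r} = {..<r}" using r by auto
  then have "card {a \<in> {..<n}. a < r} = r" by simp
  then show ?thesis using pick_card_in_set[of r "{..<n}"] r by simp
qed

lemma augmented_carrier:
  "H \<in> carrier_mat (n + 1) n \<Longrightarrow> augmented H b \<in> carrier_mat (Suc n) (Suc n)"
  by (auto simp: augmented_def mat_of_cols_def)

lemma augmented_index:
  assumes "H \<in> carrier_mat (n + 1) n" "i \<le> n" "k \<le> n" "b \<in> carrier_vec (n + 1)"
  shows "augmented H b $$ (i, k) = (if k < n then H $$ (i, k) else b $ i)"
  using assms by (auto simp: augmented_def mat_of_cols_index nth_append)

lemma submatrix_augmented: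
  assumes "H \<in> carrier_mat (n + 1) n" "b \<in> carrier_vec (n + 1)"
  shows "submatrix (augmented H b) I {..<n} = submatrix H I {..<n}"
proof (rule eq_matI)
  note A = augmented_carrier[OF assms(1), of b]
  have c: "{j. j < dim_col (augmented H b) \<and> j \<in> {..<n}} = {..<n}" "{j. j < dim_col H \<and> j \<in> {..<n}} = {..<n}"
    using A assms by auto
  have r: "dim_row (augmented H b) = dim_row H" using A assms by simp
  show "dim_row (submatrix (augmented H b) I {..<n}) = dim_row (submatrix H I {..<n})"
    by (simp add: dim_submatrix r)
  show "dim_col (submatrix (augmented H b) I {..<n}) = dim_col (submatrix H I {..<n})"
    unfolding dim_submatrix c ..
  fix i j assume "i < dim_row (submatrix H I {..<n})" "j < dim_col (submatrix H I {..<n})"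
  then have i: "i < card {i. i < dim_row H \<and> i \<in> I}" and j: "j < n" unfolding dim_submatrix c by simp_all
  have "pick I i < dim_row H" by (rule pick_le[OF i])
  then have p: "pick I i \<le> n" using assms(1) by simp
  have "submatrix (augmented H b) I {..<n} $$ (i, j) = augmented H b $$ (pick I i, pick {..<n} j)"
    by (rule submatrix_index) (unfold r c, use i j in simp_all)
  also have "\<dots> = H $$ (pick I i, pick {..<n} j)"
    using augmented_index[OF assms(1) p _ assms(2), of "pick {..<n} j"] j by (simp add: pick_lessThan)
  also have "\<dots> = submatrix H I {..<n} $$ (i, j)"
    by (rule submatrix_index[symmetric]) (unfold c, use i j in simp_all)
  finally show "submatrix (augmented H b) I {..<n} $$ (i, j) = submatrix H I {..<n} $$ (i, j)" .
qed

text \<open>The kernel of the transpose of \<open>H\<close>: the cofactors of the last column of \<open>(H b)\<close>.\<close>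

definition row_relation :: "int mat \<Rightarrow> int vec \<Rightarrow> nat \<Rightarrow> int" where
  "row_relation H b j = cofactor (augmented H b) j (dim_col H)"

context
  fixes n :: nat and H :: "int mat" and b :: "int vec"
  assumes H: "H \<in> carrier_mat (n + 1) n" and b: "b \<in> carrier_vec (n + 1)"
begin

text \<open>This is the off-diagonal entry \<open>(n, k)\<close> of the product of the adjugate with
  the augmented matrix: the expansion along the last column of the determinant in which
  \<open>b\<close> is replaced by column \<open>k\<close>.\<close>

lemma row_relation_kernel:
  assumes "k < n"
  shows "(\<Sum>j\<le>n. H $$ (j, k) * row_relation H b j) = 0"
proof -
  let ?A = "augmented H b"
  note A = augmented_carrier[OF H, of b]
  note adj = adj_mat[OF A]
  have "0 = (adj_mat ?A * ?A) $$ (n, k)" unfolding adj(3) using assms by simp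
  also have "\<dots> = (\<Sum>j<Suc n. adj_mat ?A $$ (n, j) * ?A $$ (j, k))"
    using A adj(1) assms by (simp add: scalar_prod_def atLeast0LessThan)
  also have "\<dots> = (\<Sum>j<Suc n. H $$ (j, k) * row_relation H b j)"
    by (rule sum.cong) (use A H assms augmented_index[OF H _ _ b] in \<open>auto simp: adj_mat_def row_relation_def\<close>)
  finally show ?thesis by (simp add: lessThan_Suc_atMost)
qed

text \<open>An off-diagonal entry of the augmented matrix times its adjugate. It expresses
  \<open>b $ j\<close> times a coefficient of the row relation through minors of
  \<open>(H b)\<close>, which is how \<open>Delta_aug\<close> comes to control the size of
  \<open>b\<close>.\<close>

lemma cofactor_row:
  assumes "i \<le> n" "j \<le> n" "i \<noteq> j"
  shows "(\<Sum>k<n. H $$ (j, k) * cofactor (augmented H b) i k) + b $ j * row_relation H b i = 0"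
proof -
  let ?A = "augmented H b"
  note A = augmented_carrier[OF H, of b]
  note adj = adj_mat[OF A]
  have "0 = (?A * adj_mat ?A) $$ (j, i)" unfolding adj(2) using assms by simp
  also have "\<dots> = (\<Sum>k<Suc n. ?A $$ (j, k) * adj_mat ?A $$ (k, i))"
    using A adj(1) assms by (simp add: scalar_prod_def atLeast0LessThan)
  also have "\<dots> = (\<Sum>k<n. H $$ (j, k) * cofactor ?A i k) + b $ j * row_relation H b i"
    using A H assms augmented_index[OF H _ _ b] by (auto simp: adj_mat_def row_relation_def intro!: sum.cong)
  finally show ?thesis by simp
qed

lemma row_relation_le: "j \<le> n \<Longrightarrow> \<bar>row_relation H b j\<bar> \<le> max_minor n H"
proof -
  assume j: "j \<le> n"
  let ?A = "augmented H b"
  note A = augmented_carrier[OF H, of b]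
  have "{..<Suc n} - {n} = {..<n}" by auto
  then have "\<bar>row_relation H b j\<bar> = \<bar>det (submatrix ?A ({..<Suc n} - {j}) {..<n})\<bar>"
    using submatrix_delete[of j ?A n] A H j by (simp add: row_relation_def cofactor_def abs_mult)
  also have "\<dots> = \<bar>det (submatrix H ({..<Suc n} - {j}) {..<n})\<bar>"
    by (simp add: submatrix_augmented[OF H b])
  also have "\<dots> \<le> max_minor n H" by (rule minor_le_max_minor) (use H j in auto)
  finally show ?thesis .
qed

lemma max_minor_le_aug: "max_minor n H \<le> Delta_aug H b"
proof -
  let ?S = "{\<bar>det (submatrix H I J)\<bar> | I J. I \<subseteq> {..<dim_row H} \<and> J \<subseteq> {..<dim_col H} \<and> card I = n \<and> card J = n}"
  note A = augmented_carrier[OF H, of b]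
  have "\<bar>det (submatrix H {..<n} {..<n})\<bar> \<in> ?S" using H by (auto intro!: exI[of _ "{..<n}"])
  then have "?S \<noteq> {}" by blast
  then have "max_minor n H \<in> ?S" unfolding max_minor_def by (rule Max_in[OF finite_minors])
  then obtain I J where IJ: "max_minor n H = \<bar>det (submatrix H I J)\<bar>" "I \<subseteq> {..<dim_row H}"
    "J \<subseteq> {..<dim_col H}" "card I = n" "card J = n" by auto
  have "J = {..<n}" using IJ(3,5) H by (intro card_subset_eq) auto
  then have "max_minor n H = \<bar>det (submatrix (augmented H b) I {..<n})\<bar>"
    using IJ(1) by (simp add: submatrix_augmented[OF H b])
  also have "\<dots> \<le> max_minor n (augmented H b)"
    by (rule minor_le_max_minor) (use IJ H A in auto)
  finally show ?thesis using H by (simp add: Delta_aug_def)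
qed

lemma row_relation_last:
  assumes "\<forall>i<n. \<forall>j<n. i < j \<longrightarrow> H $$ (i, j) = 0"
  shows "row_relation H b n = (\<Prod>k<n. H $$ (k, k))"
proof -
  note A = augmented_carrier[OF H, of b]
  have "mat_delete (augmented H b) n n = first_rows n H"
    by (rule eq_matI) (use A H b in \<open>auto simp: mat_delete_def first_rows_def augmented_index[OF H _ _ b]\<close>)
  then have "row_relation H b n = det (first_rows n H)"
    using H by (simp add: row_relation_def cofactor_def)
  also have "\<dots> = prod_list (diag_mat (first_rows n H))"
    by (rule det_lower_triangular[of n]) (use assms H in \<open>auto simp: first_rows_def\<close>)
  also have "diag_mat (first_rows n H) = map (\<lambda>k. H $$ (k, k)) [0..<n]"
    using H by (auto simp: diag_mat_def first_rows_def)
  finally show ?thesis by (simp add: prod.list_conv_set_nth atLeast0LessThan)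
qed

lemma polyhedron_halfspaces:
  "polyhedron H b = halfspaces n (\<lambda>j k. H $$ (j, k)) (\<lambda>j. b $ j)"
proof -
  have r: "(map_mat real_of_int H *\<^sub>v x) $ j = (\<Sum>k<n. real_of_int (H $$ (j, k)) * x $ k)"
    if "x \<in> carrier_vec n" "j \<le> n" for x j
    using that H by (auto simp: scalar_prod_def atLeast0LessThan intro!: sum.cong)
  show ?thesis
    unfolding polyhedron_def halfspaces_def
    using H b r by (auto simp: less_eq_vec_def less_Suc_eq_le)
qed

end

section \<open>Signs forced by being a simplex\<close>

lemma simplex_distinct_points:
  assumes "is_simplex n S" "1 \<le> n"
  obtains p q k where "p \<in> S" "q \<in> S" "k < n" "p $ k \<noteq> q $ k"
proof -
  obtain v where v: "\<And>i. i \<le> n \<Longrightarrow> v i \<in> carrier_vec n" "affinely_independent n v" "S = hull_of n v"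
    using assms(1) by (auto simp: is_simplex_def)
  have vS: "v i \<in> S" if "i \<le> n" for i
  proof -
    have "v i = vec n (\<lambda>j. \<Sum>l\<le>n. (if l = i then 1 else 0) * v l $ j)"
      using v(1)[OF that] that by (intro eq_vecI) (simp_all add: if_distrib[of "\<lambda>x. x * _"] cong: if_cong)
    then show ?thesis
      unfolding v(3) hull_of_def using that
      by (auto intro!: exI[of _ "\<lambda>l. if l = i then 1 else 0"])
  qed
  have "\<exists>k<n. v 0 $ k \<noteq> v 1 $ k"
  proof (rule ccontr)
    assume "\<not> ?thesis"
    then have eq: "v 0 $ k = v 1 $ k" if "k < n" for k using that by auto
    \<comment> \<open>The affine dependence expressing that the vertices 0 and 1 coincide.\<close>
    define u where "u i = (if i = 0 then 1 else if i = 1 then - 1 else 0 :: real)" for i :: nat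
    have sum: "(\<Sum>i\<le>n. u i * f i) = f 0 - f 1" for f :: "nat \<Rightarrow> real"
    proof -
      have "(\<Sum>i\<le>n. u i * f i) = (\<Sum>i\<in>{0, 1}. u i * f i)"
        by (rule sum.mono_neutral_right) (use assms(2) in \<open>auto simp: u_def\<close>)
      then show ?thesis by (simp add: u_def)
    qed
    have "(\<Sum>i\<le>n. u i) = 0" using sum[of "\<lambda>_. 1"] by simp
    moreover have "\<forall>j<n. (\<Sum>i\<le>n. u i * v i $ j) = 0" using sum eq by simp
    ultimately have "u 0 = 0" using v(2) unfolding affinely_independent_def by blast
    then show False by (simp add: u_def)
  qed
  then show thesis using vS[of 0] vS[of 1] assms(2) that by auto
qed

lemma simplex_bounded:
  assumes "is_simplex n S"
  obtains B where "\<And>x k. x \<in> S \<Longrightarrow> k < n \<Longrightarrow> \<bar>x $ k\<bar> \<le> B k"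
proof -
  obtain v where v: "S = hull_of n v" using assms by (auto simp: is_simplex_def)
  show thesis
  proof (rule that[of "\<lambda>k. \<Sum>i\<le>n. \<bar>v i $ k\<bar>"])
    fix x k assume "x \<in> S" "k < n"
    then obtain u where "x = vec n (\<lambda>j. \<Sum>i\<le>n. u i * v i $ j)" and u': "\<forall>i\<le>n. 0 \<le> u i" "(\<Sum>i\<le>n. u i) = 1"
      unfolding v hull_of_def by blast
    then have u: "\<And>i. i \<le> n \<Longrightarrow> 0 \<le> u i" "(\<Sum>i\<le>n. u i) = 1" "x $ k = (\<Sum>i\<le>n. u i * v i $ k)"
      using \<open>k < n\<close> by simp_all
    have "u i \<le> 1" if "i \<le> n" for i
      using member_le_sum[of i "{..n}" u] u that by auto
    then have "\<bar>u i * v i $ k\<bar> \<le> 1 * \<bar>v i $ k\<bar>" if "i \<le> n" for i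
      unfolding abs_mult using u(1) that by (intro mult_right_mono) auto
    then have "(\<Sum>i\<le>n. \<bar>u i * v i $ k\<bar>) \<le> (\<Sum>i\<le>n. \<bar>v i $ k\<bar>)" by (intro sum_mono) auto
    then show "\<bar>x $ k\<bar> \<le> (\<Sum>i\<le>n. \<bar>v i $ k\<bar>)" unfolding u(3) by (rule order_trans[OF sum_abs])
  qed
qed

text \<open>A nonpositive coefficient would leave an edge direction of the cone at the vertex given by
  the first \<open>n\<close> rows unbounded.\<close>

lemma kernel_pos:
  fixes h :: "nat \<Rightarrow> nat \<Rightarrow> int" and lam :: "nat \<Rightarrow> int"
  assumes simplex: "is_simplex n (halfspaces n h b)" and n: "1 \<le> n"
    and upper: "\<And>i k. i < n \<Longrightarrow> k < n \<Longrightarrow> i < k \<Longrightarrow> h i k = 0" and diag: "\<And>k. k < n \<Longrightarrow> h k k \<noteq> 0"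
    and kernel: "\<And>k. k < n \<Longrightarrow> (\<Sum>j\<le>n. h j k * lam j) = 0" and last: "0 < lam n" and i: "i \<le> n"
  shows "0 < lam i"
proof (rule ccontr)
  assume np: "\<not> 0 < lam i"
  then have i': "i < n" using i last by (cases "i = n") auto
  \<comment> \<open>A direction that decreases row \<open>i\<close> and leaves the other ones among
    the first \<open>n\<close> rows unchanged.\<close>
  have "\<exists>d. \<forall>j<n. (\<Sum>k<n. real_of_int (h j k) * d k) = (if j = i then - 1 else 0)"
    by (rule triangular_solvable) (use upper diag in auto)
  then obtain d where d: "\<And>j. j < n \<Longrightarrow> (\<Sum>k<n. real_of_int (h j k) * d k) = (if j = i then - 1 else 0)"
    by blast
  let ?r = "\<lambda>j. \<Sum>k<n. real_of_int (h j k) * d k"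
  have "(\<Sum>j\<le>n. lam j * ?r j) = (\<Sum>k<n. real_of_int (\<Sum>j\<le>n. h j k * lam j) * d k)"
    unfolding of_int_sum sum_distrib_left sum_distrib_right
    by (subst sum.swap) (simp add: mult_ac)
  then have "(\<Sum>j\<le>n. lam j * ?r j) = 0" using kernel by simp
  then have "(\<Sum>j<n. lam j * ?r j) + lam n * ?r n = 0" by (simp add: lessThan_Suc_atMost[symmetric])
  moreover have "(\<Sum>j<n. lam j * ?r j) = (\<Sum>j<n. if j = i then - real_of_int (lam i) else 0)"
    by (rule sum.cong) (use d in auto)
  \<comment> \<open>The relation between the rows determines the change of row \<open>n\<close>: a
    nonpositive \<open>lam i\<close> means that row \<open>n\<close> does not increase along
    \<open>d\<close> either, so \<open>d\<close> is a ray of the polyhedron.\<close>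
  ultimately have "lam n * ?r n = lam i" using i' by simp
  then have "real_of_int (lam n) * ?r n \<le> 0" using np by simp
  then have rn: "?r n \<le> 0" using last by (simp add: mult_le_0_iff)
  have r: "?r j \<le> 0" if "j \<le> n" for j using d[of j] rn that by (cases "j = n") auto
  obtain p where p: "p \<in> halfspaces n h b" using simplex_distinct_points[OF simplex n] by blast
  have ray: "p + s \<cdot>\<^sub>v vec n d \<in> halfspaces n h b" if "0 \<le> s" for s
  proof -
    have pc: "p \<in> carrier_vec n" using p by (simp add: halfspaces_def)
    have "(\<Sum>k<n. real_of_int (h j k) * (p + s \<cdot>\<^sub>v vec n d) $ k) \<le> b j" if j: "j \<le> n" for j
    proof -
      have "(\<Sum>k<n. real_of_int (h j k) * (p + s \<cdot>\<^sub>v vec n d) $ k) =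
          (\<Sum>k<n. real_of_int (h j k) * p $ k + s * (real_of_int (h j k) * d k))"
        by (rule sum.cong) (use pc in \<open>auto simp: algebra_simps\<close>)
      also have "\<dots> = (\<Sum>k<n. real_of_int (h j k) * p $ k) + s * ?r j"
        by (simp add: sum.distrib sum_distrib_left)
      also have "\<dots> \<le> real_of_int (b j) + 0"
      proof (rule add_mono)
        show "(\<Sum>k<n. real_of_int (h j k) * p $ k) \<le> b j" using p j by (simp add: halfspaces_def)
        show "s * ?r j \<le> 0" using \<open>0 \<le> s\<close> r[OF j] by (rule mult_nonneg_nonpos)
      qed
      finally show ?thesis by simp
    qed
    then show ?thesis using pc by (simp add: halfspaces_def)
  qed
  obtain B where B: "\<And>x k. x \<in> halfspaces n h b \<Longrightarrow> k < n \<Longrightarrow> \<bar>x $ k\<bar> \<le> B k"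
    using simplex_bounded[OF simplex] by blast
  have "\<exists>k<n. d k \<noteq> 0"
  proof (rule ccontr)
    assume "\<not> ?thesis"
    then have "?r i = 0" by simp
    then show False using d[OF i'] by simp
  qed
  then obtain k where k: "k < n" "d k \<noteq> 0" by blast
  \<comment> \<open>With this step length coordinate \<open>k\<close> moves by
    \<open>2 * B k + 1\<close>, more than two points whose coordinates are bounded by
    \<open>B k\<close> can differ.\<close>
  define s where "s = (2 * B k + 1) / \<bar>d k\<bar>"
  have pc: "p \<in> carrier_vec n" using p by (simp add: halfspaces_def)
  have B0: "\<bar>p $ k\<bar> \<le> B k" by (rule B[OF p k(1)])
  then have s: "0 \<le> s" by (simp add: s_def)
  have "\<bar>p $ k + s * d k\<bar> \<le> B k" using B[OF ray[OF s] k(1)] k(1) pc by simp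
  moreover have "\<bar>s * d k\<bar> = 2 * B k + 1" using k(2) s B0 by (simp add: abs_mult s_def)
  ultimately show False using B0 by linarith
qed

text \<open>At every point of the simplex the nonnegative slacks, weighted by \<open>lam\<close>,
  add up to this sum. If it were 0, all rows would be tight everywhere, and the triangular system
  would leave room for a single point only.\<close>

lemma beta_pos_of_simplex:
  fixes h :: "nat \<Rightarrow> nat \<Rightarrow> int" and lam b :: "nat \<Rightarrow> int"
  assumes simplex: "is_simplex n (halfspaces n h b)" and n: "1 \<le> n"
    and upper: "\<And>i k. i < n \<Longrightarrow> k < n \<Longrightarrow> i < k \<Longrightarrow> h i k = 0" and diag: "\<And>k. k < n \<Longrightarrow> h k k \<noteq> 0"
    and kernel: "\<And>k. k < n \<Longrightarrow> (\<Sum>j\<le>n. h j k * lam j) = 0" and pos: "\<And>j. j \<le> n \<Longrightarrow> 0 < lam j"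
  shows "0 < (\<Sum>j\<le>n. b j * lam j)"
proof -
  let ?be = "\<Sum>j\<le>n. b j * lam j"
  let ?r = "\<lambda>j x. \<Sum>k<n. real_of_int (h j k) * x $ k"
  have slack: "(\<Sum>j\<le>n. lam j * (b j - ?r j x)) = ?be" for x :: "real vec"
  proof -
    have "(\<Sum>j\<le>n. lam j * ?r j x) = (\<Sum>k<n. real_of_int (\<Sum>j\<le>n. h j k * lam j) * x $ k)"
      unfolding of_int_sum sum_distrib_left sum_distrib_right
      by (subst sum.swap) (simp add: mult_ac)
    then have "(\<Sum>j\<le>n. lam j * ?r j x) = 0" using kernel by simp
    then show ?thesis by (simp add: right_diff_distrib sum_subtractf mult.commute)
  qed
  have nonneg: "0 \<le> lam j * (b j - ?r j x)" if "x \<in> halfspaces n h b" "j \<le> n" for x j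
    using that pos[of j] by (intro mult_nonneg_nonneg) (auto simp: halfspaces_def)
  obtain p q l where pq: "p \<in> halfspaces n h b" "q \<in> halfspaces n h b" "l < n" "p $ l \<noteq> q $ l"
    using simplex_distinct_points[OF simplex n] by blast
  have "0 \<le> (\<Sum>j\<le>n. lam j * (b j - ?r j p))" by (rule sum_nonneg) (use nonneg[OF pq(1)] in auto)
  then have be0: "0 \<le> ?be" unfolding slack by linarith
  moreover have "?be \<noteq> 0"
  proof
    assume z: "?be = 0"
    have tight: "?r j x = b j" if x: "x \<in> halfspaces n h b" and j: "j \<le> n" for x j
    proof -
      have "(\<Sum>j\<le>n. lam j * (b j - ?r j x)) = 0" unfolding slack z by simp
      then have "lam j * (b j - ?r j x) = 0"
        using sum_nonneg_eq_0_iff[of "{..n}" "\<lambda>j. lam j * (b j - ?r j x)"] nonneg[OF x] j by auto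
      then show ?thesis using pos[OF j] by simp
    qed
    have "p $ l - q $ l = 0"
    proof (rule triangular_injective[of n "\<lambda>j k. real_of_int (h j k)" "\<lambda>k. p $ k - q $ k"])
      show "(\<Sum>k<n. real_of_int (h j k) * (p $ k - q $ k)) = 0" if "j < n" for j
        using tight[OF pq(1), of j] tight[OF pq(2), of j] that by (simp add: right_diff_distrib sum_subtractf)
    qed (use upper diag pq in auto)
    then show False using pq(4) by simp
  qed
  ultimately show ?thesis by simp
qed

section \<open>Input encoding, the lower bound on the determinant and the size of registers\<close>

lemma concat_rows:
  assumes "0 < n"
  shows "concat (map (\<lambda>i. map (f i) [0..<n]) [0..<m]) = map (\<lambda>e. f (e div n) (e mod n)) [0..<m * n]"
proof (induction m)
  case (Suc m)
  have "Suc m * n = m * n + n" by simp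
  then have "[0..<Suc m * n] = [0..<m * n] @ [m * n..<m * n + n]"
    by (simp only: upt_add_eq_append[OF le0])
  moreover have "[m * n..<m * n + n] = map (\<lambda>k. m * n + k) [0..<n]"
    by (rule nth_equalityI) auto
  ultimately have "[0..<Suc m * n] = [0..<m * n] @ map (\<lambda>k. m * n + k) [0..<n]" by (simp only:)
  moreover have "map (\<lambda>e. f (e div n) (e mod n)) (map (\<lambda>k. m * n + k) [0..<n]) = map (f m) [0..<n]"
    using assms by auto
  ultimately show ?case using Suc by simp
qed simp

lemma encode_instance_eq:
  assumes H: "H \<in> carrier_mat (n + 1) n" and b: "b \<in> carrier_vec (n + 1)" and n: "0 < n"
  shows "encode_instance n H b =
    int n # map (\<lambda>e. H $$ (e div n, e mod n)) [0..<n * (n + 1)] @ map (\<lambda>j. b $ j) [0..<n + 1]"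
proof -
  have "concat (mat_to_list H) = concat (map (\<lambda>i. map (\<lambda>j. H $$ (i, j)) [0..<n]) [0..<n + 1])"
    using H by (simp add: mat_to_list_def)
  also have "\<dots> = map (\<lambda>e. H $$ (e div n, e mod n)) [0..<(n + 1) * n]"
    by (rule concat_rows[OF n])
  finally show ?thesis using b by (simp add: encode_instance_def list_of_vec_map mult.commute)
qed

text \<open>It remains to see that the vertex given by the first \<open>n\<close> rows satisfies the
  last one. When the block is the identity, the kernel equations weighted with \<open>b\<close> say
  that row \<open>n\<close> takes the value \<open>b n\<close> minus the positive sum
  \<open>\<Sum>j\<le>n. b j * lam j\<close> there.\<close>

lemma lattice_free_det_ge_2:
  fixes h :: "nat \<Rightarrow> nat \<Rightarrow> int" and lam b :: "nat \<Rightarrow> int"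
  assumes upper: "\<And>i k. i < n \<Longrightarrow> k < n \<Longrightarrow> i < k \<Longrightarrow> h i k = 0"
    and rows: "\<And>i k. i < n \<Longrightarrow> k < i \<Longrightarrow> 0 \<le> h i k \<and> h i k < h i i"
    and diag: "\<And>k. k < n \<Longrightarrow> 1 \<le> h k k"
    and last: "lam n = (\<Prod>k<n. h k k)"
    and kernel: "\<And>k. k < n \<Longrightarrow> (\<Sum>j\<le>n. h j k * lam j) = 0"
    and beta: "0 < (\<Sum>j\<le>n. b j * lam j)"
    and free: "halfspaces n h b \<inter> int_points n = {}"
  shows "2 \<le> lam n"
proof (rule ccontr)
  assume "\<not> 2 \<le> lam n"
  then have l1: "lam n \<le> 1" by simp
  have d1: "h k k = 1" if "k < n" for k
  proof -
    have "(\<Prod>i\<in>{k}. h i i) \<le> (\<Prod>i<n. h i i)"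
    proof (rule prod_mono2)
      show "1 \<le> h i i" if "i \<in> {..<n} - {k}" for i using diag[of i] that by simp
      show "0 \<le> h i i" if "i \<in> {k}" for i using diag[of k] \<open>k < n\<close> that by simp
    qed (use that in simp_all)
    then show ?thesis using l1 diag[OF that] by (simp add: last)
  qed
  then have ln: "lam n = 1" by (simp add: last)
  have unit: "h j k = (if j = k then 1 else 0)" if "j < n" "k < n" for j k
  proof (cases j k rule: linorder_cases)
    case less
    then show ?thesis using upper[OF that] by simp
  next
    case equal
    then show ?thesis using d1[OF that(1)] by simp
  next
    case greater
    then show ?thesis using rows[OF that(1) greater] d1[OF that(1)] by simp
  qed
  have row: "(\<Sum>k<n. h j k * b k) = b j" if "j < n" for j
  proof -
    have "(\<Sum>k<n. h j k * b k) = (\<Sum>k<n. if k = j then b j else 0)"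
      by (rule sum.cong) (use unit that in auto)
    then show ?thesis using that by simp
  qed
  have "0 = (\<Sum>k<n. (\<Sum>j\<le>n. h j k * lam j) * b k)" using kernel by simp
  also have "\<dots> = (\<Sum>j\<le>n. lam j * (\<Sum>k<n. h j k * b k))"
    unfolding sum_distrib_left sum_distrib_right by (subst sum.swap) (simp add: mult_ac)
  also have "\<dots> = (\<Sum>j<n. lam j * b j) + (\<Sum>k<n. h n k * b k)"
    using row ln by (simp add: lessThan_Suc_atMost[symmetric])
  finally have "(\<Sum>k<n. h n k * b k) = b n - (\<Sum>j\<le>n. b j * lam j)"
    using ln by (simp add: lessThan_Suc_atMost[symmetric] mult.commute)
  then have last_row: "(\<Sum>k<n. h n k * b k) \<le> b n" using beta by simp
  let ?x = "map_vec real_of_int (vec n b)"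
  have "(\<Sum>k<n. real_of_int (h j k) * ?x $ k) \<le> b j" if "j \<le> n" for j
  proof -
    have "(\<Sum>k<n. real_of_int (h j k) * ?x $ k) = real_of_int (\<Sum>k<n. h j k * b k)"
      by simp
    moreover have "(\<Sum>k<n. h j k * b k) \<le> b j" using row[of j] last_row that by (cases "j = n") auto
    ultimately show ?thesis by linarith
  qed
  then have "?x \<in> halfspaces n h b" by (simp add: halfspaces_def)
  moreover have "?x \<in> int_points n" unfolding int_points_def by (rule imageI) simp
  ultimately show False using free by blast
qed

text \<open>From \<open>n + 1 \<le> 2 * n\<close> the factor 64 becomes \<open>512 = 2 ^ 9\<close>.
  With one more bit for the passage from logarithm to length this makes 10, absorbed by
  \<open>10 * log 2 G\<close> because \<open>G \<ge> 2\<close>; together with the exponent 6 of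
  \<open>G\<close> this gives 16.\<close>

lemma bit_size_le_log:
  fixes n G :: nat
  assumes "1 \<le> n" "2 \<le> G" "V = 64 * (int (n + 1) ^ 3 * int G ^ 6)"
  shows "real (bit_size V) \<le> 16 * (log 2 G + log 2 n)"
proof -
  define N where "N = 64 * ((n + 1) ^ 3 * G ^ 6)"
  have V: "V = int N" using assms(3) unfolding N_def by simp
  have pos: "0 < N" using assms(2) unfolding N_def by simp
  have bs: "bit_size V = max 1 (floorlog 2 N)" unfolding bit_size_def V by (simp only: abs_of_nat nat_int)
  have N1: "1 \<le> real N" using pos by linarith
  then have L0: "0 \<le> log 2 (real N)" by simp
  then have "real (floorlog 2 N) \<le> log 2 (real N) + 1" using pos by (simp add: floorlog_def)
  then have fl: "real (bit_size V) \<le> log 2 (real N) + 1" unfolding bs using L0 by (simp add: max_def)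
  have "(n + 1) ^ 3 \<le> (2 * n) ^ 3" using assms(1) by (intro power_mono) auto
  then have "(n + 1) ^ 3 * G ^ 6 \<le> 8 * n ^ 3 * G ^ 6"
    unfolding power_mult_distrib by (intro mult_right_mono) simp_all
  then have "N \<le> 512 * (n ^ 3 * G ^ 6)" unfolding N_def by linarith
  then have "real N \<le> real (512 * (n ^ 3 * G ^ 6))" by (simp only: of_nat_le_iff)
  then have le: "real N \<le> 512 * (real n ^ 3 * real G ^ 6)" by simp
  have "log 2 (real N) \<le> log 2 (512 * (real n ^ 3 * real G ^ 6))"
    by (rule log_mono[OF _ _ le]) (use N1 in linarith)+
  also have "\<dots> = log 2 512 + (log 2 (real n ^ 3) + log 2 (real G ^ 6))"
    using assms(1,2) by (subst log_mult_pos, simp, simp, subst log_mult_pos) simp_all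
  also have "\<dots> = 9 + (3 * log 2 n + 6 * log 2 G)"
  proof -
    have "log 2 512 = (9 :: real)" using log_pow_cancel[of "2 :: real" 9] by simp
    moreover have "log 2 (real n ^ 3) = 3 * log 2 n" using log_nat_power[of "real n" 2 3] assms(1) by simp
    moreover have "log 2 (real G ^ 6) = 6 * log 2 G" using log_nat_power[of "real G" 2 6] assms(2) by simp
    ultimately show ?thesis by linarith
  qed
  finally have L: "log 2 (real N) \<le> 9 + (3 * log 2 n + 6 * log 2 G)" .
  have "1 \<le> log 2 (real G)" using assms(2) by (simp add: le_log_iff)
  moreover have "0 \<le> log 2 (real n)" using assms(1) by simp
  ultimately show ?thesis using L fl by argo
qed

theorem theorem5:
  fixes mult_time :: "nat \<Rightarrow> real"
  assumes "multiplication_time mult_time"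
  shows "\<exists>(prog :: program) (C :: real).
    \<forall>(n :: nat) (H :: int mat) (b :: int vec).
      n \<ge> 1 \<and>
      H \<in> carrier_mat (n + 1) n \<and>
      int_rank H = n \<and>
      reduced_HNF n H \<and>
      b \<in> carrier_vec (n + 1) \<and>
      is_simplex n (polyhedron H b) \<and>
      polyhedron H b \<inter> int_points n = {}
      \<longrightarrow>
      solves_width_in_time prog n H b
        (C * (log 2 (Delta H) * real n ^ 4 * real_of_int (Delta H) ^ 4 *
              mult_time (nat \<lceil>real n ^ 3 * log 2 (Delta_aug H b) + real n ^ 3 * log 2 n\<rceil>)))"
proof (intro exI allI impI, elim conjE)
  fix n :: nat and H :: "int mat" and b :: "int vec"
  assume n: "n \<ge> 1" and H: "H \<in> carrier_mat (n + 1) n" and rank: "int_rank H = n"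
    and hnf: "reduced_HNF n H" and b: "b \<in> carrier_vec (n + 1)"
    and simplex: "is_simplex n (polyhedron H b)" and free: "polyhedron H b \<inter> int_points n = {}"
  define h where "h j k = H $$ (j, k)" for j k
  define bb where "bb j = b $ j" for j
  define lam where "lam = row_relation H b"
  define E where "E = nat (Delta H)"
  have poly: "polyhedron H b = halfspaces n h bb"
    using polyhedron_halfspaces[OF H b] by (simp add: h_def[abs_def] bb_def[abs_def])
  have upper: "h i k = 0" if "i < n" "k < n" "i < k" for i k
    using hnf that by (simp add: reduced_HNF_def h_def)
  have rows: "0 \<le> h i k \<and> h i k < h i i" if "i < n" "k < i" for i k
    using hnf that by (simp add: reduced_HNF_def h_def)
  have diag: "1 \<le> h k k" if "k < n" for k
  proof -
    have "\<exists>s\<le>n. (\<forall>i<s. H $$ (i, i) = 1) \<and> (\<forall>i. s \<le> i \<and> i < n \<longrightarrow> H $$ (i, i) \<ge> 2)"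
      using hnf unfolding reduced_HNF_def by (elim conjE)
    then obtain s where s: "\<And>i. i < s \<Longrightarrow> H $$ (i, i) = 1" "\<And>i. s \<le> i \<Longrightarrow> i < n \<Longrightarrow> H $$ (i, i) \<ge> 2"
      by auto
    show ?thesis
    proof (cases "k < s")
      case False
      then show ?thesis using s(2)[of k] that by (simp add: h_def)
    qed (simp add: h_def s)
  qed
  have kernel: "(\<Sum>j\<le>n. h j k * lam j) = 0" if "k < n" for k
    using row_relation_kernel[OF H b that] by (simp add: h_def lam_def)
  have last: "lam n = (\<Prod>k<n. h k k)"
    using row_relation_last[OF H b] upper by (simp add: h_def lam_def)
  have diag0: "h k k \<noteq> 0" if "k < n" for k using diag[OF that] by simp
  have last_pos: "0 < lam n"
    unfolding last
  proof (rule prod_pos)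
    fix k assume "k \<in> {..<n}"
    then show "0 < h k k" using diag[of k] by simp
  qed
  have pos: "0 < lam j" if "j \<le> n" for j
    by (rule kernel_pos[OF simplex[unfolded poly] n upper diag0 kernel last_pos that])
  have lam_le: "lam j \<le> Delta H" if "j \<le> n" for j
    using row_relation_le[OF H b that] rank by (simp add: lam_def Delta_def)
  have beta: "0 < (\<Sum>j\<le>n. bb j * lam j)"
    by (rule beta_pos_of_simplex[OF simplex[unfolded poly] n upper diag0 kernel pos])
  have last2: "2 \<le> lam n"
    by (rule lattice_free_det_ge_2[OF upper rows diag last kernel beta free[unfolded poly]])
  have E: "2 \<le> E" "int E = Delta H" using last2 lam_le[of n] by (auto simp: E_def)
  interpret simplex_matrix n h lam E
  proof
    show "1 \<le> lam j" "lam j \<le> int E" if "j \<le> n" for j using pos[OF that] lam_le[OF that] E by auto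
  qed (fact n E(1) upper rows diag last kernel)+
  interpret width_simplex n h lam E bb by standard (rule beta)
  define G where "G = nat (Delta_aug H b)"
  have EG: "E \<le> G" using max_minor_le_aug[OF H b] rank by (simp add: E_def G_def Delta_def nat_mono)
  then have G: "2 \<le> G" "int G = Delta_aug H b" using E by (auto simp: G_def)
  \<comment> \<open>Large enough for the search, which needs
    \<open>64 * (n + 1) ^ 3 * E ^ 5\<close>, and for the printed numerator, which is of order
    \<open>n ^ 3 * E ^ 4 * G\<close>.\<close>
  define V where "V = 64 * (int (n + 1) ^ 3 * int G ^ 6)"
  interpret width_program n h lam E V
  proof
    have "int E ^ 5 \<le> int G ^ 6"
    proof -
      have "int E ^ 5 \<le> int G ^ 5" using EG by (intro power_mono) auto
      also have "\<dots> \<le> int G ^ 6" using G by (intro power_increasing) auto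
      finally show ?thesis .
    qed
    then show "64 * int ((n + 1) ^ 3) * int E ^ 5 \<le> V" by (simp add: V_def)
  qed
  \<comment> \<open>Bound on the entries of \<open>b\<close>: \<open>n\<close> summands, each a
    matrix entry of size up to \<open>n * E\<close> times a cofactor of size up to
    \<open>G\<close>.\<close>
  define B where "B = int (n * (n * E)) * int G"
  have bB: "\<bar>bb j\<bar> \<le> B" if j: "j \<le> n" for j
  proof -
    \<comment> \<open>Any row other than \<open>j\<close> will do. Its coefficient
      \<open>lam i\<close> is at least 1, so dividing by it does not enlarge the bound.\<close>
    define i where "i = (if j = 0 then 1 else 0 :: nat)"
    have i: "i \<le> n" "i \<noteq> j" using n by (auto simp: i_def)
    have "bb j * lam i = - (\<Sum>k<n. h j k * cofactor (augmented H b) i k)"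
      using cofactor_row[OF H b i(1) j i(2)] by (simp add: bb_def lam_def h_def)
    then have "\<bar>bb j * lam i\<bar> = \<bar>\<Sum>k<n. h j k * cofactor (augmented H b) i k\<bar>" by simp
    also have "\<dots> \<le> (\<Sum>k<n. \<bar>h j k * cofactor (augmented H b) i k\<bar>)" by (rule sum_abs)
    also have "\<dots> \<le> of_nat (card {..<n}) * (int (n * E) * int G)"
    proof (rule sum_bounded_above)
      fix k assume k: "k \<in> {..<n}"
      have "\<bar>cofactor (augmented H b) i k\<bar> \<le> int G"
        using cofactor_le_max_minor[OF augmented_carrier[OF H] i(1), of k] k H G by (simp add: Delta_aug_def)
      then show "\<bar>h j k * cofactor (augmented H b) i k\<bar> \<le> int (n * E) * int G"
        unfolding abs_mult using entry_le[OF j, of k] k by (intro mult_mono) auto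
    qed
    also have "\<dots> = B" by (simp add: B_def)
    finally have "\<bar>bb j\<bar> * lam i \<le> B" using lam_pos[OF i(1)] by (simp add: abs_mult)
    moreover have "\<bar>bb j\<bar> * 1 \<le> \<bar>bb j\<bar> * lam i" using lam_pos[OF i(1)] by (intro mult_left_mono) auto
    ultimately show ?thesis by simp
  qed
  have BV: "int (n + 1) * (int E ^ 3 * B) \<le> V"
  proof -
    have "int (n + 1) * (int E ^ 3 * B) = int ((n + 1) * (n * n)) * (int E ^ 4 * int G)"
      by (simp add: B_def power_numeral_reduce algebra_simps)
    also have "\<dots> \<le> int ((n + 1) ^ 3) * int G ^ 6"
    proof (intro mult_mono)
      show "int ((n + 1) * (n * n)) \<le> int ((n + 1) ^ 3)"
        unfolding of_nat_le_iff power3_eq_cube mult.assoc by (intro mult_mono) auto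
      have "int E ^ 4 * int G \<le> int G ^ 4 * int G" using EG by (intro mult_right_mono power_mono) auto
      also have "\<dots> = int G ^ 5" by (simp add: power_numeral_reduce)
      also have "\<dots> \<le> int G ^ 6" using G by (intro power_increasing) auto
      finally show "int E ^ 4 * int G \<le> int G ^ 6" .
    qed auto
    also have "\<dots> \<le> V" unfolding V_def by simp
    finally show ?thesis .
  qed
  obtain t R P Z M X where
    ex: "exec Width_Program (\<lambda>_. 0, int n # map (\<lambda>e. h (e div n) (e mod n)) [0..<n * (n + 1)] @ map bb [0..<n + 1], [])
       t (R, [], [(\<Sum>j\<le>n. bb j * lam j) * P, Z] @ map (\<lambda>k. (\<Sum>j\<le>n. h j k * X j) div M) [0..<n])"
    and t: "t \<le> 3000 * ((n + 1) ^ 3 * E ^ 4) * (3 * bit_size V)"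
    and P: "1 \<le> P" and good: "good P Z M X"
    and low: "\<And>a i m. int a < lam n \<Longrightarrow> i \<le> n \<Longrightarrow> int m < lam i \<Longrightarrow>
       \<exists>k\<le>n. P * (lam n * lam i * lam k) \<le> cand a i m k * Z"
    by (rule run_Width_Program[where b = bb and B = B, OF bB BV]) (assumption, rule that)
  define c where "c = vec n (\<lambda>k. (\<Sum>j\<le>n. h j k * X j) div M)"
  have enc: "encode_instance n H b =
      int n # map (\<lambda>e. h (e div n) (e mod n)) [0..<n * (n + 1)] @ map bb [0..<n + 1]"
    unfolding h_def bb_def by (rule encode_instance_eq[OF H b]) (use n in simp)
  have comp: "computes Width_Program (encode_instance n H b) t (beta * P # Z # list_of_vec c)"
    unfolding computes_def enc beta_def c_def using ex by auto
  have width: "width n (halfspaces n h bb) = real_of_int (beta * P) / real_of_int Z"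
    and flat: "flat_direction n (halfspaces n h bb) c"
    using width_of_best[OF good P low c_def] by auto
  have Z: "0 < Z" using good by (auto simp: good_def)
  let ?k = "nat \<lceil>real n ^ 3 * log 2 (Delta_aug H b) + real n ^ 3 * log 2 n\<rceil>"
  let ?L = "log 2 G + log 2 n"
  have logs: "1 \<le> log 2 (real G)" "0 \<le> log 2 (real n)" "1 \<le> log 2 (real E)"
    using G E n by (simp_all add: le_log_iff)
  \<comment> \<open>The constant is \<open>3000 * 3 * 8 * 16\<close>: instructions, integers handled
    per instruction, \<open>(n + 1) ^ 3 \<le> 8 * n ^ 3\<close>, and the bit length of
    \<open>V\<close>. The remaining factors \<open>log 2 E\<close> and \<open>n\<close> of the bound
    are at least 1.\<close>
  have time: "real t \<le> 1152000 * (log 2 (Delta H) * real n ^ 4 * real_of_int (Delta H) ^ 4 * mult_time ?k)"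
  proof -
    have n1: "1 \<le> real n ^ 3" using n by simp
    have G': "real_of_int (Delta_aug H b) = real G" using G(2) by (metis of_int_of_nat_eq)
    have E': "real_of_int (Delta H) = real E" using E(2) by (metis of_int_of_nat_eq)
    have "1 * ?L \<le> real n ^ 3 * ?L" using n1 logs by (intro mult_right_mono) auto
    also have "\<dots> = real n ^ 3 * log 2 (Delta_aug H b) + real n ^ 3 * log 2 n"
      unfolding G' by (simp add: distrib_left)
    finally have L: "?L \<le> real n ^ 3 * log 2 (Delta_aug H b) + real n ^ 3 * log 2 n" by simp
    then have "1 \<le> ?k" using logs by linarith
    then have "real ?k \<le> mult_time ?k" by (rule multiplication_time_ge[OF assms])
    moreover have "?L \<le> real ?k" using L logs by linarith
    ultimately have mt: "?L \<le> mult_time ?k" by linarith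
    have bs: "real (bit_size V) \<le> 16 * ?L" by (rule bit_size_le_log[OF n G(1) V_def])
    have "(n + 1) ^ 3 \<le> (2 * n) ^ 3" using n by (intro power_mono) auto
    then have n3: "(n + 1) ^ 3 \<le> 8 * n ^ 3" by (simp add: power_mult_distrib)
    have "real t \<le> real (3000 * ((n + 1) ^ 3 * E ^ 4) * (3 * bit_size V))" using t by (simp only: of_nat_le_iff)
    also have "\<dots> = 9000 * (real ((n + 1) ^ 3) * real E ^ 4 * real (bit_size V))" by simp
    also have "\<dots> \<le> 9000 * (real (8 * n ^ 3) * real E ^ 4 * (16 * mult_time ?k))"
    proof (intro mult_left_mono mult_mono)
      show "real ((n + 1) ^ 3) \<le> real (8 * n ^ 3)" using n3 by (simp only: of_nat_le_iff)
      show "real (bit_size V) \<le> 16 * mult_time ?k"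
        by (rule order_trans[OF bs mult_left_mono[OF mt]]) simp
    qed simp_all
    also have "\<dots> = 1152000 * (real n ^ 3 * real E ^ 4 * mult_time ?k)" by simp
    also have "\<dots> \<le> 1152000 * (log 2 (real E) * real n ^ 4 * real E ^ 4 * mult_time ?k)"
    proof -
      have "1 * real n ^ 3 \<le> log 2 (real E) * real n ^ 4"
        using logs n by (intro mult_mono power_increasing) auto
      then have "real n ^ 3 * (real E ^ 4 * mult_time ?k) \<le> (log 2 (real E) * real n ^ 4) * (real E ^ 4 * mult_time ?k)"
        using mt logs by (intro mult_right_mono) auto
      then show ?thesis by (simp add: mult.assoc)
    qed
    finally show ?thesis unfolding E' .
  qed
  show "solves_width_in_time Width_Program n H b (1152000 * (log 2 (Delta H) * real n ^ 4 * real_of_int (Delta H) ^ 4 *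
              mult_time (nat \<lceil>real n ^ 3 * log 2 (Delta_aug H b) + real n ^ 3 * log 2 n\<rceil>)))"
    unfolding solves_width_in_time_def poly
    by (intro exI conjI) (fact comp Z width flat time)+
qed

end
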